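(* For every $n\ge1$, the least constant $\beta_n$ such that $$\mu(a_n\cos nt+b_n\sin nt)\le\beta_n\,\mu(f)$$ holds for all $f(t)=\frac{a_0}2+\sum_{k=1}^n(a_k\cos kt+b_k\sin kt)\in\mathcal{F}_n$ equals $\beta_n=\sqrt{2n}$.
   Context: $\mathcal{F}_n$ is the set of real trigonometric polynomials of order at most $n$ with real coefficients. $\mathbb{T}=[0,2\pi)$ with endpoints identified, with Lebesgue measure $\mathrm{mes}$, and for a real function $f$ on $\mathbb{T}$, $\mu(f)=\mathrm{mes}\{t\in\mathbb{T}:|f(t)|\ge1\}$. *)

theory Defs
  imports "HOL-Analysis.Analysis"
begin

definition trigpoly :: "nat \<Rightarrow> (nat \<Rightarrow> real) \<Rightarrow> (nat \<Rightarrow> real) \<Rightarrow> real \<Rightarrow> real" where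
  "trigpoly n a b t = a 0 / 2 + (\<Sum>k=1..n. a k * cos (real k * t) + b k * sin (real k * t))"

definition mu :: "(real \<Rightarrow> real) \<Rightarrow> real" where
  "mu f = measure lebesgue {t \<in> {0..<2*pi}. \<bar>f t\<bar> \<ge> 1}"

end

theory Submission
  imports Defs "HOL-Complex_Analysis.Complex_Analysis" "HOL-Combinatorics.Permutations"
    "HOL-Real_Asymp.Real_Asymp"
begin

text \<open>Let \<open>w = arcosh (max 1 \<bar>f\<bar>)\<close>, let \<open>A\<close> be the amplitude of the leading harmonic of \<open>f\<close> and
  \<open>m = \<mu>(f)\<close>. With \<open>g\<close> the Green function of the complement of \<open>[-1, 1]\<close>, the function
  \<open>n log \<bar>z\<bar> + g(f(z))\<close> is subharmonic in the disc, has boundary values \<open>w\<close> and equals \<open>log A\<close> at \<open>0\<close>; in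
  the proofs it is approximated by \<open>log \<bar>z\<^sup>n\<^sup>k T\<^sub>k(f(z))\<bar> / k\<close> with the Chebyshev polynomials \<open>T\<^sub>k\<close>.
  Hence the mean of \<open>w\<close> is at least \<open>log A\<close>, and the Dirichlet energy of \<open>w\<close>, the limit as \<open>r \<rightarrow> 1\<close> of
  \<open>\<integral>w (w - P\<^sub>r w) / (1 - r)\<close> with the Poisson kernel \<open>P\<^sub>r\<close>, is at most \<open>n \<integral>w\<close>.
  Symmetric rearrangement of \<open>w\<close> on the circle does not increase this energy and moves the support
  of \<open>w\<close> into an arc of length \<open>m\<close>. Comparing with the explicit extremal function of a slightly longer
  arc gives \<open>A \<le> cos (m / 4) powr (- 2 n)\<close>, with equality for \<open>T\<^sub>2\<^sub>n (cos (t / 2) / cos (m / 4))\<close>.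
  The theorem follows from \<open>cos (sqrt (2 n) x) \<le> cos x ^ (2 n)\<close>, which is sharp as \<open>x \<rightarrow> 0\<close>.
  All integrals are replaced by averages over a grid of \<open>2 M + 1\<close> equidistant nodes,
  with \<open>M \<rightarrow> \<infinity>\<close>; then the rearrangement is a finite combinatorial problem.\<close>

section \<open>Rearrangement on a finite cyclic grid\<close>

text \<open>The comparison is a completed square. Let W be the mean of \<open>w\<close>, let v be
  the extremal function of the arc for order 1 and K its mean. In the limit the energy form E
  satisfies E(w, w) <= n W for the rearranged \<open>w\<close>; E(w, v) >= W, because the normal
  derivative of v is 1 on the arc that carries \<open>w\<close>; and E(v, v) <= K, because v is
  nonnegative and this derivative is at most 1 everywhere. Hence 0 <= E(w - n v, w - n v) <= n W - 2
  n W + n^2 K, that is, W <= n K, while \<open>ln A <= W\<close>. The arc is lengthened because the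
  estimate of the normal derivative degenerates at its end points. The obstacle in the energy bound
  is that arcosh is not Lipschitz at 1; comparing hyperbolic cosines instead leaves only values of
  f. A fixed grid could meet the set of large values too often, so the grid carries a free shift.
  The constant comes from cos(x)^(2n) = 1 - n x^2 + ... and cos(c x) = 1 - c^2 x^2 / 2 + ..., which
  agree to second order for c^2 = 2n.\<close>

lemma rearrange_two:
  fixes a a' b b' K L :: real
  assumes "L \<le> K"
  shows "(a * b + a' * b') * K + (a * b' + a' * b) * L
       \<le> (max a a' * max b b' + min a a' * min b b') * K + (max a a' * min b b' + min a a' * max b b') * L"
proof -
  \<comment> \<open>Only oppositely ordered pairs change, and this product is exactly what the
    exchange gains.\<close>
  have "0 \<le> (a - a') * (b' - b) * (K - L)" if "a' \<le> a" "b \<le> b'" using that assms by simp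
  moreover have "0 \<le> (a' - a) * (b - b') * (K - L)" if "a \<le> a'" "b' \<le> b" using that assms by simp
  ultimately show ?thesis
    by (cases "a \<le> a'"; cases "b \<le> b'") (auto simp: max_def min_def algebra_simps)
qed

text \<open>Collects the four pairs obtained by applying \<open>\<tau>\<close> to either coordinate,
  the unit on which \<open>rearrange_two\<close> acts. The factor 4 avoids choosing orbit
  representatives and treating fixed points apart.\<close>

lemma sum_pairs_involution:
  fixes F :: "'a \<Rightarrow> 'a \<Rightarrow> real"
  assumes "\<And>x. x \<in> X \<Longrightarrow> \<tau> x \<in> X" "\<And>x. x \<in> X \<Longrightarrow> \<tau> (\<tau> x) = x"
  shows "4 * (\<Sum>x\<in>X. \<Sum>y\<in>X. F x y) = (\<Sum>x\<in>X. \<Sum>y\<in>X. F x y + F (\<tau> x) (\<tau> y) + F x (\<tau> y) + F (\<tau> x) y)"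
proof -
  have r: "(\<Sum>x\<in>X. g (\<tau> x)) = (\<Sum>x\<in>X. g x)" for g :: "'a \<Rightarrow> real"
    by (rule sum.reindex_bij_witness[where i=\<tau> and j=\<tau>]) (use assms in auto)
  have "(\<Sum>x\<in>X. \<Sum>y\<in>X. F x (\<tau> y)) = (\<Sum>x\<in>X. \<Sum>y\<in>X. F x y)"
    by (intro sum.cong refl r)
  moreover have "(\<Sum>x\<in>X. \<Sum>y\<in>X. F (\<tau> x) y) = (\<Sum>x\<in>X. \<Sum>y\<in>X. F x y)"
    by (rule r[of "\<lambda>x. \<Sum>y\<in>X. F x y"])
  moreover have "(\<Sum>x\<in>X. \<Sum>y\<in>X. F (\<tau> x) (\<tau> y)) = (\<Sum>x\<in>X. \<Sum>y\<in>X. F x y)"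
    using r[of "\<lambda>x. \<Sum>y\<in>X. F x (\<tau> y)"] r[of "F _"] by simp
  ultimately show ?thesis by (simp add: sum.distrib)
qed

text \<open>Two-point symmetrization: \<open>\<tau>\<close> is a reflection and \<open>H\<close> the preferred half of the circle.\<close>

lemma polarization_form_mono:
  fixes \<kappa> :: "'a \<Rightarrow> 'a \<Rightarrow> real"
  assumes inv: "\<And>x. x \<in> X \<Longrightarrow> \<tau> x \<in> X" "\<And>x. x \<in> X \<Longrightarrow> \<tau> (\<tau> x) = x"
    and \<kappa>: "\<And>x y. x \<in> X \<Longrightarrow> y \<in> X \<Longrightarrow> \<kappa> (\<tau> x) (\<tau> y) = \<kappa> x y"
    and H: "\<And>x. x \<in> X \<Longrightarrow> x \<in> H \<or> \<tau> x \<in> H" "\<And>x. x \<in> X \<Longrightarrow> x \<in> H \<Longrightarrow> \<tau> x \<in> H \<Longrightarrow> \<tau> x = x"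
    and le: "\<And>x y. x \<in> X \<Longrightarrow> y \<in> X \<Longrightarrow> x \<in> H \<Longrightarrow> y \<in> H \<Longrightarrow> \<kappa> x (\<tau> y) \<le> \<kappa> x y"
  defines "pol \<equiv> \<lambda>u :: 'a \<Rightarrow> real. \<lambda>x. if x \<in> H then max (u x) (u (\<tau> x)) else min (u x) (u (\<tau> x))"
  shows "(\<Sum>x\<in>X. \<Sum>y\<in>X. \<kappa> x y * u x * u y) \<le> (\<Sum>x\<in>X. \<Sum>y\<in>X. \<kappa> x y * pol u x * pol u y)"
proof -
  define B where "B u x y = (u x * u y + u (\<tau> x) * u (\<tau> y)) * \<kappa> x y + (u x * u (\<tau> y) + u (\<tau> x) * u y) * \<kappa> x (\<tau> y)"
    for u :: "'a \<Rightarrow> real" and x y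
  have \<kappa>2: "\<kappa> (\<tau> x) y = \<kappa> x (\<tau> y)" if "x \<in> X" "y \<in> X" for x y
    using \<kappa>[of x "\<tau> y"] inv that by auto
  have four: "4 * (\<Sum>x\<in>X. \<Sum>y\<in>X. \<kappa> x y * u x * u y) = (\<Sum>x\<in>X. \<Sum>y\<in>X. B u x y)" for u
    unfolding sum_pairs_involution[OF inv, where F="\<lambda>x y. \<kappa> x y * u x * u y", simplified]
    by (intro sum.cong refl) (simp add: B_def \<kappa> \<kappa>2 algebra_simps)
  have B1: "B u (\<tau> x) y = B u x y" and B2: "B u x (\<tau> y) = B u x y" if "x \<in> X" "y \<in> X" for u x y
    using that by (simp_all add: B_def \<kappa> \<kappa>2 inv algebra_simps)
  have P: "pol u x = max (u x) (u (\<tau> x))" "pol u (\<tau> x) = min (u x) (u (\<tau> x))" if "x \<in> X" "x \<in> H" for x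
    using that H(2)[OF that] inv[OF that(1)] by (auto simp: pol_def)
  have HH: "B u x y \<le> B (pol u) x y" if "x \<in> X" "y \<in> X" "x \<in> H" "y \<in> H" for x y
    using rearrange_two[OF le[OF that], of "u x" "u y" "u (\<tau> x)" "u (\<tau> y)"]
    by (simp add: B_def P that)
  \<comment> \<open>\<open>B\<close> does not change when either argument is reflected, so both can
    be moved into \<open>H\<close>, where \<open>le\<close> is available.\<close>
  have "B u x y \<le> B (pol u) x y" if xy: "x \<in> X" "y \<in> X" for x y
    using HH[of x y] HH[of "\<tau> x" y] HH[of x "\<tau> y"] HH[of "\<tau> x" "\<tau> y"] H(1)[OF xy(1)] H(1)[OF xy(2)]
      B1[OF xy] B2[OF xy] B1[of x "\<tau> y"] inv xy by metis
  then have "(\<Sum>x\<in>X. \<Sum>y\<in>X. B u x y) \<le> (\<Sum>x\<in>X. \<Sum>y\<in>X. B (pol u) x y)"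
    by (intro sum_mono)
  then show ?thesis using four[of u] four[of "pol u"] by linarith
qed

text \<open>Polarization only exchanges values within orbits of \<open>\<tau>\<close>. Realising it
  by a permutation keeps it inside the finite family over which an optimum is taken.\<close>

lemma polarization_permutes:
  fixes u :: "'a \<Rightarrow> real"
  assumes inv: "\<And>x. x \<in> X \<Longrightarrow> \<tau> x \<in> X" "\<And>x. x \<in> X \<Longrightarrow> \<tau> (\<tau> x) = x"
    and H: "\<And>x. x \<in> X \<Longrightarrow> x \<in> H \<or> \<tau> x \<in> H" "\<And>x. x \<in> X \<Longrightarrow> x \<in> H \<Longrightarrow> \<tau> x \<in> H \<Longrightarrow> \<tau> x = x"
  obtains \<sigma> where "\<sigma> permutes X"
    "\<And>x. x \<in> X \<Longrightarrow> u (\<sigma> x) = (if x \<in> H then max (u x) (u (\<tau> x)) else min (u x) (u (\<tau> x)))"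
proof
  define \<sigma> where "\<sigma> x = (if x \<in> X \<and> (x \<in> H \<and> u x < u (\<tau> x) \<or> x \<notin> H \<and> u (\<tau> x) < u x) then \<tau> x else x)" for x
  have inv\<sigma>: "\<sigma> (\<sigma> x) = x" for x
    using H[of x] H[of "\<tau> x"] inv[of x] by (auto simp: \<sigma>_def)
  show "\<sigma> permutes X"
    unfolding permutes_def
  proof (intro conjI allI impI)
    show "\<sigma> x = x" if "x \<notin> X" for x using that by (simp add: \<sigma>_def)
    show "\<exists>!x. \<sigma> x = y" for y using inv\<sigma> by metis
  qed
  show "u (\<sigma> x) = (if x \<in> H then max (u x) (u (\<tau> x)) else min (u x) (u (\<tau> x)))" if "x \<in> X" for x
    using that by (auto simp: \<sigma>_def max_def min_def)
qed

text \<open>The position \<open>k\<close> of the cyclic grid \<open>-M, \<dots>, M\<close> has rank \<open>zig k\<close> in the order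
  \<open>0, 1, -1, 2, -2, \<dots>\<close>. Neighbours in this order are exchanged by one of the reflections
  \<open>k \<mapsto> -k\<close> and \<open>k \<mapsto> 1 - k\<close>.\<close>

definition zig :: "int \<Rightarrow> int" where
  "zig k = (if k > 0 then 2 * k - 1 else - 2 * k)"

definition grid_step :: "nat \<Rightarrow> real" where
  "grid_step M = 2 * pi / (2 * real M + 1)"

text \<open>An extremal choice replaces iterated symmetrization: among the permutations that
  maximise \<open>Q\<close>, take one that minimises the rank-weighted sum \<open>W\<close>.
  Polarizing cannot lower \<open>Q\<close>, and it strictly lowers \<open>W\<close> as soon as one
  reflected pair is in the wrong order.\<close>

lemma cyclic_riesz_rearrangement:
  fixes u :: "int \<Rightarrow> real" and K :: "real \<Rightarrow> real" and M :: nat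
  assumes K: "\<And>x y. -1 \<le> x \<Longrightarrow> x \<le> y \<Longrightarrow> y \<le> 1 \<Longrightarrow> K x \<le> K y"
  defines "X \<equiv> {- int M..int M}"
  defines "Q \<equiv> \<lambda>u. \<Sum>x\<in>X. \<Sum>y\<in>X. K (cos (of_int (x - y) * grid_step M)) * u x * u y"
  obtains \<sigma> where "\<sigma> permutes X" "Q u \<le> Q (u \<circ> \<sigma>)"
    "\<And>x y. x \<in> X \<Longrightarrow> y \<in> X \<Longrightarrow> zig x \<le> zig y \<Longrightarrow> u (\<sigma> y) \<le> u (\<sigma> x)"
proof -
  let ?h = "grid_step M"
  define S where "S = {\<sigma>. \<sigma> permutes X}"
  define W where "W \<sigma> = (\<Sum>x\<in>X. of_int (zig x) * u (\<sigma> x))" for \<sigma> :: "int \<Rightarrow> int"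
  have finX: "finite X" by (simp add: X_def)
  have finS: "finite S" unfolding S_def using finX by (rule finite_permutations)
  have "id \<in> S" by (simp add: S_def permutes_id)
  define S' where "S' = {\<sigma> \<in> S. \<forall>\<rho>\<in>S. Q (u \<circ> \<rho>) \<le> Q (u \<circ> \<sigma>)}"
  have "Max ((\<lambda>\<sigma>. Q (u \<circ> \<sigma>)) ` S) \<in> (\<lambda>\<sigma>. Q (u \<circ> \<sigma>)) ` S"
    using finS \<open>id \<in> S\<close> by (intro Max_in) auto
  then obtain \<sigma>0 where "\<sigma>0 \<in> S" "Q (u \<circ> \<sigma>0) = Max ((\<lambda>\<sigma>. Q (u \<circ> \<sigma>)) ` S)" by auto
  then have "\<sigma>0 \<in> S'" using finS by (auto simp: S'_def)
  have finS': "finite S'" using finS by (simp add: S'_def)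
  have "Min (W ` S') \<in> W ` S'" using finS' \<open>\<sigma>0 \<in> S'\<close> by (intro Min_in) auto
  then obtain \<sigma> where \<sigma>: "\<sigma> \<in> S'" and "W \<sigma> = Min (W ` S')" by auto
  then have minW: "W \<sigma> \<le> W \<rho>" if "\<rho> \<in> S'" for \<rho> using finS' that by auto
  have \<sigma>S: "\<sigma> permutes X" using \<sigma> by (simp add: S'_def S_def)
  have key: "u (\<sigma> (\<tau> z)) \<le> u (\<sigma> z)"
    if inv: "\<And>x. x \<in> X \<Longrightarrow> \<tau> x \<in> X" "\<And>x. x \<in> X \<Longrightarrow> \<tau> (\<tau> x) = x"
    and \<kappa>: "\<And>x y. x \<in> X \<Longrightarrow> y \<in> X \<Longrightarrow> cos (of_int (\<tau> x - \<tau> y) * ?h) = cos (of_int (x - y) * ?h)"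
    and H: "\<And>x. x \<in> X \<Longrightarrow> x \<in> H \<or> \<tau> x \<in> H" "\<And>x. x \<in> X \<Longrightarrow> x \<in> H \<Longrightarrow> \<tau> x \<in> H \<Longrightarrow> \<tau> x = x"
    and le: "\<And>x y. x \<in> X \<Longrightarrow> y \<in> X \<Longrightarrow> x \<in> H \<Longrightarrow> y \<in> H \<Longrightarrow> cos (of_int (x - \<tau> y) * ?h) \<le> cos (of_int (x - y) * ?h)"
    and zig: "\<And>x. x \<in> X \<Longrightarrow> x \<in> H \<Longrightarrow> \<tau> x \<noteq> x \<Longrightarrow> zig x < zig (\<tau> x)"
    and z: "z \<in> X" "z \<in> H" "\<tau> z \<noteq> z" for \<tau> H z
  proof (rule ccontr)
    assume less: "\<not> u (\<sigma> (\<tau> z)) \<le> u (\<sigma> z)"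
    let ?v = "u \<circ> \<sigma>"
    obtain \<rho> where \<rho>: "\<rho> permutes X"
      and v\<rho>: "\<And>x. x \<in> X \<Longrightarrow> ?v (\<rho> x) = (if x \<in> H then max (?v x) (?v (\<tau> x)) else min (?v x) (?v (\<tau> x)))"
      by (rule polarization_permutes[where X=X and \<tau>=\<tau> and H=H and u="?v"]) (use inv H in auto)
    have "Q ?v \<le> Q (\<lambda>x. if x \<in> H then max (?v x) (?v (\<tau> x)) else min (?v x) (?v (\<tau> x)))"
      unfolding Q_def
      by (rule polarization_form_mono) (use inv H \<kappa> le in \<open>auto intro!: K\<close>)
    also have "\<dots> = Q (?v \<circ> \<rho>)"
      unfolding Q_def by (intro sum.cong refl) (simp only: v\<rho>[unfolded o_def] o_def)
    finally have Q: "Q ?v \<le> Q (u \<circ> (\<sigma> \<circ> \<rho>))" by (simp add: comp_assoc)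
    have "\<sigma> \<circ> \<rho> permutes X" using \<rho> \<sigma>S by (rule permutes_compose)
    then have in': "\<sigma> \<circ> \<rho> \<in> S'" using \<sigma> Q unfolding S'_def S_def by (auto intro: order_trans)
    have r: "(\<Sum>x\<in>X. g (\<tau> x)) = (\<Sum>x\<in>X. g x)" for g :: "int \<Rightarrow> real"
      by (rule sum.reindex_bij_witness[where i=\<tau> and j=\<tau>]) (use inv in auto)
    \<comment> \<open>\<open>D\<close> is the change of \<open>W\<close> at one position; only its
      total over a reflected pair has a definite sign.\<close>
    define D where "D x = of_int (zig x) * (?v (\<rho> x) - ?v x)" for x
    have Dpair: "D x + D (\<tau> x) \<le> 0 \<and> (?v x < ?v (\<tau> x) \<longrightarrow> D x + D (\<tau> x) < 0)" if "x \<in> X" "x \<in> H" for x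
    proof (cases "\<tau> x = x")
      case True then show ?thesis using v\<rho>[OF that(1)] by (simp add: D_def)
    next
      case False
      then have nH: "\<tau> x \<notin> H" using H(2) that by blast
      have e: "?v (\<rho> x) = max (?v x) (?v (\<tau> x))" "?v (\<rho> (\<tau> x)) = min (?v x) (?v (\<tau> x))"
        using v\<rho>[OF that(1)] v\<rho>[OF inv(1)[OF that(1)]] nH inv that by (auto simp: min.commute)
      have "D x + D (\<tau> x) = (of_int (zig x) - of_int (zig (\<tau> x))) * (max (?v x) (?v (\<tau> x)) - ?v x)"
        unfolding D_def e by (auto simp: max_def min_def algebra_simps)
      moreover have "of_int (zig x) - of_int (zig (\<tau> x)) < (0::real)" using zig[OF that False] by simp
      ultimately show ?thesis by (auto simp: mult_less_0_iff mult_le_0_iff max_def)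
    qed
    have Dneg: "D x + D (\<tau> x) \<le> 0" if "x \<in> X" for x
      using Dpair[of x] Dpair[of "\<tau> x"] H(1)[OF that] inv that by (metis add.commute)
    have "2 * (W (\<sigma> \<circ> \<rho>) - W \<sigma>) = 2 * (\<Sum>x\<in>X. D x)"
      by (simp add: W_def D_def sum_subtractf[symmetric] algebra_simps)
    also have "\<dots> = (\<Sum>x\<in>X. D x + D (\<tau> x))" by (simp add: sum.distrib r)
    also have "\<dots> < (\<Sum>x\<in>X. 0)"
      by (rule sum_strict_mono_ex1[OF finX]) (use Dneg Dpair[OF z(1,2)] less z in \<open>auto intro!: bexI[of _ z]\<close>)
    finally have "W (\<sigma> \<circ> \<rho>) < W \<sigma>" by simp
    with minW[OF in'] show False by simp
  qed
  have hpos: "?h > 0" and hM: "(real M + 1/2) * ?h = pi"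
    by (auto simp: grid_step_def field_simps)
  \<comment> \<open>\<open>a\<close> and \<open>b\<close> are angular distances from the axis of
    reflection: points on the same side differ by \<open>a - b\<close>, a point and a reflected one
    by \<open>a + b\<close>.\<close>
  have cosle: "cos (a + b) \<le> cos (a - b)" if "0 \<le> a" "a \<le> pi" "0 \<le> b" "b \<le> pi" for a b
    using sin_ge_zero[OF that(1,2)] sin_ge_zero[OF that(3,4)] by (simp add: cos_add cos_diff)
  have per: "cos (a + (2 * real M + 1) * ?h) = cos a" for a
    by (simp add: grid_step_def)
  have t1: "u (\<sigma> (- z)) \<le> u (\<sigma> z)" if "z \<in> X" "z > 0" for z
  proof (rule key[where H="{0..}"])
    fix x y :: int assume "x \<in> X" "y \<in> X" "x \<in> {0..}" "y \<in> {0..}"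
    then have b: "0 \<le> x" "x \<le> int M" "0 \<le> y" "y \<le> int M" by (auto simp: X_def)
    have "of_int k * ?h \<le> pi" if "k \<le> int M" for k
    proof -
      have "of_int k * ?h \<le> (real M + 1/2) * ?h" using that hpos by (intro mult_right_mono) linarith+
      then show ?thesis using hM by simp
    qed
    with b hpos have "cos (of_int x * ?h + of_int y * ?h) \<le> cos (of_int x * ?h - of_int y * ?h)"
      by (intro cosle) auto
    then show "cos (of_int (x - - y) * ?h) \<le> cos (of_int (x - y) * ?h)" by (simp add: algebra_simps)
  next
    fix x y :: int
    have "of_int (- x - - y) * ?h = - (of_int (x - y) * ?h)" by (simp add: algebra_simps)
    then show "cos (of_int (- x - - y) * ?h) = cos (of_int (x - y) * ?h)" by (metis cos_minus)
  qed (use that in \<open>auto simp: X_def zig_def\<close>)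
  have t2: "u (\<sigma> (1 - z)) \<le> u (\<sigma> z)" if "z \<in> X" "z \<le> 0" "z \<noteq> - int M" for z
  proof -
    \<comment> \<open>\<open>- int M\<close> is fixed because \<open>M + 1\<close> and
      \<open>- M\<close> agree modulo \<open>2 * M + 1\<close>. The cases below with exactly one
      argument \<open>- int M\<close> wrap around the circle.\<close>
    define \<tau> where "\<tau> x = (if x = - int M then x else 1 - x)" for x
    have "u (\<sigma> (\<tau> z)) \<le> u (\<sigma> z)"
    proof (rule key[where H="{..0}"])
      fix x y :: int assume "x \<in> X" "y \<in> X" "x \<in> {..0}" "y \<in> {..0}"
      then have b: "- int M \<le> x" "x \<le> 0" "- int M \<le> y" "y \<le> 0" by (auto simp: X_def)
      show "cos (of_int (x - \<tau> y) * ?h) \<le> cos (of_int (x - y) * ?h)"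
      proof (cases "y = - int M")
        case False
        have k: "(1/2 - of_int k) * ?h \<le> pi" if "- int M \<le> k" for k
        proof -
          have "(1/2 - of_int k) * ?h \<le> (real M + 1/2) * ?h" using that hpos by (intro mult_right_mono) linarith+
          then show ?thesis using hM by simp
        qed
        have "cos ((1/2 - of_int x) * ?h + (1/2 - of_int y) * ?h) \<le> cos ((1/2 - of_int x) * ?h - (1/2 - of_int y) * ?h)"
          using b hpos by (intro cosle k) auto
        moreover have "(1/2 - of_int x) * ?h + (1/2 - of_int y) * ?h = - (of_int (x - \<tau> y) * ?h)"
          using False by (simp add: \<tau>_def algebra_simps)
        moreover have "(1/2 - of_int x) * ?h - (1/2 - of_int y) * ?h = - (of_int (x - y) * ?h)"
          by (simp add: algebra_simps)
        ultimately show ?thesis by (simp only: cos_minus)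
      qed (simp add: \<tau>_def)
    next
      fix x y :: int assume "x \<in> X" "y \<in> X"
      consider "x = - int M" "y \<noteq> - int M" | "x \<noteq> - int M" "y = - int M" | "x = - int M" "y = - int M"
        | "x \<noteq> - int M" "y \<noteq> - int M" by blast
      then show "cos (of_int (\<tau> x - \<tau> y) * ?h) = cos (of_int (x - y) * ?h)"
      proof cases
        case 1
        have "of_int (x - y) * ?h = - (of_int (\<tau> x - \<tau> y) * ?h + (2 * real M + 1) * ?h)"
          using 1 by (simp add: \<tau>_def algebra_simps)
        then show ?thesis by (simp only: cos_minus per)
      next
        case 2
        have "of_int (\<tau> x - \<tau> y) * ?h = - (of_int (x - y) * ?h) + (2 * real M + 1) * ?h"
          using 2 by (simp add: \<tau>_def algebra_simps)
        then show ?thesis by (simp only: cos_minus per)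
      next
        case 4
        have "of_int (\<tau> x - \<tau> y) * ?h = - (of_int (x - y) * ?h)"
          using 4 by (simp add: \<tau>_def algebra_simps)
        then show ?thesis by (simp only: cos_minus)
      qed (simp add: \<tau>_def)
    qed (use that in \<open>auto simp: X_def zig_def \<tau>_def split: if_splits\<close>)
    then show ?thesis using that by (simp add: \<tau>_def)
  qed
  have all: "x \<in> X \<Longrightarrow> y \<in> X \<Longrightarrow> zig y = zig x + int j \<Longrightarrow> u (\<sigma> y) \<le> u (\<sigma> x)" for j x y
  proof (induction j arbitrary: y)
    case 0
    then have "y = x" by (auto simp: zig_def split: if_splits) presburger+
    then show ?case by simp
  next
    case (Suc j)
    \<comment> \<open>The predecessor of \<open>y\<close> in the order of ranks; one of the two
      reflections exchanges it with \<open>y\<close>.\<close>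
    define y' where "y' = (if y > 0 then 1 - y else - y)"
    have y': "y' \<in> X" "zig y' = zig x + int j"
      using Suc.prems by (auto simp: X_def zig_def y'_def split: if_splits)
    have "u (\<sigma> y) \<le> u (\<sigma> y')"
    proof (cases "y > 0")
      case True
      then show ?thesis using t2[of y'] y' Suc.prems by (auto simp: y'_def X_def)
    next
      case False
      then have "y' > 0" using Suc.prems by (auto simp: y'_def zig_def split: if_splits)
      then show ?thesis using t1[of y'] y' False by (auto simp: y'_def)
    qed
    then show ?case using Suc.IH[OF Suc.prems(1) y'] by simp
  qed
  have "u (\<sigma> y) \<le> u (\<sigma> x)" if "x \<in> X" "y \<in> X" "zig x \<le> zig y" for x y
    using all[OF that(1,2), of "nat (zig y - zig x)"] that(3) by simp
  moreover have "Q u \<le> Q (u \<circ> \<sigma>)" using \<sigma> \<open>id \<in> S\<close> by (force simp: S'_def)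
  ultimately show thesis using \<sigma>S that by blast
qed

section \<open>Discrete Poisson sums\<close>

definition poisson :: "real \<Rightarrow> real \<Rightarrow> real" where
  "poisson r \<theta> = (1 - r\<^sup>2) / (1 - 2 * r * cos \<theta> + r\<^sup>2)"

text \<open>\<open>s\<close> rotates the whole grid; it is chosen later so that few nodes fall on
  large values.\<close>

definition node :: "nat \<Rightarrow> real \<Rightarrow> int \<Rightarrow> real" where
  "node M s k = s + of_int k * grid_step M"

definition avg :: "nat \<Rightarrow> (int \<Rightarrow> 'a :: real_normed_field) \<Rightarrow> 'a" where
  "avg M g = (\<Sum>k\<in>{- int M..int M}. g k) / of_nat (2 * M + 1)"

definition poisson_sum :: "nat \<Rightarrow> real \<Rightarrow> real \<Rightarrow> (real \<Rightarrow> real) \<Rightarrow> real \<Rightarrow> real" where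
  "poisson_sum M s r \<phi> t = avg M (\<lambda>k. poisson r (t - node M s k) * \<phi> (node M s k))"

text \<open>The Schwarz integral of \<open>\<phi>\<close> sampled at the nodes. It is holomorphic in
  the open disc with \<open>poisson_sum\<close> as real part, which gives access to the maximum
  modulus principle.\<close>

definition schwarz_sum :: "nat \<Rightarrow> real \<Rightarrow> (real \<Rightarrow> real) \<Rightarrow> complex \<Rightarrow> complex" where
  "schwarz_sum M s \<phi> z =
     avg M (\<lambda>k. of_real (\<phi> (node M s k)) * ((cis (node M s k) + z) / (cis (node M s k) - z)))"

lemma avg_mono: "(\<And>k. g k \<le> f k) \<Longrightarrow> avg M g \<le> (avg M f :: real)"
  unfolding avg_def by (intro divide_right_mono sum_mono) auto

lemma avg_add: "avg M (\<lambda>k. g k + f k) = avg M g + avg M f"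
  by (simp add: avg_def sum.distrib add_divide_distrib)

lemma avg_diff: "avg M (\<lambda>k. g k - f k) = avg M g - avg M f"
  by (simp add: avg_def sum_subtractf diff_divide_distrib)

lemma avg_cmult: "avg M (\<lambda>k. c * g k) = c * avg M g"
  by (simp add: avg_def sum_distrib_left)

lemma avg_const [simp]: "avg M (\<lambda>k. c) = c"
proof -
  have "of_nat (nat (1 + 2 * int M)) = (1 + 2 * of_nat M :: 'a)"
    by (simp add: nat_add_distrib nat_mult_distrib)
  moreover have "(1 + 2 * of_nat M :: 'a) \<noteq> 0"
    using of_nat_neq_0[of "2 * M", where 'a='a] by simp
  ultimately show ?thesis by (simp add: avg_def add.commute)
qed

lemma abs_avg_le: "\<bar>avg M g\<bar> \<le> (avg M (\<lambda>k. \<bar>g k\<bar>) :: real)"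
  unfolding avg_def by (simp add: divide_right_mono)

lemma Re_avg: "Re (avg M g) = avg M (\<lambda>k. Re (g k))"
proof -
  have "Re (avg M g) = Re (sum g {- int M..int M} / of_real (real (2 * M + 1)))"
    unfolding avg_def by simp
  then show ?thesis unfolding avg_def Re_divide_of_real by simp
qed

lemma poisson_denominator_pos:
  fixes r :: real
  assumes "0 \<le> r" "r < 1"
  shows "0 < 1 - 2 * r * cos \<theta> + r\<^sup>2"
proof -
  have "r * cos \<theta> \<le> r * 1" using assms by (intro mult_left_mono) auto
  moreover have "0 < (1 - r)\<^sup>2" using assms by simp
  ultimately show ?thesis by (simp add: power2_eq_square algebra_simps)
qed

lemma poisson_nonneg:
  assumes "0 \<le> r" "r < 1"
  shows "0 \<le> poisson r \<theta>"
  using poisson_denominator_pos[OF assms, of \<theta>] assms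
  by (auto simp: poisson_def power_le_one intro!: divide_nonneg_pos)

lemma poisson_minus [simp]: "poisson r (- \<theta>) = poisson r \<theta>"
  by (simp add: poisson_def)

lemma Re_schwarz_kernel:
  "Re ((cis s + of_real r * cis t) / (cis s - of_real r * cis t)) = poisson r (t - s)"
proof -
  have sc: "(cos x)\<^sup>2 = 1 - (sin x)\<^sup>2" for x :: real by (simp add: cos_squared_eq)
  have "(cos s + r * cos t) * (cos s - r * cos t) + (sin s + r * sin t) * (sin s - r * sin t) = 1 - r\<^sup>2"
    using sin_cos_squared_add[of s] sin_cos_squared_add[of t] by algebra
  moreover have "(cos s - r * cos t)\<^sup>2 + (sin s - r * sin t)\<^sup>2 = 1 - 2 * r * cos (t - s) + r\<^sup>2"
    unfolding cos_diff using sin_cos_squared_add[of s] sin_cos_squared_add[of t] by algebra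
  ultimately show ?thesis by (simp add: Re_divide poisson_def add_divide_distrib[symmetric])
qed

lemma Re_schwarz_sum: "Re (schwarz_sum M s \<phi> (of_real r * cis t)) = poisson_sum M s r \<phi> t"
proof -
  have *: "Re (of_real a * w) = a * Re w" for a w by simp
  show ?thesis
    unfolding schwarz_sum_def poisson_sum_def Re_avg * Re_schwarz_kernel by (simp only: mult.commute)
qed

lemma cis_minus_ne_zero: "norm z < 1 \<Longrightarrow> cis t - z \<noteq> 0"
  by (metis norm_cis order_less_irrefl right_minus_eq)

lemma schwarz_sum_holomorphic: "schwarz_sum M s \<phi> holomorphic_on ball 0 1"
  unfolding schwarz_sum_def avg_def
  by (intro holomorphic_intros) (auto simp: cis_minus_ne_zero simp del: of_nat_add of_nat_mult of_nat_Suc)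

section \<open>Total mass of the discrete Poisson kernel\<close>

lemma sum_int_symmetric_interval: "(\<Sum>k\<in>{- int M..int M}. g k) = (\<Sum>j<2*M+1. g (int j - int M))"
  by (rule sum.reindex_bij_witness[where i="\<lambda>j. int j - int M" and j="\<lambda>k. nat (k + int M)"]) auto

text \<open>A geometric sum whose ratio is a root of unity different from 1, because
  \<open>2 * M + 1\<close> does not divide \<open>l\<close>.\<close>

lemma sum_node_powers:
  assumes "0 < l" "l < 2 * M + 1"
  shows "(\<Sum>k\<in>{- int M..int M}. cis (- node M s k) ^ l) = 0"
proof -
  define \<omega> where "\<omega> = cis (- (real l * grid_step M))"
  have h: "real (2 * M + 1) * grid_step M = 2 * pi" by (simp add: grid_step_def add.commute)
  have "\<omega> ^ (2 * M + 1) = cis (- (real l * (2 * pi)))"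
    unfolding \<omega>_def Complex.DeMoivre h[symmetric] by (simp add: mult_ac)
  also have "\<dots> = 1" using cis_multiple_2pi[of "- real l"] by (simp add: mult_ac)
  finally have one: "\<omega> ^ (2 * M + 1) = 1" .
  have "\<omega> \<noteq> 1"
  proof
    assume "\<omega> = 1"
    then have "cos (real l * grid_step M) = 1" by (simp add: \<omega>_def complex_eq_iff)
    then obtain n :: int where "real l * grid_step M = of_int n * 2 * pi"
      unfolding cos_one_2pi_int by auto
    then have "real l = of_int n * real (2 * M + 1)"
      unfolding grid_step_def by (simp add: divide_simps)
    then have "int l = n * int (2 * M + 1)" by (metis of_int_mult of_int_of_nat_eq of_int_eq_iff)
    then have "int (2 * M + 1) dvd int l" by simp
    then show False using assms by (meson dvd_imp_le int_dvd_int_iff not_le)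
  qed
  have "(\<Sum>k\<in>{- int M..int M}. cis (- node M s k) ^ l)
      = (\<Sum>j<2*M+1. cis (- (real l * (s - real M * grid_step M))) * \<omega> ^ j)"
    unfolding sum_int_symmetric_interval \<omega>_def node_def
    by (intro sum.cong refl) (simp only: Complex.DeMoivre cis_mult, simp add: algebra_simps)
  also have "\<dots> = cis (- (real l * (s - real M * grid_step M))) * ((\<omega> ^ (2 * M + 1) - 1) / (\<omega> - 1))"
    unfolding sum_distrib_left[symmetric] using geometric_sum[OF \<open>\<omega> \<noteq> 1\<close>, of "2*M+1"] by simp
  finally show ?thesis by (simp only: one) simp
qed

text \<open>The \<open>N\<close>-th power of \<open>z * cis (- node M s k)\<close> does not depend
  on \<open>k\<close>. So the kernel is a finite geometric sum with a common prefactor, and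
  averaging over the nodes removes every power except \<open>l = 0\<close>.\<close>

lemma schwarz_sum_one:
  fixes M :: nat
  assumes z: "norm z < 1"
  defines "N \<equiv> 2 * M + 1"
  shows "schwarz_sum M s (\<lambda>_. 1) z = (cis (real N * s) + z ^ N) / (cis (real N * s) - z ^ N)"
proof -
  define E where "E = cis (real N * s)"
  define q where "q = z ^ N / E"
  have "N > 0" by (simp add: N_def)
  have nz: "norm (z ^ N) < 1" using z \<open>N > 0\<close> by (simp add: norm_power power_less_one_iff)
  have "E \<noteq> 0" by (simp add: E_def)
  have q1: "q \<noteq> 1"
  proof
    assume "q = 1"
    then have "z ^ N = E" using \<open>E \<noteq> 0\<close> by (simp add: q_def)
    then show False using nz by (simp add: E_def)
  qed
  have h: "real N * grid_step M = 2 * pi" by (simp add: N_def grid_step_def add.commute)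
  have pow: "(z * cis (- node M s k)) ^ N = q" for k
  proof -
    have "real N * (- node M s k) = - (real N * s) + 2 * pi * (- of_int k)"
      unfolding node_def using h by (simp add: algebra_simps)
    then have "cis (- node M s k) ^ N = cis (- (real N * s)) * cis (2 * pi * (- of_int k))"
      unfolding Complex.DeMoivre by (simp add: cis_mult)
    also have "cis (2 * pi * (- of_int k)) = 1" by (rule cis_multiple_2pi) simp
    finally have "cis (- node M s k) ^ N = inverse E" by (simp add: E_def cis_inverse)
    then show ?thesis by (simp add: power_mult_distrib q_def divide_inverse)
  qed
  have kernel: "(cis (node M s k) + z) / (cis (node M s k) - z)
      = -1 + 2 / (1 - q) * (\<Sum>l<N. z ^ l * cis (- node M s k) ^ l)" for k
  proof -
    let ?x = "z * cis (- node M s k)"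
    have x1: "?x \<noteq> 1"
    proof
      assume "?x = 1"
      then have "norm ?x = 1" by simp
      then show False using z by (simp add: norm_mult)
    qed
    have "(\<Sum>l<N. ?x ^ l) = (q - 1) / (?x - 1)"
      using geometric_sum[OF x1, of N] pow[of k] by simp
    also have "\<dots> = (1 - q) / (1 - ?x)" using minus_divide_divide[of "1 - q" "1 - ?x"] by simp
    finally have S: "(\<Sum>l<N. ?x ^ l) = (1 - q) / (1 - ?x)" .
    have cancel: "2 / u * (u / v) = 2 / v" if "u \<noteq> 0" for u v :: complex using that by simp
    have "2 / (1 - q) * (\<Sum>l<N. ?x ^ l) = 2 / (1 - ?x)"
      unfolding S by (rule cancel) (use q1 in simp)
    moreover have "cis (node M s k) * cis (- node M s k) = 1" by (simp add: cis_mult)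
    then have e: "cis (node M s k) * ?x = z" by (simp add: mult.left_commute)
    have "(cis (node M s k) + z) / (cis (node M s k) - z)
        = (cis (node M s k) * (1 + ?x)) / (cis (node M s k) * (1 - ?x))"
      by (simp only: distrib_left right_diff_distrib e mult_1_right)
    then have "(cis (node M s k) + z) / (cis (node M s k) - z) = (1 + ?x) / (1 - ?x)" by simp
    moreover have "(1 + ?x) / (1 - ?x) = - 1 + 2 / (1 - ?x)"
      using x1 by (simp add: field_simps)
    ultimately show ?thesis by (simp add: power_mult_distrib)
  qed
  have "(\<Sum>k\<in>{- int M..int M}. \<Sum>l<N. z ^ l * cis (- node M s k) ^ l)
      = (\<Sum>l<N. z ^ l * (\<Sum>k\<in>{- int M..int M}. cis (- node M s k) ^ l))"
    unfolding sum_distrib_left by (rule sum.swap)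
  also have "\<dots> = (\<Sum>l<N. if l = 0 then of_nat N else 0)"
  proof (intro sum.cong refl)
    fix l assume "l \<in> {..<N}"
    then show "z ^ l * (\<Sum>k\<in>{- int M..int M}. cis (- node M s k) ^ l) = (if l = 0 then of_nat N else 0)"
      using sum_node_powers[of l M s] by (auto simp: N_def nat_add_distrib nat_mult_distrib)
  qed
  also have "\<dots> = of_nat N" using \<open>N > 0\<close> by simp
  finally have S: "avg M (\<lambda>k. \<Sum>l<N. z ^ l * cis (- node M s k) ^ l) = 1"
    unfolding avg_def N_def[symmetric] using \<open>N > 0\<close> by simp
  have "schwarz_sum M s (\<lambda>_. 1) z = avg M (\<lambda>k. -1 + 2 / (1 - q) * (\<Sum>l<N. z ^ l * cis (- node M s k) ^ l))"
    unfolding schwarz_sum_def kernel by simp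
  also have "\<dots> = -1 + 2 / (1 - q)" unfolding avg_add avg_cmult S avg_const by simp
  also have "\<dots> = (1 + q) / (1 - q)" using q1 by (simp add: field_simps)
  also have "\<dots> = (E * (1 + q)) / (E * (1 - q))" using \<open>E \<noteq> 0\<close> by simp
  also have "\<dots> = (E + z ^ N) / (E - z ^ N)"
    using \<open>E \<noteq> 0\<close> by (simp only: distrib_left right_diff_distrib mult_1_right) (simp add: q_def)
  finally show ?thesis by (simp add: E_def)
qed

text \<open>The deviation is the real part of \<open>2 * z ^ N / (cis (real N * s) - z ^ N)\<close>;
  it decays geometrically in \<open>N\<close>, uniformly in shift and angle.\<close>

lemma poisson_row_sum:
  fixes M :: nat
  assumes r: "0 \<le> r" "r < 1"
  defines "N \<equiv> 2 * M + 1"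
  shows "\<bar>poisson_sum M s r (\<lambda>_. 1) t - 1\<bar> \<le> 2 * r ^ N / (1 - r ^ N)"
proof -
  define z where "z = of_real r * cis t"
  have nz: "norm z = r" using r by (simp add: z_def norm_mult)
  have "N > 0" by (simp add: N_def)
  have rN: "r ^ N < 1" using r \<open>N > 0\<close> unfolding N_def by (intro power_less_one_iff[THEN iffD2]) auto
  let ?E = "cis (real N * s)"
  have d: "norm (?E - z ^ N) \<ge> 1 - r ^ N"
    using norm_triangle_ineq2[of ?E "z ^ N"] nz by (simp add: norm_power)
  then have ne: "?E - z ^ N \<noteq> 0" using rN by auto
  have "poisson_sum M s r (\<lambda>_. 1) t - 1 = Re ((?E + z ^ N) / (?E - z ^ N) - 1)"
    unfolding Re_schwarz_sum[symmetric] z_def[symmetric]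
    using schwarz_sum_one[of z M s] nz r by (simp add: N_def)
  also have "(?E + z ^ N) / (?E - z ^ N) - 1 = 2 * z ^ N / (?E - z ^ N)"
    using ne by (simp add: field_simps)
  finally have "\<bar>poisson_sum M s r (\<lambda>_. 1) t - 1\<bar> \<le> norm (2 * z ^ N / (?E - z ^ N))"
    using abs_Re_le_cmod by metis
  also have "\<dots> = 2 * r ^ N / norm (?E - z ^ N)" using nz by (simp add: norm_divide norm_mult norm_power)
  also have "\<dots> \<le> 2 * r ^ N / (1 - r ^ N)" using d rN r by (intro divide_left_mono mult_pos_pos) auto
  finally show ?thesis .
qed

section \<open>Periodic functions and their approximation by Poisson sums\<close>

lemma periodic_int:
  fixes \<phi> :: "real \<Rightarrow> 'a"
  assumes "\<And>t. \<phi> (t + T) = \<phi> t"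
  shows "\<phi> (t + of_int k * T) = \<phi> t"
proof (induction k rule: int_induct[where k=0])
  case (step1 i)
  then show ?case using assms[of "t + of_int i * T"] by (simp add: algebra_simps)
next
  case (step2 i)
  then show ?case using assms[of "t + of_int (i - 1) * T"] by (simp add: algebra_simps)
qed simp

lemma reduce_mod_2pi:
  fixes t a :: real
  obtains k :: int where "a \<le> t + of_int k * (2 * pi)" "t + of_int k * (2 * pi) < a + 2 * pi"
proof
  let ?x = "(a - t) / (2 * pi)"
  have "?x * (2 * pi) \<le> of_int \<lceil>?x\<rceil> * (2 * pi)" by (intro mult_right_mono) (linarith, simp)
  then show "a \<le> t + of_int \<lceil>?x\<rceil> * (2 * pi)" by simp
  have "of_int \<lceil>?x\<rceil> * (2 * pi) < (?x + 1) * (2 * pi)" by (intro mult_strict_right_mono) (linarith, simp)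
  then show "t + of_int \<lceil>?x\<rceil> * (2 * pi) < a + 2 * pi" by (simp add: distrib_right)
qed

lemma periodic_bounded:
  fixes \<phi> :: "real \<Rightarrow> real"
  assumes "continuous_on UNIV \<phi>" "\<And>t. \<phi> (t + 2 * pi) = \<phi> t"
  obtains B where "B > 0" "\<And>t. \<bar>\<phi> t\<bar> \<le> B"
proof -
  have "compact (\<phi> ` {0..2 * pi})"
    using assms(1) by (intro compact_continuous_image) (auto intro: continuous_on_subset)
  then obtain B where "B > 0" and B: "\<And>x. x \<in> {0..2 * pi} \<Longrightarrow> \<bar>\<phi> x\<bar> \<le> B"
    unfolding bounded_pos compact_eq_bounded_closed by force
  have "\<bar>\<phi> t\<bar> \<le> B" for t
  proof -
    obtain k where "0 \<le> t + of_int k * (2 * pi)" "t + of_int k * (2 * pi) < 0 + 2 * pi"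
      by (rule reduce_mod_2pi)
    then show ?thesis using B[of "t + of_int k * (2 * pi)"] periodic_int[of \<phi>, OF assms(2)] by simp
  qed
  with \<open>B > 0\<close> that show thesis by blast
qed

text \<open>A modulus of continuity in terms of the weight that \<open>poisson_concentration\<close>
  controls. Uniform continuity handles close arguments; for the others
  \<open>1 - cos (s - t)\<close> is bounded below, and \<open>C\<close> absorbs the range of
  \<open>\<phi>\<close>.\<close>

lemma periodic_cos_modulus:
  fixes \<phi> :: "real \<Rightarrow> real"
  assumes cont: "continuous_on UNIV \<phi>" and per: "\<And>t. \<phi> (t + 2 * pi) = \<phi> t" and "\<epsilon> > 0"
  obtains C where "C \<ge> 0" "\<And>s t. \<bar>\<phi> s - \<phi> t\<bar> \<le> \<epsilon> + C * (1 - cos (s - t))"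
proof -
  obtain B where B: "B > 0" "\<And>t. \<bar>\<phi> t\<bar> \<le> B" using periodic_bounded[OF cont per] by blast
  \<comment> \<open>\<open>t\<close> is reduced to \<open>[0, 2 pi)\<close> and then
    \<open>s\<close> to within \<open>pi\<close> of it, which needs this larger interval.\<close>
  have "uniformly_continuous_on {- pi..3 * pi} \<phi>"
    using cont by (intro compact_uniformly_continuous) (auto intro: continuous_on_subset)
  then obtain \<delta>0 where "\<delta>0 > 0"
    and \<delta>0: "\<And>x y. x \<in> {- pi..3 * pi} \<Longrightarrow> y \<in> {- pi..3 * pi} \<Longrightarrow> \<bar>x - y\<bar> < \<delta>0 \<Longrightarrow> \<bar>\<phi> x - \<phi> y\<bar> < \<epsilon>"
    unfolding uniformly_continuous_on_def dist_real_def using \<open>\<epsilon> > 0\<close> by metis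
  define \<delta> where "\<delta> = min \<delta>0 pi"
  have \<delta>: "0 < \<delta>" "\<delta> \<le> pi" "\<delta> \<le> \<delta>0" using \<open>\<delta>0 > 0\<close> by (auto simp: \<delta>_def)
  have c1: "cos \<delta> < 1" using cos_monotone_0_pi[of 0 \<delta>] \<delta> by simp
  define C where "C = 2 * B / (1 - cos \<delta>)"
  have "C \<ge> 0" using B c1 by (simp add: C_def)
  have "\<bar>\<phi> s - \<phi> t\<bar> \<le> \<epsilon> + C * (1 - cos (s - t))" for s t
  proof -
    obtain k where k: "0 \<le> t + of_int k * (2 * pi)" "t + of_int k * (2 * pi) < 0 + 2 * pi"
      by (rule reduce_mod_2pi)
    define t0 where "t0 = t + of_int k * (2 * pi)"
    obtain j where j: "t0 - pi \<le> s + of_int j * (2 * pi)" "s + of_int j * (2 * pi) < t0 - pi + 2 * pi"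
      by (rule reduce_mod_2pi)
    define s0 where "s0 = s + of_int j * (2 * pi)"
    have \<phi>: "\<phi> t = \<phi> t0" "\<phi> s = \<phi> s0" unfolding t0_def s0_def using periodic_int[of \<phi>, OF per] by auto
    have "s - t = (s0 - t0) + of_int (k - j) * (2 * pi)" by (simp add: s0_def t0_def algebra_simps)
    then have c: "cos (s - t) = cos (s0 - t0)" using periodic_int[of "cos :: real \<Rightarrow> real" "2 * pi" "s0 - t0" "k - j"] by (simp only: cos_periodic)
    show ?thesis
    proof (cases "\<bar>s0 - t0\<bar> < \<delta>")
      case True
      then have "\<bar>\<phi> s0 - \<phi> t0\<bar> < \<epsilon>"
        using k j \<delta> by (intro \<delta>0) (auto simp: t0_def s0_def)
      moreover have "0 \<le> C * (1 - cos (s - t))" using \<open>C \<ge> 0\<close> by simp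
      ultimately show ?thesis by (simp add: \<phi>)
    next
      case False
      have "\<bar>s0 - t0\<bar> \<le> pi" using j by (auto simp: s0_def)
      then have "cos \<bar>s0 - t0\<bar> \<le> cos \<delta>" using False \<delta> by (intro cos_monotone_0_pi_le) auto
      then have "1 - cos \<delta> \<le> 1 - cos (s - t)" by (simp add: c)
      then have "C * (1 - cos \<delta>) \<le> C * (1 - cos (s - t))" using \<open>C \<ge> 0\<close> by (rule mult_left_mono)
      moreover have "C * (1 - cos \<delta>) = 2 * B" using c1 by (simp add: C_def)
      moreover have "\<bar>\<phi> s - \<phi> t\<bar> \<le> 2 * B" using B(2)[of s] B(2)[of t] by linarith
      ultimately show ?thesis using \<open>\<epsilon> > 0\<close> by linarith
    qed
  qed
  with \<open>C \<ge> 0\<close> that show thesis by blast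
qed

text \<open>The denominator is \<open>2 * r * (1 - cos \<theta>)\<close> plus the square of
  \<open>1 - r\<close>. The bound tends to 0 as \<open>r\<close> tends to 1: the mass concentrates
  at angle 0.\<close>

lemma poisson_concentration:
  assumes "0 < r" "r < 1"
  shows "poisson r \<theta> * (1 - cos \<theta>) \<le> (1 - r\<^sup>2) / (2 * r)"
proof -
  let ?D = "1 - 2 * r * cos \<theta> + r\<^sup>2"
  have D: "?D > 0" using poisson_denominator_pos[of r \<theta>] assms by simp
  have "2 * r * (1 - cos \<theta>) \<le> ?D" using zero_le_power2[of "1 - r"] by (simp add: power2_eq_square algebra_simps)
  then have "(1 - r\<^sup>2) * (2 * r * (1 - cos \<theta>)) \<le> (1 - r\<^sup>2) * ?D"
    using assms by (intro mult_left_mono) (auto simp: power_le_one)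
  then show ?thesis using D assms by (simp add: poisson_def field_simps)
qed

lemma power_div_one_minus_power_tendsto:
  fixes r :: real
  assumes "0 \<le> r" "r < 1"
  shows "(\<lambda>M. 2 * r ^ (2 * M + 1) / (1 - r ^ (2 * M + 1))) \<longlonglongrightarrow> 0"
proof -
  have "(\<lambda>M. r ^ M) \<longlonglongrightarrow> 0" using assms by (intro LIMSEQ_realpow_zero) auto
  then have p: "(\<lambda>M. r ^ (2 * M + 1)) \<longlonglongrightarrow> 0"
    by (rule filterlim_compose) (intro filterlim_subseq strict_monoI, simp)
  have "(\<lambda>M. 2 * r ^ (2 * M + 1) / (1 - r ^ (2 * M + 1))) \<longlonglongrightarrow> 2 * 0 / (1 - 0)"
    by (intro tendsto_intros p) auto
  then show ?thesis by simp
qed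

lemma poisson_row_sum_eventually:
  assumes "0 \<le> r" "r < 1" "\<epsilon> > 0"
  obtains M0 where "\<And>M s t. M \<ge> M0 \<Longrightarrow> \<bar>poisson_sum M s r (\<lambda>_. 1) t - 1\<bar> \<le> \<epsilon>"
proof -
  have "eventually (\<lambda>M. 2 * r ^ (2 * M + 1) / (1 - r ^ (2 * M + 1)) < \<epsilon>) sequentially"
    using order_tendstoD(2)[OF power_div_one_minus_power_tendsto[OF assms(1,2)] assms(3)] .
  then obtain M0 where "\<And>M. M \<ge> M0 \<Longrightarrow> 2 * r ^ (2 * M + 1) / (1 - r ^ (2 * M + 1)) < \<epsilon>"
    unfolding eventually_sequentially by blast
  then show thesis using poisson_row_sum[OF assms(1,2)] that by (meson less_imp_le order_trans)
qed

text \<open>The order of quantifiers matters: first the radius, then \<open>M\<close>, both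
  independent of \<open>s\<close> and \<open>t\<close>, so that the shift may be chosen after
  \<open>M\<close>.\<close>

lemma poisson_approx_identity:
  fixes \<phi> :: "real \<Rightarrow> real"
  assumes cont: "continuous_on UNIV \<phi>" and per: "\<And>t. \<phi> (t + 2 * pi) = \<phi> t" and "\<epsilon> > 0"
  obtains \<rho>0 where "0 < \<rho>0" "\<rho>0 < 1"
    "\<And>\<rho>. \<rho>0 \<le> \<rho> \<Longrightarrow> \<rho> < 1 \<Longrightarrow> \<exists>M0. \<forall>M\<ge>M0. \<forall>s t. \<bar>poisson_sum M s \<rho> \<phi> t - \<phi> t\<bar> \<le> \<epsilon>"
proof -
  obtain B where B: "B > 0" "\<And>t. \<bar>\<phi> t\<bar> \<le> B" using periodic_bounded[OF cont per] by blast
  have "\<epsilon> / 4 > 0" using \<open>\<epsilon> > 0\<close> by simp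
  then obtain C where C: "C \<ge> 0" "\<And>s t. \<bar>\<phi> s - \<phi> t\<bar> \<le> \<epsilon> / 4 + C * (1 - cos (s - t))"
    using periodic_cos_modulus[OF cont per] by blast
  have "((\<lambda>\<rho>. C * ((1 - \<rho>\<^sup>2) / (2 * \<rho>))) \<longlongrightarrow> C * ((1 - 1\<^sup>2) / (2 * 1))) (at_left (1::real))"
    by (intro tendsto_intros) auto
  then have "eventually (\<lambda>\<rho>. C * ((1 - \<rho>\<^sup>2) / (2 * \<rho>)) < \<epsilon> / 4) (at_left (1::real))"
    using \<open>\<epsilon> > 0\<close> by (intro order_tendstoD(2)) auto
  then obtain b where "b < 1" and b: "\<And>\<rho>. b < \<rho> \<Longrightarrow> \<rho> < 1 \<Longrightarrow> C * ((1 - \<rho>\<^sup>2) / (2 * \<rho>)) < \<epsilon> / 4"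
    using eventually_at_left[of 0 "1::real"] by auto
  define \<rho>0 where "\<rho>0 = max (1/2) ((1 + b) / 2)"
  have "\<exists>M0. \<forall>M\<ge>M0. \<forall>s t. \<bar>poisson_sum M s \<rho> \<phi> t - \<phi> t\<bar> \<le> \<epsilon>" if "\<rho>0 \<le> \<rho>" "\<rho> < 1" for \<rho>
  proof -
    have \<rho>: "0 < \<rho>" "\<rho> < 1" "b < \<rho>" using that \<open>b < 1\<close> by (auto simp: \<rho>0_def)
    \<comment> \<open>The bound 1 gives \<open>?R \<le> 2\<close>; the other makes
      \<open>\<bar>?R - 1\<bar> * \<bar>\<phi> t\<bar>\<close> at most a quarter of
      \<open>\<epsilon>\<close>.\<close>
    define \<eta> where "\<eta> = min 1 (\<epsilon> / (4 * B))"
    have "\<eta> > 0" using \<open>\<epsilon> > 0\<close> B by (simp add: \<eta>_def)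
    then obtain M0 where M0: "\<And>M s t. M \<ge> M0 \<Longrightarrow> \<bar>poisson_sum M s \<rho> (\<lambda>_. 1) t - 1\<bar> \<le> \<eta>"
      using poisson_row_sum_eventually[of \<rho> \<eta>] \<rho> by (metis less_imp_le)
    have "\<bar>poisson_sum M s \<rho> \<phi> t - \<phi> t\<bar> \<le> \<epsilon>" if "M \<ge> M0" for M s t
    proof -
      let ?R = "poisson_sum M s \<rho> (\<lambda>_. 1) t"
      let ?x = "node M s"
      have R: "\<bar>?R - 1\<bar> \<le> \<eta>" using M0 that by blast
      have "poisson_sum M s \<rho> \<phi> t - ?R * \<phi> t = avg M (\<lambda>k. poisson \<rho> (t - ?x k) * (\<phi> (?x k) - \<phi> t))"
        unfolding poisson_sum_def right_diff_distrib avg_diff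
        by (subst (2) mult.commute, subst avg_cmult[symmetric]) (simp add: mult_ac)
      also have "\<bar>\<dots>\<bar> \<le> avg M (\<lambda>k. \<bar>poisson \<rho> (t - ?x k) * (\<phi> (?x k) - \<phi> t)\<bar>)" by (rule abs_avg_le)
      also have "\<dots> \<le> avg M (\<lambda>k. \<epsilon> / 4 * poisson \<rho> (t - ?x k) + \<epsilon> / 4)"
      proof (rule avg_mono)
        fix k
        let ?p = "poisson \<rho> (t - ?x k)"
        have p: "?p \<ge> 0" using poisson_nonneg[of \<rho>] \<rho> by simp
        have "\<bar>?p * (\<phi> (?x k) - \<phi> t)\<bar> = ?p * \<bar>\<phi> t - \<phi> (?x k)\<bar>" using p by (simp add: abs_mult abs_minus_commute)
        also have "\<dots> \<le> ?p * (\<epsilon> / 4 + C * (1 - cos (t - ?x k)))" using C p by (intro mult_left_mono) auto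
        also have "\<dots> = \<epsilon> / 4 * ?p + C * (?p * (1 - cos (t - ?x k)))" by (simp add: algebra_simps)
        also have "C * (?p * (1 - cos (t - ?x k))) \<le> C * ((1 - \<rho>\<^sup>2) / (2 * \<rho>))"
          using poisson_concentration[OF \<rho>(1,2)] C(1) by (intro mult_left_mono)
        also have "\<dots> \<le> \<epsilon> / 4" using b[OF \<rho>(3,2)] by simp
        finally show "\<bar>?p * (\<phi> (?x k) - \<phi> t)\<bar> \<le> \<epsilon> / 4 * ?p + \<epsilon> / 4" by simp
      qed
      also have "\<dots> = \<epsilon> / 4 * ?R + \<epsilon> / 4" by (simp only: avg_add avg_cmult avg_const poisson_sum_def mult_1_right)
      also have "\<dots> \<le> \<epsilon> / 4 * 2 + \<epsilon> / 4" using R \<open>\<epsilon> > 0\<close> by (intro add_mono mult_left_mono) (auto simp: \<eta>_def)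
      finally have 1: "\<bar>poisson_sum M s \<rho> \<phi> t - ?R * \<phi> t\<bar> \<le> 3 * \<epsilon> / 4" by simp
      have "\<bar>?R * \<phi> t - \<phi> t\<bar> = \<bar>?R - 1\<bar> * \<bar>\<phi> t\<bar>" by (simp add: abs_mult[symmetric] algebra_simps)
      also have "\<dots> \<le> \<epsilon> / (4 * B) * B" using R B by (intro mult_mono) (auto simp: \<eta>_def)
      also have "\<dots> = \<epsilon> / 4" using B by simp
      finally show ?thesis using 1 by linarith
    qed
    then show ?thesis by blast
  qed
  moreover have "0 < \<rho>0" "\<rho>0 < 1" using \<open>b < 1\<close> by (auto simp: \<rho>0_def)
  ultimately show thesis using that by blast
qed

text \<open>A Poisson majorant for the subharmonic function \<open>ln (norm g)\<close>, from the
  maximum modulus of \<open>g * exp (- schwarz_sum)\<close>. The comparison is made on a circle of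
  radius \<open>\<rho> < 1\<close>, since the sum may have poles at the nodes on the unit
  circle.\<close>

lemma norm_le_exp_schwarz_sum:
  fixes \<phi> :: "real \<Rightarrow> real"
  assumes cont: "continuous_on UNIV \<phi>" and per: "\<And>t. \<phi> (t + 2 * pi) = \<phi> t"
    and contg: "continuous_on (cball 0 1) g" and holg: "g holomorphic_on ball 0 1"
    and bd: "\<And>t. norm (g (cis t)) \<le> exp (\<phi> t)"
    and "r < 1" "\<epsilon> > 0"
  shows "\<exists>M0. \<forall>M\<ge>M0. \<forall>s z. norm z \<le> r \<longrightarrow> norm (g z) \<le> exp (Re (schwarz_sum M s \<phi> z) + \<epsilon>)"
proof -
  obtain B where B: "B > 0" "\<And>t. \<bar>\<phi> t\<bar> \<le> B" using periodic_bounded[OF cont per] by blast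
  \<comment> \<open>Chosen so that adding \<open>\<eta>\<close> to \<open>exp (\<phi> t)\<close>
    costs at most a factor \<open>exp (\<epsilon> / 2)\<close>, as
    \<open>- B \<le> \<phi> t\<close>.\<close>
  define \<eta> where "\<eta> = exp (- B) * (exp (\<epsilon> / 2) - 1)"
  have "\<eta> > 0" using \<open>\<epsilon> > 0\<close> by (simp add: \<eta>_def)
  have "uniformly_continuous_on (cball 0 1) g" using contg by (intro compact_uniformly_continuous) auto
  then obtain d where "d > 0" and d: "\<And>x y. x \<in> cball 0 1 \<Longrightarrow> y \<in> cball 0 1 \<Longrightarrow> dist x y < d \<Longrightarrow> dist (g x) (g y) < \<eta>"
    unfolding uniformly_continuous_on_def using \<open>\<eta> > 0\<close> by metis
  obtain \<rho>0 where \<rho>0: "0 < \<rho>0" "\<rho>0 < 1"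
    "\<And>\<rho>. \<rho>0 \<le> \<rho> \<Longrightarrow> \<rho> < 1 \<Longrightarrow> \<exists>M0. \<forall>M\<ge>M0. \<forall>s t. \<bar>poisson_sum M s \<rho> \<phi> t - \<phi> t\<bar> \<le> \<epsilon> / 2"
    using poisson_approx_identity[OF cont per, of "\<epsilon> / 2"] \<open>\<epsilon> > 0\<close> by auto
  define \<rho> where "\<rho> = max (max \<rho>0 r) (1 - d / 2)"
  have \<rho>: "0 < \<rho>" "\<rho> < 1" "\<rho>0 \<le> \<rho>" "r \<le> \<rho>" "1 - \<rho> < d" using \<rho>0 \<open>r < 1\<close> \<open>d > 0\<close> by (auto simp: \<rho>_def)
  obtain M0 where M0: "\<And>M s t. M \<ge> M0 \<Longrightarrow> \<bar>poisson_sum M s \<rho> \<phi> t - \<phi> t\<bar> \<le> \<epsilon> / 2"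
    using \<rho>0(3)[OF \<rho>(3,2)] by blast
  have circle: "norm (g (of_real \<rho> * cis t)) \<le> exp (\<phi> t + \<epsilon> / 2)" for t
  proof -
    have "cis t - of_real \<rho> * cis t = of_real (1 - \<rho>) * cis t" by (simp add: algebra_simps)
    then have "dist (of_real \<rho> * cis t) (cis t) = 1 - \<rho>"
      using \<rho> by (simp add: dist_norm norm_minus_commute norm_mult del: of_real_diff)
    then have "dist (g (of_real \<rho> * cis t)) (g (cis t)) < \<eta>" using \<rho> by (intro d) (auto simp: norm_mult)
    then have "norm (g (of_real \<rho> * cis t)) \<le> norm (g (cis t)) + \<eta>"
      using norm_triangle_ineq2[of "g (of_real \<rho> * cis t)" "g (cis t)"] by (simp add: dist_norm)
    also have "\<dots> \<le> exp (\<phi> t) + exp (\<phi> t) * (exp (\<epsilon> / 2) - 1)"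
      using bd[of t] B(2)[of t] \<open>\<epsilon> > 0\<close> unfolding \<eta>_def by (intro add_mono mult_right_mono) auto
    finally show ?thesis by (simp add: algebra_simps exp_add)
  qed
  have "norm (g z) \<le> exp (Re (schwarz_sum M s \<phi> z) + \<epsilon>)" if "M \<ge> M0" "norm z \<le> r" for M s z
  proof -
    let ?H = "schwarz_sum M s \<phi>"
    have sub: "cball 0 \<rho> \<subseteq> ball (0::complex) 1" using \<rho> by auto
    have hol: "(\<lambda>z. g z * exp (- ?H z)) holomorphic_on ball 0 1"
      by (intro holomorphic_intros holg schwarz_sum_holomorphic)
    have "norm (g z * exp (- ?H z)) \<le> exp \<epsilon>"
    proof (rule maximum_modulus_frontier[where S="cball 0 \<rho>" and f="\<lambda>z. g z * exp (- ?H z)" and \<xi>=z])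
      show "(\<lambda>z. g z * exp (- ?H z)) holomorphic_on interior (cball 0 \<rho>)"
        using hol sub by (metis holomorphic_on_subset interior_subset order_trans)
      show "continuous_on (closure (cball 0 \<rho>)) (\<lambda>z. g z * exp (- ?H z))"
        using hol sub by (simp add: holomorphic_on_imp_continuous_on holomorphic_on_subset)
      show "z \<in> cball 0 \<rho>" using that \<rho> by simp
    next
      fix w :: complex assume "w \<in> frontier (cball 0 \<rho>)"
      then have "norm w = \<rho>" by simp
      then have w: "w = of_real \<rho> * cis (Arg w)" by (metis cis_conv_exp complex_norm_eq_1_exp_eq rcis_cmod_Arg rcis_def)
      have P: "- poisson_sum M s \<rho> \<phi> (Arg w) \<le> - \<phi> (Arg w) + \<epsilon> / 2"
        using M0[OF that(1), of s "Arg w"] by linarith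
      have "norm (g w * exp (- ?H w)) = norm (g w) * exp (- Re (?H w))" by (simp add: norm_mult)
      also have "Re (?H w) = poisson_sum M s \<rho> \<phi> (Arg w)" by (subst w) (rule Re_schwarz_sum)
      also have "norm (g w) * exp (- poisson_sum M s \<rho> \<phi> (Arg w))
           \<le> exp (\<phi> (Arg w) + \<epsilon> / 2) * exp (- \<phi> (Arg w) + \<epsilon> / 2)"
        using circle[of "Arg w"] w P by (intro mult_mono) auto
      also have "\<dots> = exp \<epsilon>" by (simp add: exp_add[symmetric])
      finally show "norm (g w * exp (- ?H w)) \<le> exp \<epsilon>" .
    qed auto
    then have "norm (g z) * exp (- Re (?H z)) \<le> exp \<epsilon>" by (simp add: norm_mult)
    then show ?thesis by (simp add: exp_add exp_minus field_simps)
  qed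
  then show ?thesis by blast
qed

text \<open>The majorants for \<open>exp g\<close> and for \<open>exp (- g)\<close> are the two
  inequalities.\<close>

lemma poisson_sum_reproduces_harmonic:
  fixes \<phi> :: "real \<Rightarrow> real"
  assumes cont: "continuous_on UNIV \<phi>" and per: "\<And>t. \<phi> (t + 2 * pi) = \<phi> t"
    and contg: "continuous_on (cball 0 1) g" and holg: "g holomorphic_on ball 0 1"
    and bd: "\<And>t. Re (g (cis t)) = \<phi> t"
    and "r < 1" "\<epsilon> > 0"
  shows "\<exists>M0. \<forall>M\<ge>M0. \<forall>s z. norm z \<le> r \<longrightarrow> \<bar>Re (g z) - Re (schwarz_sum M s \<phi> z)\<bar> \<le> \<epsilon>"
proof -
  have 1: "\<exists>M0. \<forall>M\<ge>M0. \<forall>s z. norm z \<le> r \<longrightarrow> norm (exp (g z)) \<le> exp (Re (schwarz_sum M s \<phi> z) + \<epsilon>)"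
    by (rule norm_le_exp_schwarz_sum)
      (use assms in \<open>auto intro!: continuous_intros holomorphic_intros\<close>)
  have 2: "\<exists>M0. \<forall>M\<ge>M0. \<forall>s z. norm z \<le> r \<longrightarrow> norm (exp (- g z)) \<le> exp (Re (schwarz_sum M s (\<lambda>t. - \<phi> t) z) + \<epsilon>)"
    by (rule norm_le_exp_schwarz_sum)
      (use assms in \<open>auto intro!: continuous_intros holomorphic_intros\<close>)
  have m: "schwarz_sum M s (\<lambda>t. - \<phi> t) z = - schwarz_sum M s \<phi> z" for M s z
    unfolding schwarz_sum_def using avg_cmult[of M "-1"] by simp
  from 1 2 obtain M1 M2 where
    "\<forall>M\<ge>M1. \<forall>s z. norm z \<le> r \<longrightarrow> norm (exp (g z)) \<le> exp (Re (schwarz_sum M s \<phi> z) + \<epsilon>)"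
    "\<forall>M\<ge>M2. \<forall>s z. norm z \<le> r \<longrightarrow> norm (exp (- g z)) \<le> exp (- Re (schwarz_sum M s \<phi> z) + \<epsilon>)"
    unfolding m by auto
  then have "\<forall>M\<ge>M1. \<forall>s z. norm z \<le> r \<longrightarrow> Re (g z) \<le> Re (schwarz_sum M s \<phi> z) + \<epsilon>"
    "\<forall>M\<ge>M2. \<forall>s z. norm z \<le> r \<longrightarrow> - Re (g z) \<le> - Re (schwarz_sum M s \<phi> z) + \<epsilon>"
    by (simp_all only: norm_exp_eq_Re exp_le_cancel_iff uminus_complex.sel)
  then have "\<bar>Re (g z) - Re (schwarz_sum M s \<phi> z)\<bar> \<le> \<epsilon>" if "M \<ge> max M1 M2" "norm z \<le> r" for M s z
    using that by (smt (verit) max.bounded_iff)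
  then show ?thesis by blast
qed

section \<open>Growth of trigonometric polynomials in the disc\<close>

text \<open>Homogeneous Chebyshev polynomials, \<open>y ^ k\<close> times
  \<open>T\<^sub>k (x / y)\<close>. With \<open>x = z ^ n * f\<close> and \<open>y = z ^ n\<close>
  there is no singularity at the origin, where \<open>f\<close> itself may have a pole.\<close>

fun cheb :: "nat \<Rightarrow> 'a :: comm_ring_1 \<Rightarrow> 'a \<Rightarrow> 'a" where
  "cheb 0 x y = 1"
| "cheb (Suc 0) x y = x"
| "cheb (Suc (Suc k)) x y = 2 * x * cheb (Suc k) x y - y\<^sup>2 * cheb k x y"

lemma cheb_cos:
  fixes \<theta> y :: "'a :: {real_normed_field, banach}"
  shows "cheb k (y * cos \<theta>) y = y ^ k * cos (of_nat k * \<theta>)"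
proof (induction k "y * cos \<theta>" y rule: cheb.induct)
  case (3 k y)
  let ?a = "of_nat (Suc k) * \<theta>"
  have "cos (of_nat (Suc (Suc k)) * \<theta>) = cos (?a + \<theta>)" "cos (of_nat k * \<theta>) = cos (?a - \<theta>)"
    by (simp_all add: algebra_simps)
  then have "cos (of_nat (Suc (Suc k)) * \<theta>) = 2 * cos \<theta> * cos ?a - cos (of_nat k * \<theta>)"
    by (simp only: cos_add cos_diff) (simp add: algebra_simps)
  then show ?case
    using 3 by (simp only: cheb.simps) (simp add: algebra_simps power2_eq_square)
qed auto

text \<open>Only the top power survives at \<open>y = 0\<close>; this is how the leading coefficient
  of \<open>f\<close> is read off at the origin.\<close>

lemma cheb_zero: "cheb (Suc k) x 0 = 2 ^ k * x ^ Suc k"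
proof (induction k)
  case (Suc k)
  have "cheb (Suc (Suc k)) x 0 = 2 * x * cheb (Suc k) x 0" by simp
  then show ?case unfolding Suc by (simp add: mult_ac)
qed simp

lemma cheb_holomorphic:
  assumes "f holomorphic_on S" "g holomorphic_on S"
  shows "(\<lambda>z. cheb k (f z) (g z)) holomorphic_on S"
proof -
  have "(\<lambda>z. cheb k (f z) (g z)) holomorphic_on S \<and> (\<lambda>z. cheb (Suc k) (f z) (g z)) holomorphic_on S"
    by (induction k) (use assms in \<open>auto intro!: holomorphic_intros\<close>)
  then show ?thesis ..
qed

text \<open>\<open>z ^ n\<close> times the Laurent polynomial that extends the trigonometric
  polynomial from the unit circle.\<close>

definition trig_numerator :: "nat \<Rightarrow> (nat \<Rightarrow> real) \<Rightarrow> (nat \<Rightarrow> real) \<Rightarrow> complex \<Rightarrow> complex" where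
  "trig_numerator n a b z = of_real (a 0 / 2) * z ^ n
     + (\<Sum>k=1..n. Complex (a k) (- b k) / 2 * z ^ (n + k) + Complex (a k) (b k) / 2 * z ^ (n - k))"

text \<open>Real part of that Laurent polynomial on the circle of radius \<open>r\<close>.\<close>

definition trig_radial :: "nat \<Rightarrow> (nat \<Rightarrow> real) \<Rightarrow> (nat \<Rightarrow> real) \<Rightarrow> real \<Rightarrow> real \<Rightarrow> real" where
  "trig_radial n a b r t = a 0 / 2
     + (\<Sum>k=1..n. (r ^ k + 1 / r ^ k) / 2 * (a k * cos (real k * t) + b k * sin (real k * t)))"

definition log_size :: "(real \<Rightarrow> real) \<Rightarrow> real \<Rightarrow> real" where
  "log_size f t = arcosh (max 1 \<bar>f t\<bar>)"

lemma trig_numerator_polar: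
  fixes r t :: real
  assumes r: "r > 0"
  defines "z \<equiv> of_real r * cis t"
  shows "Re (trig_numerator n a b z / z ^ n) = trig_radial n a b r t"
    and "r = 1 \<Longrightarrow> Im (trig_numerator n a b z / z ^ n) = 0"
proof -
  have z0: "z \<noteq> 0" using r by (simp add: z_def)
  have zk: "z ^ k = of_real (r ^ k) * cis (real k * t)" for k
    by (simp add: z_def power_mult_distrib Complex.DeMoivre)
  have zk': "inverse (z ^ k) = of_real (1 / r ^ k) * cis (- (real k * t))" for k
    unfolding zk inverse_mult_distrib cis_inverse by (simp add: inverse_eq_divide)
  have "trig_numerator n a b z / z ^ n
      = of_real (a 0 / 2) + (\<Sum>k=1..n. Complex (a k) (- b k) / 2 * z ^ k + Complex (a k) (b k) / 2 * inverse (z ^ k))"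
    unfolding trig_numerator_def add_divide_distrib sum_divide_distrib
    by (intro arg_cong2[where f="(+)"] sum.cong refl)
      (use z0 in \<open>auto simp: power_add power_diff field_simps\<close>)
  also have "\<dots> = of_real (a 0 / 2)
      + (\<Sum>k=1..n. Complex (a k) (- b k) / 2 * (of_real (r ^ k) * cis (real k * t))
                 + Complex (a k) (b k) / 2 * (of_real (1 / r ^ k) * cis (- (real k * t))))"
    by (simp only: zk[symmetric] zk'[symmetric])
  finally have e: "trig_numerator n a b z / z ^ n = \<dots>" .
  show "Re (trig_numerator n a b z / z ^ n) = trig_radial n a b r t"
    unfolding e trig_radial_def plus_complex.sel Re_sum
    by (intro arg_cong2[where f="(+)"] sum.cong refl) (simp_all add: algebra_simps add_divide_distrib diff_divide_distrib)
  show "Im (trig_numerator n a b z / z ^ n) = 0" if "r = 1"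
    unfolding e plus_complex.sel Im_sum using that
    by (simp add: algebra_simps add_divide_distrib[symmetric])
qed

lemma trig_numerator_circle: "trig_numerator n a b (cis t) = cis t ^ n * of_real (trigpoly n a b t)"
proof -
  have "trig_radial n a b 1 t = trigpoly n a b t" by (simp add: trig_radial_def trigpoly_def)
  then have "trig_numerator n a b (cis t) / cis t ^ n = of_real (trigpoly n a b t)"
    using trig_numerator_polar[of 1 n a b t] by (simp add: complex_eq_iff)
  then show ?thesis by (simp add: field_simps)
qed

lemma norm_cos_bounds:
  shows "norm (cos z) \<le> cosh (Im z)" and "\<bar>sinh (Im z)\<bar> \<le> norm (cos z)"
proof -
  have e: "(norm (cos z))\<^sup>2 = (cos (Re z))\<^sup>2 + (sinh (Im z))\<^sup>2"
    unfolding norm_cos_squared by (simp add: sinh_field_def exp_minus power_divide)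
  have "(norm (cos z))\<^sup>2 \<le> 1 + (sinh (Im z))\<^sup>2" unfolding e by (simp add: abs_square_le_1)
  also have "\<dots> = (cosh (Im z))\<^sup>2" by (simp add: cosh_square_eq)
  finally show "norm (cos z) \<le> cosh (Im z)" by (rule power2_le_imp_le) simp
  have "\<bar>sinh (Im z)\<bar>\<^sup>2 \<le> (norm (cos z))\<^sup>2" unfolding e by simp
  then show "\<bar>sinh (Im z)\<bar> \<le> norm (cos z)" by (rule power2_le_imp_le) simp
qed

lemma cosh_le_exp_abs: "cosh (x::real) \<le> exp \<bar>x\<bar>"
  by (cases "x \<ge> 0") (auto simp: cosh_field_def)

text \<open>For real \<open>x\<close> the imaginary part of \<open>cos \<theta> = x\<close> leaves
  two cases: \<open>\<theta>\<close> is real, or its real part is a multiple of \<open>pi\<close>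
  and \<open>\<bar>x\<bar> = cosh (Im \<theta>)\<close>.\<close>

lemma norm_cos_multiple_Arccos_le:
  "norm (cos (of_nat k * Arccos (of_real x))) \<le> exp (real k * arcosh (max 1 \<bar>x\<bar>))"
proof -
  let ?\<theta> = "Arccos (of_real x)"
  define p q where "p = Re ?\<theta>" and "q = Im ?\<theta>"
  have "Im (cos ?\<theta>) = 0" "Re (cos ?\<theta>) = x" by simp_all
  then have im: "sin p * (exp (- q) - exp q) / 2 = 0" and re: "cos p * (exp (- q) + exp q) / 2 = x"
    unfolding Im_cos Re_cos p_def q_def by (simp_all only: add.commute)
  have "\<bar>q\<bar> \<le> arcosh (max 1 \<bar>x\<bar>)"
  proof (cases "q = 0")
    case False
    then have "sin p = 0" using im by auto
    then have "\<bar>cos p\<bar> = 1" by (rule sin_zero_abs_cos_one)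
    then have "\<bar>x\<bar> = cosh \<bar>q\<bar>" unfolding re[symmetric] by (cases "q \<ge> 0") (simp_all add: abs_mult cosh_field_def)
    then have "arcosh (max 1 \<bar>x\<bar>) = arcosh (cosh \<bar>q\<bar>)" using cosh_real_ge_1[of "\<bar>q\<bar>"] by (simp add: max_def)
    then show ?thesis by (simp only: arcosh_cosh_real abs_ge_zero)
  qed simp
  then have "\<bar>Im ?\<theta>\<bar> \<le> arcosh (max 1 \<bar>x\<bar>)" by (simp only: q_def)
  then have "\<bar>real k * Im ?\<theta>\<bar> \<le> real k * arcosh (max 1 \<bar>x\<bar>)" by (simp add: abs_mult mult_left_mono)
  moreover have "norm (cos (of_nat k * ?\<theta>)) \<le> exp \<bar>real k * Im ?\<theta>\<bar>"
    using norm_cos_bounds(1)[of "of_nat k * ?\<theta>"] cosh_le_exp_abs[of "real k * Im ?\<theta>"] by simp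
  ultimately show ?thesis by (meson exp_le_cancel_iff order_trans)
qed

text \<open>\<open>\<bar>Im \<theta>\<bar>\<close> is the Green function at \<open>\<zeta>\<close>.
  The bound discards the imaginary part of \<open>\<zeta>\<close>: for the Laurent extension at
  radius \<open>r\<close> that part is of first order in \<open>1 - r\<close>, while the real part
  differs from \<open>f\<close> only in second order.\<close>

lemma cos_imaginary_part_ge:
  fixes \<zeta> :: complex
  obtains \<theta> where "cos \<theta> = \<zeta>" "arcosh (max 1 \<bar>Re \<zeta>\<bar>) \<le> \<bar>Im \<theta>\<bar>"
proof
  let ?\<theta> = "Arccos \<zeta>"
  show "cos ?\<theta> = \<zeta>" by simp
  have "\<bar>Re (cos ?\<theta>)\<bar> = \<bar>cos (Re ?\<theta>)\<bar> * cosh (Im ?\<theta>)"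
    unfolding Re_cos by (simp add: abs_mult cosh_field_def add.commute)
  also have "\<dots> \<le> 1 * cosh (Im ?\<theta>)" by (intro mult_right_mono) auto
  finally have "max 1 \<bar>Re \<zeta>\<bar> \<le> cosh \<bar>Im ?\<theta>\<bar>" using cosh_real_ge_1[of "Im ?\<theta>"] by simp
  then have "arcosh (max 1 \<bar>Re \<zeta>\<bar>) \<le> arcosh (cosh \<bar>Im ?\<theta>\<bar>)"
    by (metis arcosh_less_iff_real max.cobounded1 not_le order_trans)
  then show "arcosh (max 1 \<bar>Re \<zeta>\<bar>) \<le> \<bar>Im ?\<theta>\<bar>" by (simp only: arcosh_cosh_real abs_ge_zero)
qed

section \<open>Poisson majorants and the logarithmic size\<close>

lemma trigpoly_continuous [continuous_intros]: "continuous_on S (trigpoly n a b)"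
  unfolding trigpoly_def by (intro continuous_intros)

lemma trigpoly_periodic: "trigpoly n a b (t + 2 * pi) = trigpoly n a b t"
proof -
  have "cos (real k * (t + 2 * pi)) = cos (real k * t)" "sin (real k * (t + 2 * pi)) = sin (real k * t)" for k
  proof -
    have e: "real k * (t + 2 * pi) = real k * t + of_int (int k) * (2 * pi)" by (simp add: algebra_simps)
    show "cos (real k * (t + 2 * pi)) = cos (real k * t)"
      unfolding e by (rule periodic_int) simp
    show "sin (real k * (t + 2 * pi)) = sin (real k * t)"
      unfolding e by (rule periodic_int) simp
  qed
  then show ?thesis by (simp add: trigpoly_def)
qed

lemma log_size_nonneg: "log_size f t \<ge> 0"
  by (simp add: log_size_def)

lemma log_size_continuous:
  assumes "continuous_on S f"
  shows "continuous_on S (log_size f)"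
  unfolding log_size_def by (intro continuous_intros assms) auto

lemma schwarz_sum_cmult: "schwarz_sum M s (\<lambda>t. c * \<phi> t) z = of_real c * schwarz_sum M s \<phi> z"
  unfolding schwarz_sum_def avg_cmult[symmetric] by (simp add: mult_ac)

text \<open>The exponent grows like \<open>k\<close> while the error stays 1, so it becomes
  negligible after taking \<open>k\<close>-th roots.\<close>

lemma norm_cheb_le_exp_schwarz_sum:
  fixes n :: nat and a b :: "nat \<Rightarrow> real"
  assumes "r < 1"
  defines "w \<equiv> log_size (trigpoly n a b)"
  shows "\<exists>M0. \<forall>M\<ge>M0. \<forall>s z. norm z \<le> r \<longrightarrow>
    norm (cheb k (trig_numerator n a b z) (z ^ n)) \<le> exp (real k * Re (schwarz_sum M s w z) + 1)"
proof -
  have hol: "(\<lambda>z. cheb k (trig_numerator n a b z) (z ^ n)) holomorphic_on UNIV"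
    unfolding trig_numerator_def by (intro cheb_holomorphic holomorphic_intros)
  have "\<exists>M0. \<forall>M\<ge>M0. \<forall>s z. norm z \<le> r \<longrightarrow>
    norm (cheb k (trig_numerator n a b z) (z ^ n)) \<le> exp (Re (schwarz_sum M s (\<lambda>t. real k * w t) z) + 1)"
  proof (rule norm_le_exp_schwarz_sum)
    show "continuous_on UNIV (\<lambda>t. real k * w t)"
      unfolding w_def by (intro continuous_intros log_size_continuous)
    show "real k * w (t + 2 * pi) = real k * w t" for t
      by (simp add: w_def log_size_def trigpoly_periodic)
    show "continuous_on (cball 0 1) (\<lambda>z. cheb k (trig_numerator n a b z) (z ^ n))"
      using hol by (meson continuous_on_subset holomorphic_on_imp_continuous_on subset_UNIV)
    show "(\<lambda>z. cheb k (trig_numerator n a b z) (z ^ n)) holomorphic_on ball 0 1"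
      using hol by (meson holomorphic_on_subset subset_UNIV)
    show "norm (cheb k (trig_numerator n a b (cis t)) (cis t ^ n)) \<le> exp (real k * w t)" for t
    proof -
      have "cheb k (trig_numerator n a b (cis t)) (cis t ^ n)
          = cheb k (cis t ^ n * cos (Arccos (of_real (trigpoly n a b t)))) (cis t ^ n)"
        by (simp add: trig_numerator_circle)
      also have "norm \<dots> = norm (cos (of_nat k * Arccos (of_real (trigpoly n a b t))))"
        unfolding cheb_cos by (simp add: norm_mult norm_power)
      also have "\<dots> \<le> exp (real k * w t)"
        unfolding w_def log_size_def by (rule norm_cos_multiple_Arccos_le)
      finally show ?thesis .
    qed
  qed (use assms in auto)
  then show ?thesis by (simp add: schwarz_sum_cmult)
qed

lemma poisson_sum_nonneg:
  assumes "0 \<le> r" "r < 1" "\<And>t. \<phi> t \<ge> 0"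
  shows "poisson_sum M s r \<phi> t \<ge> 0"
  unfolding poisson_sum_def avg_def
  by (intro divide_nonneg_nonneg sum_nonneg mult_nonneg_nonneg poisson_nonneg assms) auto

text \<open>Subharmonicity of \<open>n ln \<bar>z\<bar>\<close> plus the Green function. The
  Chebyshev polynomials recover the Green function from below through
  \<open>norm (cos (k * \<theta>)) \<ge> exp (k * q) / 4\<close>, valid once
  \<open>k * q \<ge> 3\<close>.\<close>

lemma log_size_le_poisson_sum:
  fixes n :: nat and a b :: "nat \<Rightarrow> real"
  assumes r: "0 < r" "r < 1" and "\<epsilon> > 0"
  defines "w \<equiv> log_size (trigpoly n a b)"
  shows "\<exists>M0. \<forall>M\<ge>M0. \<forall>s t.
    real n * ln r + arcosh (max 1 \<bar>trig_radial n a b r t\<bar>) - \<epsilon> \<le> poisson_sum M s r w t"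
proof -
  \<comment> \<open>The 3 pays for the error 1 of the majorant and for the factor 4, which is at
    most \<open>exp 2\<close>.\<close>
  obtain k :: nat where k: "real k \<ge> max 1 (3 / \<epsilon>)" using real_arch_simple by blast
  then have kpos: "real k > 0" and k\<epsilon>: "real k * \<epsilon> \<ge> 3" using \<open>\<epsilon> > 0\<close> by (auto simp: field_simps)
  obtain M0 where M0: "\<And>M s z. M \<ge> M0 \<Longrightarrow> norm z \<le> r \<Longrightarrow>
      norm (cheb k (trig_numerator n a b z) (z ^ n)) \<le> exp (real k * Re (schwarz_sum M s w z) + 1)"
    using norm_cheb_le_exp_schwarz_sum[OF r(2)] unfolding w_def by blast
  have "real n * ln r + arcosh (max 1 \<bar>trig_radial n a b r t\<bar>) - \<epsilon> \<le> poisson_sum M s r w t"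
    if "M \<ge> M0" for M s t
  proof -
    define z where "z = of_real r * cis t"
    have z: "norm z = r" "z \<noteq> 0" using r by (auto simp: z_def norm_mult)
    obtain \<theta> where \<theta>: "cos \<theta> = trig_numerator n a b z / z ^ n"
      and q: "arcosh (max 1 \<bar>trig_radial n a b r t\<bar>) \<le> \<bar>Im \<theta>\<bar>"
      using cos_imaginary_part_ge[of "trig_numerator n a b z / z ^ n"] trig_numerator_polar(1)[OF r(1), of n a b t]
      unfolding z_def by metis
    define q where "q = \<bar>Im \<theta>\<bar>"
    have P0: "poisson_sum M s r w t \<ge> 0"
      using r by (intro poisson_sum_nonneg) (auto simp: w_def log_size_nonneg)
    have "real n * ln r + q - \<epsilon> \<le> poisson_sum M s r w t"
    proof (cases "q \<le> \<epsilon>")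
      case True
      moreover have "real n * ln r \<le> 0" using r by (simp add: mult_nonneg_nonpos)
      ultimately show ?thesis using P0 by linarith
    next
      case False
      then have "real k * \<epsilon> \<le> real k * q" using kpos by simp
      then have kq: "real k * q \<ge> 3" using k\<epsilon> by linarith
      define E F where "E = exp (real k * q)" and "F = exp (- (real k * q))"
      have "F \<le> 1" "1 + real k * q \<le> E" using kq by (simp_all add: E_def F_def)
      then have "F \<le> 1" "E \<ge> 4" using kq by auto
      then have "E / 4 \<le> (E - F) / 2" by (simp add: field_simps)
      then have "exp (real k * q) / 4 \<le> sinh (real k * q)" by (simp only: sinh_field_def E_def F_def)
      also have "sinh (real k * q) = \<bar>sinh (Im (of_nat k * \<theta>))\<bar>"
        using sinh_real_abs[of "Im (of_nat k * \<theta>)"] by (simp add: q_def abs_mult)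
      also have "\<dots> \<le> norm (cos (of_nat k * \<theta>))" by (rule norm_cos_bounds)
      finally have s: "exp (real k * q) / 4 \<le> norm (cos (of_nat k * \<theta>))" .
      have "exp (real k * (real n * ln r)) = norm ((z ^ n) ^ k)"
        using r by (simp add: norm_power z exp_of_nat_mult)
      then have "exp (real k * (real n * ln r)) * (exp (real k * q) / 4)
          \<le> norm ((z ^ n) ^ k) * norm (cos (of_nat k * \<theta>))" using s by (metis mult_left_mono norm_ge_zero)
      also have "\<dots> = norm (cheb k (z ^ n * cos \<theta>) (z ^ n))" unfolding cheb_cos norm_mult ..
      also have "z ^ n * cos \<theta> = trig_numerator n a b z" using z by (simp add: \<theta>)
      also have "norm (cheb k (trig_numerator n a b z) (z ^ n)) \<le> exp (real k * Re (schwarz_sum M s w z) + 1)"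
        using M0[OF that] z by simp
      also have "Re (schwarz_sum M s w z) = poisson_sum M s r w t"
        unfolding z_def by (rule Re_schwarz_sum)
      finally have "exp (real k * (real n * ln r) + real k * q) \<le> 4 * exp (real k * poisson_sum M s r w t + 1)"
        by (simp add: exp_add)
      also have "\<dots> \<le> exp 2 * exp (real k * poisson_sum M s r w t + 1)"
      proof (rule mult_right_mono)
        have "(1 + 1)\<^sup>2 \<le> (exp 1 :: real)\<^sup>2" using exp_ge_add_one_self[of 1] by (intro power_mono) auto
        then show "4 \<le> (exp 2 :: real)" by (simp add: exp_double[symmetric])
      qed simp
      also have "\<dots> = exp (real k * poisson_sum M s r w t + 3)" by (simp add: exp_add[symmetric])
      finally have "real k * (real n * ln r) + real k * q \<le> real k * poisson_sum M s r w t + real k * \<epsilon>"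
        using k\<epsilon> by simp
      then have "real k * (real n * ln r + q) \<le> real k * (poisson_sum M s r w t + \<epsilon>)"
        by (simp add: distrib_left)
      then show ?thesis using kpos by simp
    qed
    then show ?thesis using q q_def by linarith
  qed
  then show ?thesis by blast
qed

text \<open>The same majorant at the origin, where the Schwarz sum is the plain average and the
  Chebyshev value has modulus \<open>A ^ k / 2\<close>.\<close>

lemma ln_lead_le_avg_log_size:
  fixes n :: nat and a b :: "nat \<Rightarrow> real"
  assumes "n \<ge> 1" and "\<epsilon> > 0"
  defines "w \<equiv> log_size (trigpoly n a b)" and "A \<equiv> sqrt ((a n)\<^sup>2 + (b n)\<^sup>2)"
  assumes "A > 0"
  shows "\<exists>M0. \<forall>M\<ge>M0. \<forall>s. ln A - \<epsilon> \<le> avg M (\<lambda>k. w (node M s k))"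
proof -
  obtain k :: nat where k: "real k \<ge> max 1 (2 / \<epsilon>)" using real_arch_simple by blast
  then have kpos: "real k > 0" and k\<epsilon>: "real k * \<epsilon> \<ge> 2" using \<open>\<epsilon> > 0\<close> by (auto simp: field_simps)
  then obtain j where j: "k = Suc j" by (cases k) auto
  obtain M0 where M0: "\<And>M s z. M \<ge> M0 \<Longrightarrow> norm z \<le> 0 \<Longrightarrow>
      norm (cheb k (trig_numerator n a b z) (z ^ n)) \<le> exp (real k * Re (schwarz_sum M s w z) + 1)"
    using norm_cheb_le_exp_schwarz_sum[of 0 k n a b] unfolding w_def by auto
  have "Complex (a k) (- b k) / 2 * 0 ^ (n + k) + Complex (a k) (b k) / 2 * 0 ^ (n - k)
      = (if k = n then Complex (a n) (b n) / 2 else 0)" if "k \<in> {1..n}" for k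
    using that by (auto simp: power_0_left)
  then have "trig_numerator n a b 0 = (\<Sum>k=1..n. if k = n then Complex (a n) (b n) / 2 else 0)"
    unfolding trig_numerator_def using \<open>n \<ge> 1\<close> by (simp add: power_0_left)
  then have "trig_numerator n a b 0 = Complex (a n) (b n) / 2" using \<open>n \<ge> 1\<close> by simp
  then have F0: "norm (trig_numerator n a b 0) = A / 2"
    by (simp only: norm_divide) (simp add: A_def complex_norm)
  have "ln A - \<epsilon> \<le> avg M (\<lambda>k. w (node M s k))" if "M \<ge> M0" for M s
  proof -
    have S: "Re (schwarz_sum M s w 0) = avg M (\<lambda>k. w (node M s k))"
      by (simp add: schwarz_sum_def Re_avg)
    have "norm (cheb k (trig_numerator n a b 0) (0 ^ n)) = 2 ^ j * (A / 2) ^ Suc j"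
      using \<open>n \<ge> 1\<close> by (simp add: j cheb_zero norm_mult norm_power F0 power_0_left del: cheb.simps power_Suc)
    also have "\<dots> = A ^ k / 2" by (simp add: j power_divide)
    finally have "A ^ k / 2 \<le> exp (real k * avg M (\<lambda>k. w (node M s k)) + 1)"
      using M0[OF that, of 0 s] by (simp add: S)
    moreover have "A ^ k = exp (real k * ln A)" using \<open>A > 0\<close> by (simp add: exp_of_nat_mult)
    ultimately have "exp (real k * ln A) \<le> 2 * exp (real k * avg M (\<lambda>k. w (node M s k)) + 1)"
      by simp
    also have "\<dots> \<le> exp 1 * exp (real k * avg M (\<lambda>k. w (node M s k)) + 1)"
      using exp_ge_add_one_self[of 1] by (intro mult_right_mono) auto
    finally have "exp (real k * ln A) \<le> exp 1 * exp (real k * avg M (\<lambda>k. w (node M s k)) + 1)" .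
    then have "real k * ln A \<le> real k * avg M (\<lambda>k. w (node M s k)) + 2" by (simp add: exp_add[symmetric])
    then have "real k * ln A \<le> real k * (avg M (\<lambda>k. w (node M s k)) + \<epsilon>)"
      using k\<epsilon> by (simp add: distrib_left)
    then show ?thesis using kpos by simp
  qed
  then show ?thesis by blast
qed

section \<open>The energy of the logarithmic size\<close>

lemma le_sinh: "x \<le> sinh x" if "x \<ge> 0" for x :: real
  using real_le_x_sinh[OF that] by (simp add: sinh_field_def exp_minus)

text \<open>With \<open>a = x + y\<close> and \<open>b = x - y\<close> this is
  \<open>2 * (x + y) * y \<le> 4 * x * y \<le> 4 * sinh x * sinh y\<close>. It circumvents the
  square-root behaviour of \<open>arcosh\<close> at 1: multiplied by \<open>a\<close>, the
  difference is controlled by hyperbolic cosines, that is, by values of \<open>f\<close>.\<close>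

lemma mult_diff_le_cosh_diff:
  fixes a b :: real
  assumes "0 \<le> b" "b \<le> a"
  shows "a * (a - b) \<le> 2 * (cosh a - cosh b)"
proof -
  define x y where "x = (a + b) / 2" and "y = (a - b) / 2"
  have ab: "a = x + y" "b = x - y" by (simp_all add: x_def y_def field_simps)
  have xy: "0 \<le> y" "y \<le> x" using assms by (simp_all add: x_def y_def)
  have xs: "x * y \<le> sinh x * sinh y" using xy le_sinh[of x] le_sinh[of y] by (intro mult_mono) auto
  have "y * y \<le> x * y" using xy by (intro mult_right_mono)
  then have "x * y + y * y \<le> sinh x * sinh y + sinh x * sinh y" using xs order_trans by (intro add_mono) blast+
  moreover have "2 * (cosh a - cosh b) = 2 * (sinh x * sinh y + sinh x * sinh y)"
    unfolding ab by (simp add: cosh_add cosh_diff)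
  moreover have "a * (a - b) = 2 * (x * y + y * y)" unfolding ab by (simp add: algebra_simps)
  ultimately show ?thesis by simp
qed

definition radial_error :: "nat \<Rightarrow> (nat \<Rightarrow> real) \<Rightarrow> (nat \<Rightarrow> real) \<Rightarrow> real \<Rightarrow> real" where
  "radial_error n a b r = (\<Sum>k=1..n. ((r ^ k + 1 / r ^ k) / 2 - 1) * (\<bar>a k\<bar> + \<bar>b k\<bar>))"

lemma half_sum_inverse_minus_one:
  fixes x :: real
  assumes "x > 0"
  shows "(x + 1 / x) / 2 - 1 = (1 - x)\<^sup>2 / (2 * x)"
  using assms by (simp add: field_simps power2_eq_square)

lemma trig_radial_error:
  assumes "0 < r"
  shows "\<bar>trig_radial n a b r t - trigpoly n a b t\<bar> \<le> radial_error n a b r"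
proof -
  have e: "trig_radial n a b r t - trigpoly n a b t
      = (\<Sum>k=1..n. ((r ^ k + 1 / r ^ k) / 2 - 1) * (a k * cos (real k * t) + b k * sin (real k * t)))"
    unfolding trig_radial_def trigpoly_def left_diff_distrib sum_subtractf by simp
  have "\<bar>trig_radial n a b r t - trigpoly n a b t\<bar>
      \<le> (\<Sum>k=1..n. \<bar>((r ^ k + 1 / r ^ k) / 2 - 1) * (a k * cos (real k * t) + b k * sin (real k * t))\<bar>)"
    unfolding e by (rule sum_abs)
  also have "\<dots> \<le> radial_error n a b r"
    unfolding radial_error_def
  proof (rule sum_mono)
    fix k
    let ?c = "(r ^ k + 1 / r ^ k) / 2 - 1" and ?s = "a k * cos (real k * t) + b k * sin (real k * t)"
    have "0 \<le> (1 - r ^ k)\<^sup>2 / (2 * r ^ k)"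
      by (intro divide_nonneg_pos zero_le_power2 mult_pos_pos zero_less_power assms) simp
    then have pos: "0 \<le> ?c" using half_sum_inverse_minus_one[of "r ^ k"] assms by (simp only: zero_less_power)
    have "\<bar>a k * cos (real k * t)\<bar> \<le> \<bar>a k\<bar>" "\<bar>b k * sin (real k * t)\<bar> \<le> \<bar>b k\<bar>"
      by (simp_all add: abs_mult mult_left_le)
    then have "\<bar>?s\<bar> \<le> \<bar>a k\<bar> + \<bar>b k\<bar>" by linarith
    then show "\<bar>?c * ?s\<bar> \<le> ?c * (\<bar>a k\<bar> + \<bar>b k\<bar>)"
      unfolding abs_mult abs_of_nonneg[OF pos] using pos by (rule mult_left_mono)
  qed
  finally show ?thesis .
qed

text \<open>Each factor equals \<open>(1 - r ^ k)\<^sup>2 / (2 * r ^ k)\<close>, of second order in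
  \<open>1 - r\<close>, so it disappears from an energy normalised by \<open>1 - r\<close>.\<close>

lemma radial_error_tendsto: "((\<lambda>r. radial_error n a b r / (1 - r)) \<longlongrightarrow> 0) (at_left 1)"
proof -
  have e: "((r ^ k + 1 / r ^ k) / 2 - 1) * c / (1 - r) = (1 - r ^ k) * (\<Sum>i<k. r ^ i) / (2 * r ^ k) * c"
    if "0 < r" "r < 1" for r c :: real and k
  proof -
    have "1 - r ^ k = (1 - r) * (\<Sum>i<k. r ^ i)" by (rule one_diff_power_eq)
    then have "(1 - r ^ k)\<^sup>2 = (1 - r) * ((1 - r ^ k) * (\<Sum>i<k. r ^ i))"
      by (simp add: power2_eq_square)
    then show ?thesis unfolding half_sum_inverse_minus_one[OF zero_less_power[OF that(1)]] using that by simp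
  qed
  have "((\<lambda>r::real. \<Sum>k=1..n. (1 - r ^ k) * (\<Sum>i<k. r ^ i) / (2 * r ^ k) * (\<bar>a k\<bar> + \<bar>b k\<bar>))
      \<longlongrightarrow> (\<Sum>k=1..n. (1 - 1 ^ k) * (\<Sum>i<k. 1 ^ i) / (2 * 1 ^ k) * (\<bar>a k\<bar> + \<bar>b k\<bar>))) (at_left 1)"
    by (intro tendsto_intros) auto
  then have lim: "((\<lambda>r::real. \<Sum>k=1..n. (1 - r ^ k) * (\<Sum>i<k. r ^ i) / (2 * r ^ k) * (\<bar>a k\<bar> + \<bar>b k\<bar>)) \<longlongrightarrow> 0) (at_left 1)"
    by simp
  have "eventually (\<lambda>r::real. 0 < r \<and> r < 1) (at_left 1)"
    using eventually_at_left_real[of 0 1] by simp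
  then have "eventually (\<lambda>r::real. (\<Sum>k=1..n. (1 - r ^ k) * (\<Sum>i<k. r ^ i) / (2 * r ^ k) * (\<bar>a k\<bar> + \<bar>b k\<bar>))
      = radial_error n a b r / (1 - r)) (at_left 1)"
    by eventually_elim (simp add: radial_error_def sum_divide_distrib e)
  then show ?thesis using lim by (rule Lim_transform_eventually[rotated])
qed

text \<open>The Poisson sum is at least \<open>n ln r\<close> plus the logarithmic size
  \<open>v\<close> at radius \<open>r\<close>, up to \<open>\<epsilon>\<close>, and
  \<open>w * (w - v)\<close> costs only the radial error.\<close>

lemma log_size_energy:
  fixes n :: nat and a b :: "nat \<Rightarrow> real"
  assumes r: "0 < r" "r < 1" and "\<epsilon> > 0"
  defines "w \<equiv> log_size (trigpoly n a b)"
  shows "\<exists>M0. \<forall>M\<ge>M0. \<forall>s t.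
    w t * (w t - poisson_sum M s r w t) \<le> (real n * ln (1 / r) + \<epsilon>) * w t + 2 * radial_error n a b r"
proof -
  obtain M0 where M0: "\<And>M s t. M \<ge> M0 \<Longrightarrow>
    real n * ln r + arcosh (max 1 \<bar>trig_radial n a b r t\<bar>) - \<epsilon> \<le> poisson_sum M s r w t"
    using log_size_le_poisson_sum[OF r \<open>\<epsilon> > 0\<close>] unfolding w_def by blast
  have "w t * (w t - poisson_sum M s r w t) \<le> (real n * ln (1 / r) + \<epsilon>) * w t + 2 * radial_error n a b r"
    if "M \<ge> M0" for M s t
  proof -
    define v where "v = arcosh (max 1 \<bar>trig_radial n a b r t\<bar>)"
    have w0: "w t \<ge> 0" by (simp add: w_def log_size_nonneg)
    have E: "\<bar>trig_radial n a b r t - trigpoly n a b t\<bar> \<le> radial_error n a b r"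
      by (rule trig_radial_error[OF r(1)])
    have "w t * (w t - v) \<le> 2 * radial_error n a b r"
    proof (cases "v \<le> w t")
      case True
      have "w t * (w t - v) \<le> 2 * (cosh (w t) - cosh v)"
        using True by (intro mult_diff_le_cosh_diff) (auto simp: v_def)
      also have "\<dots> = 2 * (max 1 \<bar>trigpoly n a b t\<bar> - max 1 \<bar>trig_radial n a b r t\<bar>)"
        by (simp add: w_def v_def log_size_def)
      also have "\<dots> \<le> 2 * radial_error n a b r" using E by (auto simp: max_def)
      finally show ?thesis .
    next
      case False
      then have "w t * (w t - v) \<le> 0" using w0 by (intro mult_nonneg_nonpos) auto
      then show ?thesis using E by linarith
    qed
    moreover have "w t * (w t - poisson_sum M s r w t) \<le> w t * (w t - (real n * ln r + v - \<epsilon>))"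
      using M0[OF that, of t s] w0 by (intro mult_left_mono) (auto simp: v_def)
    ultimately show ?thesis using r by (simp add: ln_div algebra_simps)
  qed
  then show ?thesis by blast
qed

section \<open>The extremal function of an arc\<close>

text \<open>Square roots of the right half-plane lie in the sector of half-angle
  \<open>pi / 4\<close>, so a product of two of them stays in the right half-plane.\<close>

lemma csqrt_sector:
  assumes "Re u \<ge> 0"
  shows "\<bar>Im (csqrt u)\<bar> \<le> Re (csqrt u)" and "Re u > 0 \<Longrightarrow> \<bar>Im (csqrt u)\<bar> < Re (csqrt u)"
proof -
  define s where "s = csqrt u"
  have "s\<^sup>2 = u" by (simp add: s_def)
  then have e: "(Re s)\<^sup>2 - (Im s)\<^sup>2 = Re u" by (auto simp: power2_eq_square)
  have pos: "Re s \<ge> 0" using csqrt_principal[of u] by (auto simp: s_def simp del: csqrt.sel)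
  show "\<bar>Im (csqrt u)\<bar> \<le> Re (csqrt u)"
    unfolding s_def[symmetric] by (rule power2_le_imp_le[OF _ pos]) (use e assms in simp)
  show "\<bar>Im (csqrt u)\<bar> < Re (csqrt u)" if "Re u > 0"
    unfolding s_def[symmetric] by (rule power2_less_imp_less[OF _ pos]) (use e that in simp)
qed

text \<open>Continuity at 0 is the point: \<open>1 - z * cis \<beta>\<close> vanishes at a point of
  the unit circle.\<close>

lemma continuous_on_csqrt_right_halfplane: "continuous_on {u. Re u \<ge> 0} csqrt"
proof (intro continuous_at_imp_continuous_on ballI)
  fix u assume "u \<in> {u. Re u \<ge> 0}"
  show "isCont csqrt u"
  proof (cases "u = 0")
    case True
    have "((\<lambda>z. norm (csqrt z)) \<longlongrightarrow> sqrt (norm (0::complex))) (at 0)"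
      unfolding norm_csqrt by (intro tendsto_intros)
    then show ?thesis using True by (auto simp: isCont_def intro: tendsto_norm_zero_cancel)
  next
    case False
    then have "u \<notin> \<real>\<^sub>\<le>\<^sub>0" using \<open>u \<in> _\<close> by (auto simp: complex_nonpos_Reals_iff complex_eq_iff)
    then show ?thesis by (rule continuous_at_csqrt)
  qed
qed

text \<open>After division by \<open>z\<close>, the function \<open>(1 + z + arc_root \<beta> z)\<^sup>2 / (2 cos (\<beta> / 2))\<^sup>2\<close> is the inverse
  Joukowski transform of the Chebyshev polynomial \<open>2 (cos (t / 2) / cos (\<beta> / 2))\<^sup>2 - 1\<close> of the arc
  \<open>\<beta> \<le> \<bar>t\<bar> \<le> \<pi>\<close>.\<close>

definition arc_root :: "real \<Rightarrow> complex \<Rightarrow> complex" where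
  "arc_root \<beta> z = csqrt (1 - z * cis \<beta>) * csqrt (1 - z * cis (- \<beta>))"

definition arc_log :: "real \<Rightarrow> complex \<Rightarrow> complex" where
  "arc_log \<beta> z = 2 * Ln (1 + z + arc_root \<beta> z) - of_real (2 * ln (2 * cos (\<beta> / 2)))"

lemma Re_one_minus_nonneg: "norm z \<le> 1 \<Longrightarrow> Re (1 - z) \<ge> 0"
  using complex_Re_le_cmod[of z] by simp

lemma Re_one_minus_pos: "norm z < 1 \<Longrightarrow> Re (1 - z) > 0"
  using complex_Re_le_cmod[of z] by simp

lemma arc_root_square: "(arc_root \<beta> z)\<^sup>2 = 1 - 2 * of_real (cos \<beta>) * z + z\<^sup>2"
proof -
  have 1: "cis \<beta> * cis (- \<beta>) = 1" by (simp add: cis_mult)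
  have 2: "cis \<beta> + cis (- \<beta>) = 2 * of_real (cos \<beta>)" by (simp add: complex_eq_iff)
  have "(arc_root \<beta> z)\<^sup>2 = (1 - z * cis \<beta>) * (1 - z * cis (- \<beta>))"
    by (simp add: arc_root_def power_mult_distrib)
  also have "\<dots> = 1 - (cis \<beta> + cis (- \<beta>)) * z + (cis \<beta> * cis (- \<beta>)) * z\<^sup>2"
    by (simp add: algebra_simps power2_eq_square)
  finally show ?thesis by (simp only: 1 2) simp
qed

lemma Re_arc_root:
  assumes "norm z \<le> 1"
  shows "Re (arc_root \<beta> z) \<ge> 0" and "norm z < 1 \<Longrightarrow> Re (arc_root \<beta> z) > 0"
proof -
  let ?u = "1 - z * cis \<beta>" and ?v = "1 - z * cis (- \<beta>)"
  have n: "norm (z * cis \<beta>) = norm z" "norm (z * cis (- \<beta>)) = norm z" by (simp_all add: norm_mult)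
  have le: "Im p * Im q \<le> \<bar>Im p\<bar> * \<bar>Im q\<bar>" for p q by (metis abs_ge_self abs_mult)
  have Re: "Re (arc_root \<beta> z) = Re (csqrt ?u) * Re (csqrt ?v) - Im (csqrt ?u) * Im (csqrt ?v)"
    by (simp only: arc_root_def times_complex.sel)
  have uv: "Re ?u \<ge> 0" "Re ?v \<ge> 0" using Re_one_minus_nonneg n assms by metis+
  define p q where "p = csqrt ?u" and "q = csqrt ?v"
  note Re' = Re[folded p_def q_def]
  have le': "\<bar>Im p\<bar> \<le> Re p" "\<bar>Im q\<bar> \<le> Re q" unfolding p_def q_def by (intro csqrt_sector uv)+
  have "\<bar>Im p\<bar> * \<bar>Im q\<bar> \<le> Re p * Re q" using le' by (intro mult_mono) auto
  then show "Re (arc_root \<beta> z) \<ge> 0" unfolding Re' using le[of p q] by linarith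
  assume "norm z < 1"
  then have "Re ?u > 0" "Re ?v > 0" using Re_one_minus_pos n by metis+
  then have "\<bar>Im p\<bar> < Re p" "\<bar>Im q\<bar> < Re q" unfolding p_def q_def using csqrt_sector(2) uv by blast+
  then have "\<bar>Im p\<bar> * \<bar>Im q\<bar> < Re p * Re q" by (intro mult_strict_mono') auto
  then show "Re (arc_root \<beta> z) > 0" unfolding Re' using le[of p q] by linarith
qed

lemma arc_root_continuous: "continuous_on (cball 0 1) (arc_root \<beta>)"
proof -
  have "continuous_on (cball 0 1) (\<lambda>z. csqrt (1 - z * cis \<theta>))" for \<theta>
  proof (rule continuous_on_compose2[OF continuous_on_csqrt_right_halfplane])
    show "continuous_on (cball 0 1) (\<lambda>z. 1 - z * cis \<theta>)" by (intro continuous_intros)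
    show "(\<lambda>z. 1 - z * cis \<theta>) ` cball 0 1 \<subseteq> {u. Re u \<ge> 0}"
    proof clarify
      fix z :: complex assume "z \<in> cball 0 1"
      then have "norm (z * cis \<theta>) \<le> 1" by (simp add: norm_mult)
      then show "Re (1 - z * cis \<theta>) \<ge> 0" by (rule Re_one_minus_nonneg)
    qed
  qed
  then show ?thesis unfolding arc_root_def by (intro continuous_on_mult)
qed

lemma arc_root_holomorphic: "arc_root \<beta> holomorphic_on ball 0 1"
proof -
  have "1 - z * cis \<theta> \<notin> \<real>\<^sub>\<le>\<^sub>0" if "z \<in> ball 0 1" for z \<theta>
  proof -
    have "norm (z * cis \<theta>) < 1" using that by (simp add: norm_mult)
    then have "Re (1 - z * cis \<theta>) > 0" by (rule Re_one_minus_pos)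
    then show ?thesis unfolding complex_nonpos_Reals_iff by linarith
  qed
  then show ?thesis unfolding arc_root_def by (intro holomorphic_intros)
qed

lemma half_angle_cos: "4 * (cos (\<beta> / 2))\<^sup>2 = 2 + 2 * cos \<beta>" for \<beta> :: real
  using cos_double_cos[of "\<beta> / 2"] by simp

section \<open>The extremal function: harmonicity, sign and radial derivative\<close>

context
  fixes \<beta> :: real
  assumes \<beta>: "0 < \<beta>" "\<beta> < pi"
begin

lemma cos_\<beta>: "\<bar>cos \<beta>\<bar> < 1"
  using \<beta> cos_monotone_0_pi[of 0 \<beta>] cos_monotone_0_pi[of \<beta> pi] by auto

lemma cos_half_\<beta>_pos: "cos (\<beta> / 2) > 0"
  using \<beta> by (intro cos_gt_zero) auto

text \<open>Both \<open>1 + z\<close> and the root have nonnegative real part, so only the value 0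
  has to be excluded. It would make their squares equal and force \<open>z = 0\<close>, where the
  sum is 2.\<close>

lemma arc_sum_not_nonpos:
  assumes "norm z \<le> 1"
  shows "1 + z + arc_root \<beta> z \<notin> \<real>\<^sub>\<le>\<^sub>0"
proof
  let ?S = "arc_root \<beta> z"
  assume "1 + z + ?S \<in> \<real>\<^sub>\<le>\<^sub>0"
  moreover have "Re (1 + z) \<ge> 0" using Re_one_minus_nonneg[of "- z"] assms by simp
  moreover have "Re ?S \<ge> 0" using assms by (rule Re_arc_root)
  ultimately have "1 + z + ?S = 0" by (auto simp: complex_nonpos_Reals_iff complex_eq_iff)
  then have "?S = - (1 + z)" by (simp only: add_eq_0_iff)
  then have "?S\<^sup>2 = (1 + z)\<^sup>2" by (simp only: power2_minus)
  then have "of_real (2 + 2 * cos \<beta>) * z = 0"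
    unfolding arc_root_square by (simp add: algebra_simps power2_eq_square)
  moreover have "2 + 2 * cos \<beta> \<noteq> 0" using cos_\<beta> by auto
  ultimately have "z = 0" by (metis mult_eq_0_iff of_real_eq_0_iff)
  with \<open>1 + z + ?S = 0\<close> show False by (simp add: arc_root_def)
qed

lemma arc_log_continuous: "continuous_on (cball 0 1) (arc_log \<beta>)"
  unfolding arc_log_def
  by (intro continuous_intros arc_root_continuous) (use arc_sum_not_nonpos in auto)

lemma arc_log_holomorphic: "arc_log \<beta> holomorphic_on ball 0 1"
  unfolding arc_log_def
  by (intro holomorphic_intros arc_root_holomorphic) (use arc_sum_not_nonpos in auto)

lemma arc_root_ne_zero: "norm z < 1 \<Longrightarrow> arc_root \<beta> z \<noteq> 0"
  using Re_arc_root(2)[of z \<beta>] by force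

text \<open>Reduces radial derivatives of the real part to the sign and size of the real part of
  \<open>(1 - z) / arc_root \<beta> z\<close>.\<close>

lemma arc_log_deriv:
  assumes "norm z < 1"
  shows "\<exists>D. (arc_log \<beta> has_field_derivative D) (at z) \<and> z * D = 1 - (1 - z) / arc_root \<beta> z"
proof -
  let ?S = "arc_root \<beta> z" and ?c = "of_real (cos \<beta>) :: complex"
  let ?G = "1 + z + ?S"
  have S0: "?S \<noteq> 0" using arc_root_ne_zero assms by blast
  have G: "?G \<notin> \<real>\<^sub>\<le>\<^sub>0" using arc_sum_not_nonpos assms by simp
  then have G0: "?G \<noteq> 0" by auto
  obtain D where D: "(arc_root \<beta> has_field_derivative D) (at z)"
    using arc_root_holomorphic[of \<beta>] assms holomorphic_on_open[OF open_ball] by (metis mem_ball_0)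
  have "((\<lambda>z. (arc_root \<beta> z)\<^sup>2) has_field_derivative 2 * ?S * D) (at z)"
    using D by (auto intro!: derivative_eq_intros)
  moreover have "((\<lambda>z. (arc_root \<beta> z)\<^sup>2) has_field_derivative 2 * z - 2 * ?c) (at z)"
    unfolding arc_root_square by (auto intro!: derivative_eq_intros)
  ultimately have "2 * ?S * D = 2 * z - 2 * ?c" by (rule DERIV_unique)
  then have SD: "?S * D = z - ?c" by (metis mult.assoc mult_cancel_left right_diff_distrib zero_neq_numeral)
  have der: "(arc_log \<beta> has_field_derivative 2 * ((1 + D) / ?G)) (at z)"
    unfolding arc_log_def
    by (rule derivative_eq_intros D G refl | simp add: G divide_inverse mult_ac)+
  have sq: "?S\<^sup>2 = 1 - 2 * ?c * z + z\<^sup>2" by (rule arc_root_square)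
  have "z * (2 * (1 + D)) * ?S = 2 * z * (?S + ?S * D)" by (simp add: algebra_simps)
  also have "\<dots> = (?S - (1 - z)) * ?G"
    unfolding SD using sq by (simp add: algebra_simps power2_eq_square)
  finally have "z * (2 * ((1 + D) / ?G)) = (?S - (1 - z)) / ?S"
    using S0 G0 by (simp add: frac_eq_eq mult_ac)
  also have "\<dots> = 1 - (1 - z) / ?S" using S0 by (simp add: diff_divide_distrib)
  finally show ?thesis using der by blast
qed

text \<open>A purely imaginary quotient has square \<open>- q\<close> with \<open>q > 0\<close>,
  which makes \<open>z\<close> a root of \<open>z\<^sup>2 - 2 * d * z + 1\<close> with
  \<open>\<bar>d\<bar> < 1\<close>. Such roots have modulus 1.\<close>

lemma arc_quotient_Re_ne_zero:
  assumes "norm z < 1"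
  shows "Re ((1 - z) / arc_root \<beta> z) \<noteq> 0"
proof
  let ?S = "arc_root \<beta> z" and ?R = "(1 - z) / arc_root \<beta> z"
  assume R: "Re ?R = 0"
  define q where "q = (Im ?R)\<^sup>2"
  have "w\<^sup>2 = - of_real ((Im w)\<^sup>2)" if "Re w = 0" for w
    using that by (simp add: complex_eq_iff power2_eq_square)
  from this[OF R] have "?R\<^sup>2 = - of_real q" by (simp only: q_def)
  moreover have S0: "?S \<noteq> 0" using arc_root_ne_zero assms by blast
  ultimately have "(1 - z)\<^sup>2 = - of_real q * ?S\<^sup>2" by (simp add: power_divide field_simps)
  then have e: "(1 - z)\<^sup>2 + of_real q * (1 - 2 * of_real (cos \<beta>) * z + z\<^sup>2) = 0"
    unfolding arc_root_square by simp
  define d where "d = (1 + q * cos \<beta>) / (1 + q)"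
  have q0: "q \<ge> 0" by (simp add: q_def)
  have q1: "q \<noteq> 0"
  proof
    assume "q = 0"
    with e have "z = 1" by simp
    with assms show False by simp
  qed
  have "(1 + q) * d = 1 + q * cos \<beta>" using q0 by (simp add: d_def)
  then have dd: "of_real (1 + q) * of_real d = (1 + of_real q * of_real (cos \<beta>) :: complex)"
    by (metis of_real_1 of_real_add of_real_mult)
  have "of_real (1 + q) * (z\<^sup>2 - 2 * of_real d * z + 1)
      = of_real (1 + q) * (z\<^sup>2 + 1) - 2 * z * (of_real (1 + q) * of_real d)" by (simp only: algebra_simps)
  also have "\<dots> = (1 - z)\<^sup>2 + of_real q * (1 - 2 * of_real (cos \<beta>) * z + z\<^sup>2)"
    unfolding dd by (simp add: algebra_simps power2_eq_square)
  finally have "of_real (1 + q) * (z\<^sup>2 - 2 * of_real d * z + 1) = 0" using e by simp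
  moreover have "of_real (1 + q) \<noteq> (0 :: complex)" using q0 by (metis add_nonneg_eq_0_iff of_real_eq_0_iff zero_le_one zero_neq_one)
  ultimately have z: "z\<^sup>2 - 2 * of_real d * z + 1 = 0" by (metis mult_eq_0_iff)
  have "q * cos \<beta> < q * 1" "q * (- 1) < q * cos \<beta>"
    using cos_\<beta> q0 q1 by (intro mult_strict_left_mono; simp add: abs_less_iff)+
  then have d: "d < 1" "- 1 < d" using q0 by (auto simp: d_def divide_simps)
  have re: "(Re z)\<^sup>2 - (Im z)\<^sup>2 - 2 * d * Re z + 1 = 0" and im: "Im z * (Re z - d) = 0"
    using arg_cong[OF z, of Re] arg_cong[OF z, of Im] by (auto simp: power2_eq_square algebra_simps)
  have d2: "d\<^sup>2 < 1" using d by (simp add: abs_square_less_1)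
  show False
  proof (cases "Im z = 0")
    case True
    then have "(Re z - d)\<^sup>2 + (1 - d\<^sup>2) = 0" using re by (simp add: power2_eq_square algebra_simps)
    then show False using d2 zero_le_power2[of "Re z - d"] by linarith
  next
    case False
    then have "Re z = d" using im by simp
    then have "(Re z)\<^sup>2 + (Im z)\<^sup>2 = 1" using re by (simp add: power2_eq_square)
    then have "(norm z)\<^sup>2 = 1" by (simp only: cmod_power2)
    moreover have "(norm z)\<^sup>2 < 1" using assms by (simp add: power_less_one_iff)
    ultimately show False by simp
  qed
qed

text \<open>The quotient is 1 at the origin; along the segment to \<open>z\<close> its real part
  cannot change sign without vanishing.\<close>

lemma arc_quotient_Re_nonneg:
  assumes "norm z < 1"
  shows "Re ((1 - z) / arc_root \<beta> z) \<ge> 0"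
proof (rule ccontr)
  assume neg: "\<not> ?thesis"
  define g where "g \<tau> = Re ((1 - of_real \<tau> * z) / arc_root \<beta> (of_real \<tau> * z))" for \<tau> :: real
  have lt: "norm (of_real \<tau> * z) < 1" if "\<tau> \<in> {0..1}" for \<tau> :: real
  proof -
    have "\<bar>\<tau>\<bar> * norm z \<le> 1 * norm z" using that by (intro mult_right_mono) auto
    then have "norm (of_real \<tau> * z) \<le> norm z" by (simp add: norm_mult)
    then show ?thesis using assms by simp
  qed
  have cont: "continuous_on {0..1} g"
    unfolding g_def
  proof (intro continuous_on_Re continuous_on_divide)
    show "continuous_on {0..1} (\<lambda>\<tau>. 1 - complex_of_real \<tau> * z)" by (intro continuous_intros)
    show "continuous_on {0..1} (\<lambda>\<tau>. arc_root \<beta> (complex_of_real \<tau> * z))"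
    proof (rule continuous_on_compose2[OF arc_root_continuous])
      show "continuous_on {0..1} (\<lambda>\<tau>. complex_of_real \<tau> * z)" by (intro continuous_intros)
      show "(\<lambda>\<tau>. complex_of_real \<tau> * z) ` {0..1} \<subseteq> cball 0 1"
        using lt less_imp_le by (fastforce simp del: norm_mult)
    qed
    show "\<forall>\<tau>\<in>{0..1}. arc_root \<beta> (complex_of_real \<tau> * z) \<noteq> 0"
      using lt arc_root_ne_zero by blast
  qed
  have "g 0 = 1" by (simp add: g_def arc_root_def)
  moreover have "g 1 \<le> 0" using neg by (simp add: g_def del: Re_divide)
  ultimately obtain \<tau> where "0 \<le> \<tau>" "\<tau> \<le> 1" "g \<tau> = 0"
    using IVT2'[of g 1 0 0] cont by auto
  then show False using arc_quotient_Re_ne_zero[OF lt[of \<tau>]] unfolding g_def by auto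
qed

text \<open>On the circle the three squares are real multiples of the same \<open>z\<close>, so
  quotients of their roots are real or purely imaginary.\<close>

lemma circle_squares:
  fixes t :: real
  defines "z \<equiv> cis t"
  shows "(1 + z)\<^sup>2 = of_real (2 + 2 * cos t) * z" "(1 - z)\<^sup>2 = of_real (2 * cos t - 2) * z"
    "(arc_root \<beta> z)\<^sup>2 = of_real (2 * cos t - 2 * cos \<beta>) * z"
proof -
  have "cis t * cis t + 1 = 2 * of_real (cos t) * cis t"
    using sin_cos_squared_add[of t] by (simp add: complex_eq_iff power2_eq_square algebra_simps)
  then have zz: "z\<^sup>2 = 2 * of_real (cos t) * z - 1" by (simp add: z_def power2_eq_square algebra_simps)
  show "(1 + z)\<^sup>2 = of_real (2 + 2 * cos t) * z" "(1 - z)\<^sup>2 = of_real (2 * cos t - 2) * z"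
    using zz by (simp_all add: power2_sum power2_diff algebra_simps)
  show "(arc_root \<beta> z)\<^sup>2 = of_real (2 * cos t - 2 * cos \<beta>) * z"
    unfolding arc_root_square zz by (simp add: algebra_simps)
qed

text \<open>With S the root, \<open>1 + z + S\<close> and \<open>1 + z - S\<close> have a product of
  modulus \<open>(2 * cos (\<beta> / 2))\<^sup>2\<close>, and the branch of S, through
  \<open>Re p \<ge> 0\<close>, makes the first factor the larger one.\<close>

lemma arc_log_circle_nonneg: "Re (arc_log \<beta> (cis t)) \<ge> 0"
proof -
  define z where "z = cis t"
  let ?S = "arc_root \<beta> z"
  define p where "p = (1 + z) * cnj ?S"
  have nz: "norm z = 1" by (simp add: z_def)
  have "p\<^sup>2 = (1 + z)\<^sup>2 * cnj (?S\<^sup>2)" by (simp add: p_def power_mult_distrib)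
  also have "\<dots> = of_real ((2 + 2 * cos t) * (2 * cos t - 2 * cos \<beta>)) * (z * cnj z)"
    unfolding z_def circle_squares by (simp add: mult_ac)
  also have "z * cnj z = 1" using nz by (simp add: complex_norm_square[symmetric])
  finally have "Im (p\<^sup>2) = 0" by simp
  then have alt: "Re p = 0 \<or> Im p = 0" by (auto simp: power2_eq_square)
  \<comment> \<open>\<open>p\<^sup>2\<close> is real. A negative real \<open>p\<close> would make
    the root a negative multiple of \<open>1 + z\<close>; the signs of the two real parts then force
    \<open>z = - 1\<close>, where \<open>p = 0\<close>.\<close>
  have p0: "Re p \<ge> 0"
  proof (rule ccontr)
    assume neg: "\<not> Re p \<ge> 0"
    then have "Im p = 0" using alt by auto
    then have pe: "p = of_real (Re p)" by (simp add: complex_eq_iff)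
    have S0: "?S \<noteq> 0" using neg by (auto simp: p_def)
    have "(1 + z) * (cnj ?S * ?S) = of_real (Re p) * ?S" using pe by (simp add: p_def mult.assoc)
    moreover have "cnj ?S * ?S = of_real ((norm ?S)\<^sup>2)" by (metis complex_norm_square mult.commute)
    ultimately have "(1 + z) * of_real ((norm ?S)\<^sup>2) = of_real (Re p) * ?S" by simp
    from arg_cong[OF this, of Re] have "Re (1 + z) * (norm ?S)\<^sup>2 = Re p * Re ?S" by simp
    moreover have "Re p * Re ?S \<le> 0" using neg Re_arc_root(1)[of z \<beta>] nz by (intro mult_nonpos_nonneg) auto
    ultimately have "Re (1 + z) \<le> 0" using S0 by (metis mult_pos_pos norm_eq_zero not_le zero_less_power2)
    then have "1 + cos t \<le> 0" by (simp add: z_def)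
    then have "cos t = - 1" using cos_ge_minus_one[of t] by linarith
    then have "(1 + z)\<^sup>2 = 0" unfolding z_def circle_squares by simp
    then show False using neg by (simp add: p_def)
  qed
  have le: "norm (1 + z - ?S) \<le> norm (1 + z + ?S)"
  proof (rule power2_le_imp_le)
    have "Re p = Re (1 + z) * Re ?S + Im (1 + z) * Im ?S" by (simp add: p_def)
    then show "(norm (1 + z - ?S))\<^sup>2 \<le> (norm (1 + z + ?S))\<^sup>2"
      using p0 unfolding cmod_power2 by (simp add: power2_eq_square algebra_simps)
  qed simp
  have "(1 + z + ?S) * (1 + z - ?S) = (1 + z)\<^sup>2 - ?S\<^sup>2" by (simp add: power2_eq_square algebra_simps)
  also have "\<dots> = of_real (4 * (cos (\<beta> / 2))\<^sup>2) * z"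
    unfolding half_angle_cos unfolding z_def circle_squares by (simp add: algebra_simps)
  finally have "norm ((1 + z + ?S) * (1 + z - ?S)) = norm (of_real (4 * (cos (\<beta> / 2))\<^sup>2) * z)"
    by (rule arg_cong)
  also have "\<dots> = (2 * cos (\<beta> / 2))\<^sup>2" unfolding norm_mult norm_of_real nz by (simp add: power_mult_distrib)
  finally have "norm (1 + z + ?S) * norm (1 + z - ?S) = (2 * cos (\<beta> / 2))\<^sup>2" unfolding norm_mult .
  then have "(2 * cos (\<beta> / 2))\<^sup>2 \<le> (norm (1 + z + ?S))\<^sup>2"
    using mult_left_mono[OF le norm_ge_zero[of "1 + z + ?S"]] by (simp add: power2_eq_square)
  then have g: "2 * cos (\<beta> / 2) \<le> norm (1 + z + ?S)" by (rule power2_le_imp_le) simp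
  have "1 + z + ?S \<noteq> 0" using arc_sum_not_nonpos[of z] nz by auto
  then have "Re (arc_log \<beta> z) = 2 * ln (norm (1 + z + ?S)) - 2 * ln (2 * cos (\<beta> / 2))"
    by (simp add: arc_log_def)
  moreover have "0 < norm (1 + z + ?S)" using g cos_half_\<beta>_pos by linarith
  then have "ln (2 * cos (\<beta> / 2)) \<le> ln (norm (1 + z + ?S))" using g cos_half_\<beta>_pos by (subst ln_le_cancel_iff) auto
  ultimately show ?thesis by (simp only: z_def)
qed

lemma arc_log_zero: "Re (arc_log \<beta> 0) = - 2 * ln (cos (\<beta> / 2))"
  using cos_half_\<beta>_pos by (simp add: arc_log_def arc_root_def ln_mult)

lemma arc_log_radial_deriv:
  assumes "0 < r" "r < 1"
  shows "((\<lambda>r. Re (arc_log \<beta> (of_real r * cis t))) has_real_derivative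
    (1 - Re ((1 - of_real r * cis t) / arc_root \<beta> (of_real r * cis t))) / r) (at r)"
proof -
  define z where "z = of_real r * cis t"
  have "norm z < 1" using assms by (simp add: z_def norm_mult)
  then obtain D where D: "(arc_log \<beta> has_field_derivative D) (at z)"
    and zD: "z * D = 1 - (1 - z) / arc_root \<beta> z" using arc_log_deriv by blast
  have "((\<lambda>r. of_real r * cis t) has_vector_derivative cis t) (at r)"
    by (auto intro!: derivative_eq_intros)
  moreover have "(arc_log \<beta> has_field_derivative D) (at (of_real r * cis t) within range (\<lambda>r. of_real r * cis t))"
    using D has_field_derivative_at_within by (auto simp: z_def)
  ultimately have "((arc_log \<beta> \<circ> (\<lambda>r. of_real r * cis t)) has_vector_derivative cis t * D) (at r)"
    by (intro field_vector_diff_chain_within)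
  then have "((\<lambda>r. Re (arc_log \<beta> (of_real r * cis t))) has_vector_derivative Re (cis t * D)) (at r)"
    unfolding o_def by (rule bounded_linear.has_vector_derivative[OF bounded_linear_Re])
  moreover have "r * Re (cis t * D) = 1 - Re ((1 - z) / arc_root \<beta> z)"
  proof -
    have "r * Re (cis t * D) = Re (z * D)" by (simp add: z_def algebra_simps)
    then show ?thesis by (simp only: zD minus_complex.sel one_complex.sel)
  qed
  then have "Re (cis t * D) = (1 - Re ((1 - z) / arc_root \<beta> z)) / r"
    using assms by (metis less_irrefl nonzero_mult_div_cancel_left)
  ultimately show ?thesis by (simp only: has_real_derivative_iff_has_vector_derivative z_def)
qed

lemma arc_log_radial_continuous:
  assumes "0 < r"
  shows "continuous_on {r..1} (\<lambda>r. Re (arc_log \<beta> (of_real r * cis t)))"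
proof (intro continuous_intros continuous_on_compose2[OF arc_log_continuous])
  show "(\<lambda>r. complex_of_real r * cis t) ` {r..1} \<subseteq> cball 0 1" using assms by (auto simp: norm_mult)
qed

text \<open>After subtracting \<open>ln r\<close> the radial derivative is minus the real part of
  the quotient over \<open>r\<close>, hence nonpositive. This feeds the upper bound on the energy of
  the extremal function.\<close>

lemma arc_log_radial_upper:
  assumes "0 < r" "r < 1"
  shows "Re (arc_log \<beta> (cis t)) - Re (arc_log \<beta> (of_real r * cis t)) \<le> ln (1 / r)"
proof -
  let ?f = "\<lambda>r. Re (arc_log \<beta> (of_real r * cis t)) - ln r"
  have "?f 1 \<le> ?f r"
  proof (rule DERIV_nonpos_imp_decreasing_open[of r 1])
    fix x assume x: "r < x" "x < 1"
    let ?R = "Re ((1 - of_real x * cis t) / arc_root \<beta> (of_real x * cis t))"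
    have "(?f has_real_derivative (1 - ?R) / x - 1 / x) (at x)"
      using x assms by (intro DERIV_diff arc_log_radial_deriv DERIV_ln_divide) auto
    moreover have "?R \<ge> 0" using x assms by (intro arc_quotient_Re_nonneg) (auto simp: norm_mult)
    then have "(1 - ?R) / x - 1 / x \<le> 0" using x assms by (simp add: field_simps)
    ultimately show "\<exists>y. (?f has_real_derivative y) (at x) \<and> y \<le> 0" by blast
  next
    show "continuous_on {r..1} ?f"
      using assms by (intro continuous_on_diff arc_log_radial_continuous continuous_on_ln continuous_on_id) auto
  qed (use assms in auto)
  then show ?thesis using assms by (simp add: ln_div)
qed

text \<open>On the unit circle the quotient is purely imaginary for
  \<open>\<bar>t\<bar> < \<beta>\<close>. Uniform continuity carries this inward, but only for
  \<open>\<bar>t\<bar> \<le> \<gamma>\<close>, as the denominator vanishes at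
  \<open>t = \<beta>\<close>.\<close>

lemma arc_quotient_small:
  assumes "0 < \<gamma>" "\<gamma> < \<beta>" "\<delta> > 0"
  obtains \<rho> where "0 < \<rho>" "\<rho> < 1"
    "\<And>r t. \<rho> \<le> r \<Longrightarrow> r < 1 \<Longrightarrow> \<bar>t\<bar> \<le> \<gamma> \<Longrightarrow> Re ((1 - of_real r * cis t) / arc_root \<beta> (of_real r * cis t)) \<le> \<delta>"
proof -
  define K where "K = {1/2..1::real} \<times> {- \<gamma>..\<gamma>}"
  define P where "P x = of_real (fst x) * cis (snd x)" for x :: "real \<times> real"
  define R where "R x = (1 - P x) / arc_root \<beta> (P x)" for x
  have cosgt: "cos t > cos \<beta>" if "\<bar>t\<bar> \<le> \<gamma>" for t
    using cos_monotone_0_pi[of "\<bar>t\<bar>" \<beta>] that assms \<beta> by simp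
  have S0: "arc_root \<beta> (P x) \<noteq> 0" if "x \<in> K" for x
  proof (cases "fst x = 1")
    case True
    have "(arc_root \<beta> (P x))\<^sup>2 = of_real (2 * cos (snd x) - 2 * cos \<beta>) * cis (snd x)"
      unfolding P_def True using circle_squares(3) by simp
    moreover have "2 * cos (snd x) - 2 * cos \<beta> \<noteq> 0" using cosgt[of "snd x"] that by (auto simp: K_def abs_le_iff)
    ultimately show ?thesis by (metis cis_neq_zero mult_eq_0_iff of_real_eq_0_iff power_zero_numeral)
  next
    case False
    then show ?thesis using that by (intro arc_root_ne_zero) (auto simp: K_def P_def norm_mult)
  qed
  have contP: "continuous_on K P"
    unfolding P_def cis_conv_exp by (intro continuous_intros)
  have "continuous_on K R"
    unfolding R_def
  proof (intro continuous_intros contP)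
    show "continuous_on K (\<lambda>x. arc_root \<beta> (P x))"
      by (rule continuous_on_compose2[OF arc_root_continuous contP]) (auto simp: K_def P_def norm_mult)
  qed (use S0 in blast)
  moreover have "compact K" unfolding K_def by (intro compact_Times compact_Icc)
  ultimately have "uniformly_continuous_on K R" by (intro compact_uniformly_continuous)
  then obtain d where "d > 0" and d: "\<And>x y. x \<in> K \<Longrightarrow> y \<in> K \<Longrightarrow> dist x y < d \<Longrightarrow> dist (R x) (R y) < \<delta>"
    unfolding uniformly_continuous_on_def using \<open>\<delta> > 0\<close> by metis
  have R1: "Re (R (1, t)) = 0" if "\<bar>t\<bar> \<le> \<gamma>" for t
  proof -
    have "(R (1, t))\<^sup>2 = (of_real (2 * cos t - 2) * cis t) / (of_real (2 * cos t - 2 * cos \<beta>) * cis t)"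
      unfolding R_def P_def power_divide by (simp only: fst_conv snd_conv of_real_1 mult_1 circle_squares)
    also have "\<dots> = of_real ((2 * cos t - 2) / (2 * cos t - 2 * cos \<beta>))" by simp
    finally have e: "(R (1, t))\<^sup>2 = of_real ((2 * cos t - 2) / (2 * cos t - 2 * cos \<beta>))" .
    moreover have "(2 * cos t - 2) / (2 * cos t - 2 * cos \<beta>) \<le> 0"
      using cosgt[OF that] by (intro divide_nonpos_pos) auto
    ultimately have "Re ((R (1, t))\<^sup>2) \<le> 0" "Im ((R (1, t))\<^sup>2) = 0" by simp_all
    then show ?thesis by (auto simp: power2_eq_square mult_le_0_iff)
  qed
  define \<rho> where "\<rho> = max (1/2) (1 - d / 2)"
  have \<rho>: "0 < \<rho>" "\<rho> < 1" "1/2 \<le> \<rho>" "1 - \<rho> < d" using \<open>d > 0\<close> by (auto simp: \<rho>_def)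
  have "Re ((1 - of_real r * cis t) / arc_root \<beta> (of_real r * cis t)) \<le> \<delta>"
    if "\<rho> \<le> r" "r < 1" "\<bar>t\<bar> \<le> \<gamma>" for r t
  proof -
    have "dist (R (r, t)) (R (1, t)) < \<delta>"
      using that \<rho> by (intro d) (auto simp: K_def dist_Pair_Pair dist_real_def)
    then have "\<bar>Re (R (r, t) - R (1, t))\<bar> < \<delta>" using abs_Re_le_cmod[of "R (r, t) - R (1, t)"] by (simp add: dist_norm)
    then have "Re (R (r, t)) \<le> \<delta>" using R1[OF that(3)] by simp
    then show ?thesis by (simp add: R_def P_def)
  qed
  with \<rho> that show thesis by blast
qed

text \<open>By the mean value theorem along radii: the normal derivative is nearly 1, uniformly on
  the shorter arc. This is the estimate tested against the rearranged \<open>w\<close>.\<close>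

lemma arc_log_radial_lower:
  assumes "0 < \<gamma>" "\<gamma> < \<beta>" "0 < \<delta>" "\<delta> < 1"
  obtains \<rho> where "0 < \<rho>" "\<rho> < 1"
    "\<And>r t. \<rho> \<le> r \<Longrightarrow> r < 1 \<Longrightarrow> \<bar>t\<bar> \<le> \<gamma> \<Longrightarrow>
       (1 - \<delta>) * (1 - r) \<le> Re (arc_log \<beta> (cis t)) - Re (arc_log \<beta> (of_real r * cis t))"
proof -
  obtain \<rho> where \<rho>: "0 < \<rho>" "\<rho> < 1"
    and R: "\<And>r t. \<rho> \<le> r \<Longrightarrow> r < 1 \<Longrightarrow> \<bar>t\<bar> \<le> \<gamma> \<Longrightarrow> Re ((1 - of_real r * cis t) / arc_root \<beta> (of_real r * cis t)) \<le> \<delta>"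
    using arc_quotient_small[OF assms(1-3)] by metis
  have "(1 - \<delta>) * (1 - r) \<le> Re (arc_log \<beta> (cis t)) - Re (arc_log \<beta> (of_real r * cis t))"
    if r: "\<rho> \<le> r" "r < 1" "\<bar>t\<bar> \<le> \<gamma>" for r t
  proof -
    let ?V = "\<lambda>r. Re (arc_log \<beta> (of_real r * cis t))"
    let ?R = "\<lambda>x. Re ((1 - of_real x * cis t) / arc_root \<beta> (of_real x * cis t))"
    have der: "(?V has_real_derivative (1 - ?R x) / x) (at x)" if "r < x" "x < 1" for x
      using that r \<rho> by (intro arc_log_radial_deriv) auto
    have "\<exists>l x. r < x \<and> x < 1 \<and> DERIV ?V x :> l \<and> ?V 1 - ?V r = (1 - r) * l"
      using r \<rho> der by (intro MVT arc_log_radial_continuous) (auto simp: real_differentiable_def)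
    then obtain x where x: "r < x" "x < 1" "?V 1 - ?V r = (1 - r) * ((1 - ?R x) / x)"
      using der DERIV_unique by metis
    have "1 - \<delta> \<le> 1 - ?R x" using R[of x t] x r by simp
    also have "\<dots> \<le> (1 - ?R x) / x"
      using x r \<rho> assms R[of x t] by (simp add: le_divide_eq mult_left_le del: Re_divide)
    finally have "(1 - r) * (1 - \<delta>) \<le> ?V 1 - ?V r" unfolding x(3) using r by (intro mult_left_mono) auto
    then show ?thesis by (simp add: mult.commute)
  qed
  with \<rho> that show thesis by blast
qed

end

section \<open>The sharp bound on the leading coefficient\<close>

lemma avg_swap: "avg M (\<lambda>k. avg M (\<lambda>l. F k l)) = avg M (\<lambda>l. avg M (\<lambda>k. F k l))"
  unfolding avg_def sum_divide_distrib[symmetric] by (subst sum.swap) (rule refl)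

lemma avg_mono_on: "(\<And>k. k \<in> {- int M..int M} \<Longrightarrow> g k \<le> f k) \<Longrightarrow> avg M g \<le> (avg M f :: real)"
  unfolding avg_def by (intro divide_right_mono sum_mono) auto

lemma avg_permute:
  assumes "\<sigma> permutes {- int M..int M}"
  shows "avg M (\<lambda>k. g (\<sigma> k)) = avg M g"
  unfolding avg_def using sum.permute[OF assms, of g] by (simp add: o_def)

section \<open>The discrete energy form\<close>

definition poisson_matrix :: "nat \<Rightarrow> real \<Rightarrow> (int \<Rightarrow> real) \<Rightarrow> int \<Rightarrow> real" where
  "poisson_matrix M r u k = avg M (\<lambda>l. poisson r (of_int (k - l) * grid_step M) * u l)"

definition energy :: "nat \<Rightarrow> real \<Rightarrow> (int \<Rightarrow> real) \<Rightarrow> (int \<Rightarrow> real) \<Rightarrow> real" where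
  "energy M r u v = avg M (\<lambda>k. u k * (v k - poisson_matrix M r v k))"

text \<open>The matrix sees only differences of nodes and not \<open>s\<close>, so samples taken
  with different shifts can be paired in one energy.\<close>

lemma poisson_sum_node: "poisson_sum M s r \<phi> (node M s k) = poisson_matrix M r (\<lambda>l. \<phi> (node M s l)) k"
proof -
  have "node M s k - node M s l = of_int (k - l) * grid_step M" for l by (simp add: node_def algebra_simps)
  then show ?thesis by (simp only: poisson_sum_def poisson_matrix_def)
qed

lemma avg_mult_poisson_matrix:
  "avg M (\<lambda>k. u k * poisson_matrix M r v k)
     = avg M (\<lambda>k. avg M (\<lambda>l. poisson r (of_int (k - l) * grid_step M) * u k * v l))"
  unfolding poisson_matrix_def avg_cmult[symmetric] by (simp only: mult_ac)

lemma energy_commute: "energy M r u v = energy M r v u"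
proof -
  have p: "poisson r (of_int (k - l) * grid_step M) = poisson r (of_int (l - k) * grid_step M)" for k l
  proof -
    have e: "of_int (k - l) * grid_step M = - (of_int (l - k) * grid_step M)" by (simp add: algebra_simps)
    show ?thesis unfolding e by simp
  qed
  have "avg M (\<lambda>k. u k * poisson_matrix M r v k) = avg M (\<lambda>k. v k * poisson_matrix M r u k)"
    unfolding avg_mult_poisson_matrix by (subst avg_swap, subst p) (simp only: mult_ac)
  then show ?thesis
    by (simp add: energy_def right_diff_distrib avg_diff mult.commute)
qed

lemma poisson_matrix_diff_cmult:
  "poisson_matrix M r (\<lambda>k. u k - c * v k) k = poisson_matrix M r u k - c * poisson_matrix M r v k"
proof -
  have "poisson r x * (a - c * b) = poisson r x * a - c * (poisson r x * b)" for x a b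
    by (simp add: algebra_simps)
  then show ?thesis by (simp only: poisson_matrix_def avg_diff avg_cmult)
qed

lemma energy_diff_cmult:
  "energy M r (\<lambda>k. u k - c * v k) (\<lambda>k. u k - c * v k)
     = energy M r u u - 2 * c * energy M r u v + c\<^sup>2 * energy M r v v"
proof -
  let ?P = "poisson_matrix M r"
  have "(u k - c * v k) * ((u k - c * v k) - ?P (\<lambda>k. u k - c * v k) k)
      = u k * (u k - ?P u k) - c * (u k * (v k - ?P v k)) - c * (v k * (u k - ?P u k)) + c\<^sup>2 * (v k * (v k - ?P v k))" for k
    unfolding poisson_matrix_diff_cmult by (simp add: algebra_simps power2_eq_square)
  then have "energy M r (\<lambda>k. u k - c * v k) (\<lambda>k. u k - c * v k)
      = energy M r u u - c * energy M r u v - c * energy M r v u + c\<^sup>2 * energy M r v v"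
    unfolding energy_def by (simp only: avg_add avg_diff avg_cmult)
  then show ?thesis unfolding energy_commute[of M r v u] by simp
qed

text \<open>Bounding \<open>u k * u l\<close> by half the sum of squares leaves row and column sums,
  which are 1 only up to \<open>\<eta>\<close>; that is the price
  \<open>\<eta> * B\<^sup>2\<close>.\<close>

lemma energy_almost_nonneg:
  assumes r: "0 \<le> r" "r < 1" and row: "\<And>s t. \<bar>poisson_sum M s r (\<lambda>_. 1) t - 1\<bar> \<le> \<eta>"
    and B: "\<And>k. \<bar>u k\<bar> \<le> B"
  shows "0 \<le> \<eta> * B\<^sup>2 + energy M r u u"
proof -
  let ?p = "\<lambda>k l. poisson r (of_int (k - l) * grid_step M)"
  have \<eta>: "\<eta> \<ge> 0" using row[of 0 0] by linarith
  have R: "avg M (\<lambda>l. ?p k l) \<le> 1 + \<eta>" for k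
    using row[of 0 "node M 0 k"] unfolding poisson_sum_node by (simp add: poisson_matrix_def)
  have R': "avg M (\<lambda>k. ?p k l) \<le> 1 + \<eta>" for l
  proof -
    have e: "of_int (k - l) * grid_step M = - (of_int (l - k) * grid_step M)" for k by (simp add: algebra_simps)
    show ?thesis unfolding e using R[of l] by simp
  qed
  have sw: "avg M (\<lambda>k. avg M (\<lambda>l. (u l)\<^sup>2 / 2 * ?p k l)) = avg M (\<lambda>l. (u l)\<^sup>2 / 2 * avg M (\<lambda>k. ?p k l))"
    by (subst avg_swap) (simp only: avg_cmult)
  have "avg M (\<lambda>k. u k * poisson_matrix M r u k) \<le> avg M (\<lambda>k. avg M (\<lambda>l. (u k)\<^sup>2 / 2 * ?p k l + (u l)\<^sup>2 / 2 * ?p k l))"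
    unfolding avg_mult_poisson_matrix
  proof (intro avg_mono)
    fix k l
    have "u k * u l \<le> (u k)\<^sup>2 / 2 + (u l)\<^sup>2 / 2" using sum_squares_bound[of "u k" "u l"] by simp
    then have "?p k l * (u k * u l) \<le> ?p k l * ((u k)\<^sup>2 / 2 + (u l)\<^sup>2 / 2)"
      using poisson_nonneg[OF r] by (rule mult_left_mono)
    then show "?p k l * u k * u l \<le> (u k)\<^sup>2 / 2 * ?p k l + (u l)\<^sup>2 / 2 * ?p k l" by (simp add: algebra_simps)
  qed
  also have "\<dots> = avg M (\<lambda>k. (u k)\<^sup>2 / 2 * avg M (\<lambda>l. ?p k l)) + avg M (\<lambda>l. (u l)\<^sup>2 / 2 * avg M (\<lambda>k. ?p k l))"
    unfolding avg_add avg_cmult sw ..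
  also have "\<dots> \<le> avg M (\<lambda>k. (u k)\<^sup>2 / 2 * (1 + \<eta>)) + avg M (\<lambda>k. (u k)\<^sup>2 / 2 * (1 + \<eta>))"
    using R R' by (intro add_mono avg_mono mult_left_mono) auto
  also have "\<dots> = avg M (\<lambda>k. (u k)\<^sup>2 + \<eta> * (u k)\<^sup>2)"
    unfolding avg_add[symmetric] by (simp add: algebra_simps)
  also have "\<dots> \<le> avg M (\<lambda>k. (u k)\<^sup>2 + \<eta> * B\<^sup>2)"
    using \<eta> B by (intro avg_mono add_left_mono mult_left_mono) (auto intro: power2_le_iff_abs_le[THEN iffD2] order_trans[OF abs_ge_zero])
  also have "\<dots> = avg M (\<lambda>k. (u k)\<^sup>2) + \<eta> * B\<^sup>2" by (simp only: avg_add avg_const)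
  finally show ?thesis unfolding energy_def right_diff_distrib avg_diff by (simp add: power2_eq_square)
qed

lemma poisson_monotone_kernel:
  fixes r :: real
  assumes r: "0 \<le> r" "r < 1" and "x \<le> y" "y \<le> 1"
  shows "(1 - r\<^sup>2) / (1 - 2 * r * x + r\<^sup>2) \<le> (1 - r\<^sup>2) / (1 - 2 * r * y + r\<^sup>2)"
proof (rule divide_left_mono)
  have xy: "r * x \<le> r * y" "r * y \<le> r * 1" by (intro mult_left_mono assms)+
  then show "1 - 2 * r * y + r\<^sup>2 \<le> 1 - 2 * r * x + r\<^sup>2" by simp
  have "0 < (1 - r)\<^sup>2" using r by simp
  then have "0 < 1 - 2 * r * y + r\<^sup>2" "0 < 1 - 2 * r * x + r\<^sup>2"
    using xy by (simp_all add: power2_eq_square algebra_simps)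
  then show "0 < (1 - 2 * r * x + r\<^sup>2) * (1 - 2 * r * y + r\<^sup>2)" by simp
  show "0 \<le> 1 - r\<^sup>2" using r by (simp add: power_le_one)
qed

text \<open>The energy is the mean square, which permutations preserve, minus the Poisson form,
  which the rearrangement does not decrease since the kernel grows with the cosine.\<close>

lemma energy_rearrangement:
  assumes r: "0 \<le> r" "r < 1"
  obtains \<sigma> where "\<sigma> permutes {- int M..int M}" "energy M r (u \<circ> \<sigma>) (u \<circ> \<sigma>) \<le> energy M r u u"
    "\<And>x y. x \<in> {- int M..int M} \<Longrightarrow> y \<in> {- int M..int M} \<Longrightarrow> zig x \<le> zig y \<Longrightarrow> u (\<sigma> y) \<le> u (\<sigma> x)"
proof -
  let ?X = "{- int M..int M}" and ?N = "real (2 * M + 1)"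
  let ?K = "\<lambda>c. (1 - r\<^sup>2) / (1 - 2 * r * c + r\<^sup>2)"
  have K: "?K x \<le> ?K y" if "- 1 \<le> x" "x \<le> y" "y \<le> 1" for x y
    using r that(2,3) by (rule poisson_monotone_kernel)
  have "\<exists>\<sigma>. \<sigma> permutes ?X
    \<and> (\<Sum>x\<in>?X. \<Sum>y\<in>?X. ?K (cos (of_int (x - y) * grid_step M)) * u x * u y)
       \<le> (\<Sum>x\<in>?X. \<Sum>y\<in>?X. ?K (cos (of_int (x - y) * grid_step M)) * (u \<circ> \<sigma>) x * (u \<circ> \<sigma>) y)
    \<and> (\<forall>x\<in>?X. \<forall>y\<in>?X. zig x \<le> zig y \<longrightarrow> u (\<sigma> y) \<le> u (\<sigma> x))"
    by (rule cyclic_riesz_rearrangement[of ?K M u, OF K]) blast+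
  then obtain \<sigma> where \<sigma>: "\<sigma> permutes ?X"
    and Q: "(\<Sum>x\<in>?X. \<Sum>y\<in>?X. ?K (cos (of_int (x - y) * grid_step M)) * u x * u y)
       \<le> (\<Sum>x\<in>?X. \<Sum>y\<in>?X. ?K (cos (of_int (x - y) * grid_step M)) * (u \<circ> \<sigma>) x * (u \<circ> \<sigma>) y)"
    and ord: "\<And>x y. x \<in> ?X \<Longrightarrow> y \<in> ?X \<Longrightarrow> zig x \<le> zig y \<Longrightarrow> u (\<sigma> y) \<le> u (\<sigma> x)"
    by blast
  have e: "avg M (\<lambda>k. v k * poisson_matrix M r v k)
      = (\<Sum>x\<in>?X. \<Sum>y\<in>?X. ?K (cos (of_int (x - y) * grid_step M)) * v x * v y) / ?N / ?N" for v
    unfolding avg_mult_poisson_matrix unfolding avg_def poisson_def sum_divide_distrib[symmetric] ..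
  have "avg M (\<lambda>k. u k * poisson_matrix M r u k) \<le> avg M (\<lambda>k. (u \<circ> \<sigma>) k * poisson_matrix M r (u \<circ> \<sigma>) k)"
    unfolding e by (intro divide_right_mono Q) auto
  moreover have "avg M (\<lambda>k. (u \<circ> \<sigma>) k * (u \<circ> \<sigma>) k) = avg M (\<lambda>k. u k * u k)"
    using avg_permute[OF \<sigma>, of "\<lambda>k. u k * u k"] by simp
  ultimately have "energy M r (u \<circ> \<sigma>) (u \<circ> \<sigma>) \<le> energy M r u u"
    by (simp only: energy_def right_diff_distrib avg_diff)
  with \<sigma> ord that show thesis by blast
qed

text \<open>At least \<open>2 * \<bar>k\<bar>\<close> positions have rank at most that of
  \<open>k\<close>, and all of them carry positive values.\<close>

lemma zig_support:
  fixes v :: "int \<Rightarrow> real"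
  assumes ord: "\<And>x y. x \<in> {- int M..int M} \<Longrightarrow> y \<in> {- int M..int M} \<Longrightarrow> zig x \<le> zig y \<Longrightarrow> v y \<le> v x"
    and k: "k \<in> {- int M..int M}" "v k > 0"
  shows "2 * \<bar>k\<bar> \<le> int (card {x \<in> {- int M..int M}. v x > 0})"
proof -
  let ?X = "{- int M..int M}"
  let ?J = "{x \<in> ?X. zig x \<le> zig k}"
  have sub: "?J \<subseteq> {x \<in> ?X. v x > 0}" using ord k by (smt (verit) Collect_mono)
  have "{- \<bar>k\<bar> + (if k > 0 then 1 else 0)..\<bar>k\<bar>} \<subseteq> ?J \<or> k = 0"
    using k by (auto simp: zig_def split: if_splits)
  then have "2 * \<bar>k\<bar> \<le> int (card ?J)"
  proof
    assume s: "{- \<bar>k\<bar> + (if k > 0 then 1 else 0)..\<bar>k\<bar>} \<subseteq> ?J"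
    have "finite ?J" by (rule finite_subset[of _ ?X]) auto
    from card_mono[OF this s] show ?thesis by (auto split: if_splits)
  qed simp
  also have "int (card ?J) \<le> int (card {x \<in> ?X. v x > 0})"
    unfolding of_nat_le_iff by (rule card_mono[OF _ sub]) (rule finite_subset[of _ ?X], auto)
  finally show ?thesis .
qed

section \<open>Comparison with the extremal function and passage to the limit\<close>

lemma ln_inverse_tendsto: "((\<lambda>r. ln (1 / r) / (1 - r)) \<longlongrightarrow> 1) (at_left (1::real))"
proof -
  have "(ln has_field_derivative 1) (at (1::real) within {..<1})"
    using DERIV_ln[of "1::real"] by (simp add: has_field_derivative_at_within)
  then have lim: "((\<lambda>r. (ln r - ln 1) / (r - 1)) \<longlongrightarrow> 1) (at_left (1::real))"
    by (simp add: has_field_derivative_iff)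
  have ev: "eventually (\<lambda>r::real. r \<in> {0<..<1}) (at_left 1)" by (rule eventually_at_left_real) simp
  have "eventually (\<lambda>r::real. (ln r - ln 1) / (r - 1) = ln (1 / r) / (1 - r)) (at_left 1)"
    using ev
  proof eventually_elim
    case (elim r)
    have "(ln r - ln 1) / (r - 1) = (- ln r) / (- (r - 1))" by (simp only: minus_divide_divide ln_one diff_0_right)
    then show ?case using elim by (simp add: ln_div)
  qed
  then show ?thesis using lim by (rule Lim_transform_eventually[rotated])
qed

text \<open>\<open>shift\<close> is the discrete form of the bound on the measure: for each grid
  some rotation meets the set of large values no more often than its share
  \<open>m / (2 * pi)\<close>.\<close>

locale leading_coefficient =
  fixes n :: nat and a b :: "nat \<Rightarrow> real" and m :: real
  assumes n: "n \<ge> 1" and A_pos: "sqrt ((a n)\<^sup>2 + (b n)\<^sup>2) > 0" and m: "0 \<le> m" "m < 2 * pi"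
    and shift: "\<And>M. \<exists>s. real (card {k \<in> {- int M..int M}. \<bar>trigpoly n a b (node M s k)\<bar> > 1}) \<le> real (2 * M + 1) * m / (2 * pi)"
begin

definition A :: real where "A = sqrt ((a n)\<^sup>2 + (b n)\<^sup>2)"

abbreviation w :: "real \<Rightarrow> real" where "w \<equiv> log_size (trigpoly n a b)"

lemma w_periodic: "w (t + 2 * pi) = w t"
  by (simp add: log_size_def trigpoly_periodic)

lemma w_continuous: "continuous_on UNIV w"
  by (intro log_size_continuous continuous_intros)

lemma w_pos_iff: "w t > 0 \<longleftrightarrow> \<bar>trigpoly n a b t\<bar> > 1"
  unfolding log_size_def by (subst arcosh_real_gt_1_iff) (auto simp: max_def)

context
  fixes \<beta> \<gamma> \<delta> r :: real
  assumes \<beta>: "m / 2 \<le> \<gamma>" "0 < \<gamma>" "\<gamma> < \<beta>" "\<beta> < pi" and r: "0 < r" "r < 1" and \<delta>: "0 < \<delta>" "\<delta> < 1"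
    and lower: "\<And>t. \<bar>t\<bar> \<le> \<gamma> \<Longrightarrow>
       (1 - \<delta>) * (1 - r) \<le> Re (arc_log \<beta> (cis t)) - Re (arc_log \<beta> (of_real r * cis t))"
begin

definition v :: "real \<Rightarrow> real" where "v t = Re (arc_log \<beta> (cis t))"

lemma \<beta>': "0 < \<beta>" "\<beta> < pi" using \<beta> by auto

lemma v_continuous: "continuous_on UNIV v"
  unfolding v_def
proof (intro continuous_on_Re continuous_on_compose2[OF arc_log_continuous[OF \<beta>']])
  show "continuous_on UNIV cis" unfolding cis_conv_exp by (intro continuous_intros)
qed auto

lemma v_periodic: "v (t + 2 * pi) = v t"
proof -
  have "cis (t + 2 * pi) = cis t" by (simp add: cis_mult[symmetric])
  then show ?thesis by (simp only: v_def)
qed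

lemma v_nonneg: "v t \<ge> 0"
  unfolding v_def by (rule arc_log_circle_nonneg[OF \<beta>'])

text \<open>Almost nonnegativity of the energy of \<open>Z - n * y\<close>, with \<open>Z\<close>
  the rearranged samples of \<open>w\<close> and \<open>y\<close> those of \<open>v\<close>. All
  errors of the grid are collected in \<open>\<epsilon>\<close>, on which \<open>M\<close> depends;
  the shift is fixed only after \<open>M\<close>.\<close>

lemma fixed_radius_bound:
  assumes "\<epsilon> > 0" and Bw: "\<And>t. \<bar>w t\<bar> \<le> Bw" and Bv: "\<And>t. \<bar>v t\<bar> \<le> Bv"
    and c: "0 \<le> 2 * ((1 - \<delta>) * (1 - r)) - ln (1 / r)"
  shows "real n * ((ln A - \<epsilon>) * (2 * ((1 - \<delta>) * (1 - r)) - ln (1 / r)))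
    \<le> \<epsilon> * (Bw + real n * Bv)\<^sup>2 + \<epsilon> * (1 + 2 * real n) * Bw + 2 * radial_error n a b r
       + (real n)\<^sup>2 * ((ln (1 / r) + \<epsilon>) * (- 2 * ln (cos (\<beta> / 2)) + \<epsilon>))"
proof -
  let ?l = "ln (1 / r)" and ?K = "- 2 * ln (cos (\<beta> / 2))"
  have "?l \<ge> 0" using r by simp
  obtain M1 where M1: "\<And>M s. M \<ge> M1 \<Longrightarrow> ln A - \<epsilon> \<le> avg M (\<lambda>k. w (node M s k))"
    using ln_lead_le_avg_log_size[where a=a and b=b, OF n \<open>\<epsilon> > 0\<close> A_pos] unfolding A_def by blast
  obtain M2 where M2: "\<And>M s t. M \<ge> M2 \<Longrightarrow>
      w t * (w t - poisson_sum M s r w t) \<le> (real n * ?l + \<epsilon>) * w t + 2 * radial_error n a b r"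
    using log_size_energy[OF r \<open>\<epsilon> > 0\<close>] by blast
  obtain M3 where M3: "\<And>M s z. M \<ge> M3 \<Longrightarrow> norm z \<le> r \<Longrightarrow> \<bar>Re (arc_log \<beta> z) - Re (schwarz_sum M s v z)\<bar> \<le> \<epsilon>"
    using poisson_sum_reproduces_harmonic[OF v_continuous v_periodic arc_log_continuous[OF \<beta>']
        arc_log_holomorphic[OF \<beta>'] _ r(2) \<open>\<epsilon> > 0\<close>] unfolding v_def by blast
  obtain M4 where M4: "\<And>M s t. M \<ge> M4 \<Longrightarrow> \<bar>poisson_sum M s r (\<lambda>_. 1) t - 1\<bar> \<le> \<epsilon>"
    using poisson_row_sum_eventually[of r \<epsilon>] r \<open>\<epsilon> > 0\<close> by (metis less_imp_le)
  define M where "M = max (max M1 M2) (max M3 M4)"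
  have M: "M \<ge> M1" "M \<ge> M2" "M \<ge> M3" "M \<ge> M4" by (auto simp: M_def)
  obtain s where s: "real (card {k \<in> {- int M..int M}. \<bar>trigpoly n a b (node M s k)\<bar> > 1}) \<le> real (2 * M + 1) * m / (2 * pi)"
    using shift by blast
  define x where "x k = w (node M s k)" for k
  \<comment> \<open>Shift 0 centres the arc at the position of rank 0, around which the
    rearrangement gathers the values.\<close>
  define y where "y k = v (node M 0 k)" for k
  have r': "0 \<le> r" "r < 1" using r by auto
  obtain \<sigma> where \<sigma>: "\<sigma> permutes {- int M..int M}" and en: "energy M r (x \<circ> \<sigma>) (x \<circ> \<sigma>) \<le> energy M r x x"
    and ord: "\<And>i j. i \<in> {- int M..int M} \<Longrightarrow> j \<in> {- int M..int M} \<Longrightarrow> zig i \<le> zig j \<Longrightarrow> x (\<sigma> j) \<le> x (\<sigma> i)"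
    using energy_rearrangement[OF r', of M x] by blast
  define Z where "Z = x \<circ> \<sigma>"
  define W where "W = avg M x"
  have W: "ln A - \<epsilon> \<le> W" using M1[OF M(1)] by (simp add: W_def x_def[abs_def])
  have x0: "x k \<ge> 0" for k by (simp add: x_def log_size_nonneg)
  have "W \<le> Bw" unfolding W_def
    using avg_mono[of x "\<lambda>_. Bw" M] Bw by (auto simp: x_def abs_le_iff)
  have avgZ: "avg M Z = W" unfolding Z_def W_def o_def by (rule avg_permute[OF \<sigma>])
  have "energy M r x x \<le> avg M (\<lambda>k. (real n * ?l + \<epsilon>) * x k + 2 * radial_error n a b r)"
    unfolding energy_def x_def
  proof (rule avg_mono)
    fix k
    show "w (node M s k) * (w (node M s k) - poisson_matrix M r (\<lambda>k. w (node M s k)) k)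
        \<le> (real n * ?l + \<epsilon>) * w (node M s k) + 2 * radial_error n a b r"
      using M2[OF M(2), of "node M s k" s] unfolding poisson_sum_node .
  qed
  also have "\<dots> = (real n * ?l + \<epsilon>) * W + 2 * radial_error n a b r"
    unfolding avg_add avg_cmult avg_const W_def ..
  finally have EZ: "energy M r Z Z \<le> (real n * ?l + \<epsilon>) * W + 2 * radial_error n a b r"
    using en unfolding Z_def by linarith
  have Py: "\<bar>Re (arc_log \<beta> (of_real r * cis (node M 0 k))) - poisson_matrix M r y k\<bar> \<le> \<epsilon>" for k
    using M3[OF M(3), of "of_real r * cis (node M 0 k)" 0] r
    unfolding Re_schwarz_sum poisson_sum_node y_def by (simp add: norm_mult)
  have "\<bar>Re (arc_log \<beta> 0) - avg M y\<bar> \<le> \<epsilon>"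
    using M3[OF M(3), of 0 0] r by (simp add: schwarz_sum_def Re_avg y_def[abs_def])
  then have avgy: "avg M y \<le> ?K + \<epsilon>" unfolding arc_log_zero[OF \<beta>'] by linarith
  have "energy M r y y \<le> avg M (\<lambda>k. (?l + \<epsilon>) * y k)"
    unfolding energy_def
  proof (rule avg_mono)
    fix k
    have "y k - poisson_matrix M r y k \<le> ?l + \<epsilon>"
      using Py[of k] arc_log_radial_upper[OF \<beta>' r, of "node M 0 k"] by (simp add: y_def v_def)
    then have "y k * (y k - poisson_matrix M r y k) \<le> y k * (?l + \<epsilon>)"
      by (rule mult_left_mono) (simp add: y_def v_nonneg)
    then show "y k * (y k - poisson_matrix M r y k) \<le> (?l + \<epsilon>) * y k" by (simp add: mult.commute)
  qed
  also have "\<dots> = (?l + \<epsilon>) * avg M y" by (rule avg_cmult)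
  also have "\<dots> \<le> (?l + \<epsilon>) * (?K + \<epsilon>)" using avgy \<open>?l \<ge> 0\<close> \<open>\<epsilon> > 0\<close> by (intro mult_left_mono) auto
  finally have Ey: "energy M r y y \<le> (?l + \<epsilon>) * (?K + \<epsilon>)" .
  \<comment> \<open>Where \<open>Z\<close> vanishes nothing is to be shown; elsewhere the node lies
    within \<open>m / 2\<close> of 0 and the lower bound on the normal derivative applies.\<close>
  have "avg M (\<lambda>k. ((1 - \<delta>) * (1 - r) - \<epsilon>) * Z k) \<le> energy M r Z y"
    unfolding energy_def
  proof (rule avg_mono_on)
    fix k assume k: "k \<in> {- int M..int M}"
    show "((1 - \<delta>) * (1 - r) - \<epsilon>) * Z k \<le> Z k * (y k - poisson_matrix M r y k)"
    proof (cases "Z k > 0")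
      case False
      then have "Z k = 0" using x0[of "\<sigma> k"] by (simp add: Z_def)
      then show ?thesis by simp
    next
      case True
      have "card {i \<in> {- int M..int M}. Z i > 0} = card {i \<in> {- int M..int M}. x i > 0}"
      proof (rule bij_betw_same_card[of \<sigma>])
        show "bij_betw \<sigma> {i \<in> {- int M..int M}. Z i > 0} {i \<in> {- int M..int M}. x i > 0}"
          unfolding Z_def
          by (rule bij_betw_byWitness[where f'="inv \<sigma>"])
            (use \<sigma> permutes_inverses[OF \<sigma>] permutes_in_image[OF \<sigma>] permutes_in_image[OF permutes_inv[OF \<sigma>]] in \<open>auto simp: image_subset_iff\<close>)
      qed
      moreover have "2 * \<bar>k\<bar> \<le> int (card {i \<in> {- int M..int M}. Z i > 0})"
        by (rule zig_support[where v=Z]) (use k True in \<open>simp_all add: Z_def ord\<close>)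
      ultimately have "2 * \<bar>real_of_int k\<bar> \<le> real (2 * M + 1) * m / (2 * pi)"
        using s unfolding x_def w_pos_iff by linarith
      then have "2 * \<bar>real_of_int k\<bar> * grid_step M \<le> real (2 * M + 1) * m / (2 * pi) * grid_step M"
        by (rule mult_right_mono) (simp add: grid_step_def)
      also have "\<dots> = m" by (simp add: grid_step_def add.commute)
      finally have "2 * (\<bar>real_of_int k\<bar> * grid_step M) \<le> m" by simp
      moreover have "\<bar>node M 0 k\<bar> = \<bar>real_of_int k\<bar> * grid_step M"
        by (simp add: node_def abs_mult grid_step_def)
      ultimately have "\<bar>node M 0 k\<bar> \<le> \<gamma>" using \<beta> by linarith
      then have "(1 - \<delta>) * (1 - r) - \<epsilon> \<le> y k - poisson_matrix M r y k"
        using lower[of "node M 0 k"] Py[of k] by (simp add: y_def v_def)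
      then have "Z k * ((1 - \<delta>) * (1 - r) - \<epsilon>) \<le> Z k * (y k - poisson_matrix M r y k)"
        using True by (intro mult_left_mono) auto
      then show ?thesis by (simp only: mult.commute)
    qed
  qed
  then have EZy: "((1 - \<delta>) * (1 - r) - \<epsilon>) * W \<le> energy M r Z y"
    unfolding avg_cmult avgZ .
  have "\<bar>Z k - real n * y k\<bar> \<le> Bw + real n * Bv" for k
  proof -
    have "\<bar>Z k\<bar> \<le> Bw" using Bw by (simp add: Z_def x_def)
    moreover have "\<bar>real n * y k\<bar> \<le> real n * Bv" using Bv by (simp add: abs_mult y_def mult_left_mono)
    ultimately show ?thesis by linarith
  qed
  \<comment> \<open>\<open>n * v\<close> is the logarithmic size of the extremal polynomial of order
    \<open>n\<close>, so in the case of equality this is the difference that vanishes in the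
    limit.\<close>
  then have "0 \<le> \<epsilon> * (Bw + real n * Bv)\<^sup>2 + energy M r (\<lambda>k. Z k - real n * y k) (\<lambda>k. Z k - real n * y k)"
    by (intro energy_almost_nonneg r' M4 M(4))
  also have "\<dots> = \<epsilon> * (Bw + real n * Bv)\<^sup>2 + (energy M r Z Z - 2 * real n * energy M r Z y + (real n)\<^sup>2 * energy M r y y)"
    unfolding energy_diff_cmult ..
  also have "\<dots> \<le> \<epsilon> * (Bw + real n * Bv)\<^sup>2 + ((real n * ?l + \<epsilon>) * W + 2 * radial_error n a b r
      - 2 * real n * (((1 - \<delta>) * (1 - r) - \<epsilon>) * W) + (real n)\<^sup>2 * ((?l + \<epsilon>) * (?K + \<epsilon>)))"
    using EZ Ey EZy by (intro add_left_mono add_mono diff_mono mult_left_mono) auto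
  finally have fin: "real n * (W * (2 * ((1 - \<delta>) * (1 - r)) - ?l))
      \<le> \<epsilon> * (Bw + real n * Bv)\<^sup>2 + \<epsilon> * (1 + 2 * real n) * W + 2 * radial_error n a b r
       + (real n)\<^sup>2 * ((?l + \<epsilon>) * (?K + \<epsilon>))"
    by (simp add: algebra_simps)
  have "real n * ((ln A - \<epsilon>) * (2 * ((1 - \<delta>) * (1 - r)) - ?l)) \<le> real n * (W * (2 * ((1 - \<delta>) * (1 - r)) - ?l))"
    using W c by (intro mult_left_mono mult_right_mono) auto
  moreover have "\<epsilon> * (1 + 2 * real n) * W \<le> \<epsilon> * (1 + 2 * real n) * Bw"
    using \<open>W \<le> Bw\<close> \<open>\<epsilon> > 0\<close> by (intro mult_left_mono) auto
  ultimately show ?thesis using fin by linarith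
qed

text \<open>The grid is already gone from the bound; only \<open>\<epsilon>\<close> is left to tend
  to 0.\<close>

lemma fixed_radius_limit:
  assumes c: "0 \<le> 2 * ((1 - \<delta>) * (1 - r)) - ln (1 / r)"
  shows "real n * (ln A * (2 * ((1 - \<delta>) * (1 - r)) - ln (1 / r)))
    \<le> 2 * radial_error n a b r + (real n)\<^sup>2 * (ln (1 / r) * (- 2 * ln (cos (\<beta> / 2))))"
proof -
  obtain Bw where Bw: "\<And>t. \<bar>w t\<bar> \<le> Bw" using periodic_bounded[OF w_continuous w_periodic] by blast
  obtain Bv where Bv: "\<And>t. \<bar>v t\<bar> \<le> Bv" using periodic_bounded[OF v_continuous v_periodic] by blast
  let ?L = "\<lambda>\<epsilon>. real n * ((ln A - \<epsilon>) * (2 * ((1 - \<delta>) * (1 - r)) - ln (1 / r)))"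
  let ?R = "\<lambda>\<epsilon>. \<epsilon> * (Bw + real n * Bv)\<^sup>2 + \<epsilon> * (1 + 2 * real n) * Bw + 2 * radial_error n a b r
       + (real n)\<^sup>2 * ((ln (1 / r) + \<epsilon>) * (- 2 * ln (cos (\<beta> / 2)) + \<epsilon>))"
  have 1: "(?L \<longlongrightarrow> ?L 0) (at_right 0)" by (intro tendsto_intros)
  have 2: "(?R \<longlongrightarrow> ?R 0) (at_right 0)" by (intro tendsto_intros)
  have "eventually (\<lambda>\<epsilon>. ?L \<epsilon> \<le> ?R \<epsilon>) (at_right 0)"
    using eventually_at_right_less[of "0::real"]
    by eventually_elim (rule fixed_radius_bound[OF _ Bw Bv c])
  from tendsto_le[OF _ 2 1 this] show ?thesis by simp
qed

end

text \<open>Dividing by \<open>1 - r\<close> and letting \<open>r\<close> tend to 1 removes the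
  radial error and turns \<open>ln (1 / r)\<close> into 1; then \<open>\<delta>\<close> tends to
  0.\<close>

lemma ln_lead_le_arc:
  assumes "m / 2 < \<beta>" "\<beta> < pi"
  shows "ln A \<le> - 2 * real n * ln (cos (\<beta> / 2))"
proof -
  let ?K = "- 2 * ln (cos (\<beta> / 2))"
  define \<gamma> where "\<gamma> = (m / 2 + \<beta>) / 2"
  have \<gamma>: "m / 2 \<le> \<gamma>" "0 < \<gamma>" "\<gamma> < \<beta>" "\<beta> < pi" "0 < \<beta>" using assms m by (auto simp: \<gamma>_def)
  \<comment> \<open>Below one half, \<open>2 * (1 - \<delta>)\<close> exceeds the limit 1 of
    \<open>ln (1 / r) / (1 - r)\<close>, which secures the sign condition of
    \<open>fixed_radius_limit\<close>.\<close>
  have \<delta>: "ln A * (2 * (1 - \<delta>) - 1) \<le> real n * ?K" if \<delta>: "0 < \<delta>" "\<delta> < 1 / 2" for \<delta>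
  proof -
    obtain \<rho> where \<rho>: "0 < \<rho>" "\<rho> < 1"
      and low: "\<And>r t. \<rho> \<le> r \<Longrightarrow> r < 1 \<Longrightarrow> \<bar>t\<bar> \<le> \<gamma> \<Longrightarrow>
       (1 - \<delta>) * (1 - r) \<le> Re (arc_log \<beta> (cis t)) - Re (arc_log \<beta> (of_real r * cis t))"
      using arc_log_radial_lower[OF \<gamma>(5,4,2,3) \<delta>(1)] \<delta>(2) by (metis less_trans half_gt_zero_iff less_numeral_extra(1) divide_less_eq_1_pos one_less_numeral_iff semiring_norm(76) zero_less_numeral)
    let ?q = "\<lambda>r. ln (1 / r) / (1 - r)" and ?e = "\<lambda>r. radial_error n a b r / (1 - r)"
    have ev1: "eventually (\<lambda>r. r \<in> {\<rho><..<1}) (at_left 1)" by (rule eventually_at_left_real) (rule \<rho>)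
    have ev2: "eventually (\<lambda>r. ?q r < 2 * (1 - \<delta>)) (at_left 1)"
      using \<delta> by (intro order_tendstoD(2)[OF ln_inverse_tendsto]) auto
    have ev: "eventually (\<lambda>r. real n * (ln A * (2 * (1 - \<delta>) - ?q r)) \<le> 2 * ?e r + (real n)\<^sup>2 * (?q r * ?K)) (at_left 1)"
      using ev1 ev2
    proof eventually_elim
      case (elim r)
      then have r: "\<rho> \<le> r" "0 < r" "r < 1" "1 - r > 0" using \<rho> by auto
      have q: "ln (1 / r) = ?q r * (1 - r)" using r by simp
      have "?q r * (1 - r) \<le> 2 * (1 - \<delta>) * (1 - r)" using elim r by (intro mult_right_mono) auto
      then have "ln (1 / r) \<le> 2 * (1 - \<delta>) * (1 - r)" using q by linarith
      then have c: "0 \<le> 2 * ((1 - \<delta>) * (1 - r)) - ln (1 / r)" by (simp only: mult.assoc diff_ge_0_iff_ge)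
      have "\<delta> < 1" using \<delta> by simp
      have "real n * (ln A * (2 * ((1 - \<delta>) * (1 - r)) - ln (1 / r)))
        \<le> 2 * radial_error n a b r + (real n)\<^sup>2 * (ln (1 / r) * ?K)"
        by (rule fixed_radius_limit[OF \<gamma>(1-4) r(2,3) \<delta>(1) \<open>\<delta> < 1\<close> low[OF r(1,3)] c])
      then have "real n * (ln A * (2 * ((1 - \<delta>) * (1 - r)) - ln (1 / r))) / (1 - r)
        \<le> (2 * radial_error n a b r + (real n)\<^sup>2 * (ln (1 / r) * ?K)) / (1 - r)"
        using r by (intro divide_right_mono) auto
      moreover have "real n * (ln A * (2 * ((1 - \<delta>) * (1 - r)) - ln (1 / r))) / (1 - r)
          = real n * (ln A * (2 * (1 - \<delta>) - ?q r))"
        using r(4) by (simp add: field_simps)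
      moreover have "(2 * radial_error n a b r + (real n)\<^sup>2 * (ln (1 / r) * ?K)) / (1 - r)
          = 2 * ?e r + (real n)\<^sup>2 * (?q r * ?K)"
        by (simp add: add_divide_distrib diff_divide_distrib)
      ultimately show ?case by simp
    qed
    have 1: "((\<lambda>r. real n * (ln A * (2 * (1 - \<delta>) - ?q r))) \<longlongrightarrow> real n * (ln A * (2 * (1 - \<delta>) - 1))) (at_left 1)"
      by (intro tendsto_intros ln_inverse_tendsto)
    have 2: "((\<lambda>r. 2 * ?e r + (real n)\<^sup>2 * (?q r * ?K)) \<longlongrightarrow> 2 * 0 + (real n)\<^sup>2 * (1 * ?K)) (at_left 1)"
      by (intro tendsto_add tendsto_mult tendsto_const ln_inverse_tendsto radial_error_tendsto)
    from tendsto_le[OF _ 2 1 ev] have "real n * (ln A * (2 * (1 - \<delta>) - 1)) \<le> real n * (real n * ?K)"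
      by (simp add: power2_eq_square mult.assoc)
    then show ?thesis using n by (simp only: mult_le_cancel_left_pos of_nat_0_less_iff)
  qed
  have "((\<lambda>\<delta>. ln A * (2 * (1 - \<delta>) - 1)) \<longlongrightarrow> ln A * (2 * (1 - 0) - 1)) (at_right 0)"
    by (intro tendsto_intros)
  moreover have "eventually (\<lambda>\<delta>::real. \<delta> \<in> {0<..<1/2}) (at_right 0)" by (rule eventually_at_right_real) simp
  then have "eventually (\<lambda>\<delta>. ln A * (2 * (1 - \<delta>) - 1) \<le> real n * ?K) (at_right 0)"
    by eventually_elim (rule \<delta>, auto)
  ultimately have "ln A * (2 * (1 - 0) - 1) \<le> real n * ?K"
    by (rule tendsto_upperbound) simp
  then show ?thesis by simp
qed

lemma lead_le: "A \<le> 1 / cos (m / 4) ^ (2 * n)"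
proof -
  have cpos: "cos (m / 4) > 0" using m by (intro cos_gt_zero_pi) auto
  have "((\<lambda>\<beta>. - 2 * real n * ln (cos (\<beta> / 2))) \<longlongrightarrow> - 2 * real n * ln (cos (m / 2 / 2))) (at_right (m / 2))"
    using cpos by (intro tendsto_intros) auto
  moreover have "eventually (\<lambda>\<beta>. \<beta> \<in> {m / 2<..<pi}) (at_right (m / 2))"
    using m by (intro eventually_at_right_real) auto
  then have "eventually (\<lambda>\<beta>. ln A \<le> - 2 * real n * ln (cos (\<beta> / 2))) (at_right (m / 2))"
    by eventually_elim (rule ln_lead_le_arc, auto)
  ultimately have "ln A \<le> - 2 * real n * ln (cos (m / 2 / 2))"
    by (rule tendsto_lowerbound) simp
  also have "\<dots> = ln (1 / cos (m / 4) ^ (2 * n))"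
    using cpos by (simp add: ln_div ln_realpow)
  finally show ?thesis using A_pos cpos by (subst (asm) ln_le_cancel_iff) (auto simp: A_def)
qed

end

section \<open>Measures of large values\<close>

text \<open>With \<open>c = sqrt (real n)\<close>, the difference
  \<open>n * ln (cos x) - ln (cos (c * x))\<close> has derivative
  \<open>c * tan (c * x) - n * tan x\<close>. That \<open>tan (c * x) \<ge> c * tan x\<close>
  follows by differentiating once more, as \<open>cos (c * x) \<le> cos x\<close>. The end point is
  separate because the logarithm breaks down there.\<close>

lemma cos_mult_le_cos_power:
  fixes n :: nat
  assumes "n \<ge> 1" "0 \<le> x" "sqrt (real n) * x \<le> pi / 2"
  shows "cos (sqrt (real n) * x) \<le> cos x ^ n"
proof (cases "sqrt (real n) * x = pi / 2")
  case True
  have "1 * x \<le> sqrt (real n) * x" using assms by (intro mult_right_mono) auto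
  then have "cos x \<ge> 0" using assms by (intro cos_ge_zero) auto
  then show ?thesis by (simp add: True)
next
  case False
  define c where "c = sqrt (real n)"
  have c1: "c \<ge> 1" and cc: "c * c = real n" using assms by (auto simp: c_def)
  have cx: "c * x < pi / 2" using assms False by (simp add: c_def)
  have pos: "cos y > 0" "cos (c * y) > 0" "cos (c * y) \<le> cos y" if "0 \<le> y" "y \<le> x" for y
  proof -
    have "c * y \<le> c * x" using that c1 by (intro mult_left_mono) auto
    moreover have "1 * y \<le> c * y" using that c1 by (intro mult_right_mono) auto
    ultimately have b: "0 \<le> y" "y \<le> c * y" "c * y < pi / 2" using cx that by auto
    then show "cos y > 0" "cos (c * y) > 0" by (auto intro!: cos_gt_zero_pi)
    show "cos (c * y) \<le> cos y" using b by (intro cos_monotone_0_pi_le) auto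
  qed
  have tan: "c * tan y \<le> tan (c * y)" if y: "0 \<le> y" "y \<le> x" for y
  proof -
    have "tan (c * 0) - c * tan 0 \<le> tan (c * y) - c * tan y"
    proof (rule DERIV_nonneg_imp_nondecreasing[OF y(1)])
      fix z assume z: "0 \<le> z" "z \<le> y"
      then have z': "0 \<le> z" "z \<le> x" using y by auto
      have "((\<lambda>z. tan (c * z) - c * tan z) has_real_derivative
          (inverse ((cos (c * z))\<^sup>2) * c - c * inverse ((cos z)\<^sup>2))) (at z)"
        using pos[OF z'] by (auto intro!: derivative_eq_intros)
      moreover have "inverse ((cos z)\<^sup>2) \<le> inverse ((cos (c * z))\<^sup>2)"
        using pos[OF z'] by (intro le_imp_inverse_le power_mono) auto
      then have "c * inverse ((cos z)\<^sup>2) \<le> c * inverse ((cos (c * z))\<^sup>2)" using c1 by (intro mult_left_mono) auto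
      then have "0 \<le> inverse ((cos (c * z))\<^sup>2) * c - c * inverse ((cos z)\<^sup>2)" by (simp add: mult.commute)
      ultimately show "\<exists>d. ((\<lambda>z. tan (c * z) - c * tan z) has_real_derivative d) (at z) \<and> 0 \<le> d" by blast
    qed
    then show ?thesis by simp
  qed
  have "real n * ln (cos 0) - ln (cos (c * 0)) \<le> real n * ln (cos x) - ln (cos (c * x))"
  proof (rule DERIV_nonneg_imp_nondecreasing[OF assms(2)])
    fix y assume y: "0 \<le> y" "y \<le> x"
    have "((\<lambda>y. real n * ln (cos y) - ln (cos (c * y))) has_real_derivative
        (c * tan (c * y) - real n * tan y)) (at y)"
      using pos[OF y] by (auto intro!: derivative_eq_intros simp: tan_def mult_ac)
    moreover have "c * (c * tan y) \<le> c * tan (c * y)" using tan[OF y] c1 by (intro mult_left_mono) auto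
    then have "0 \<le> c * tan (c * y) - real n * tan y" by (simp add: cc[symmetric] mult.assoc)
    ultimately show "\<exists>d. ((\<lambda>y. real n * ln (cos y) - ln (cos (c * y))) has_real_derivative d) (at y) \<and> 0 \<le> d"
      by blast
  qed
  then have "ln (cos (c * x)) \<le> ln (cos x ^ n)"
    using pos[of x] assms by (simp add: ln_realpow)
  then show ?thesis using pos[of x] assms by (subst (asm) ln_le_cancel_iff) (auto simp: c_def)
qed

section \<open>Measures of level sets as integrals of periodic indicators\<close>

definition big :: "(real \<Rightarrow> real) \<Rightarrow> real \<Rightarrow> real" where
  "big f = indicator {t. 1 \<le> \<bar>f t\<bar>}"

lemma big_lmeasurable:
  fixes f :: "real \<Rightarrow> real"
  assumes "continuous_on UNIV f"
  shows "{t. 1 \<le> \<bar>f t\<bar>} \<inter> {a..b} \<in> lmeasurable"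
proof -
  have "closed {t. 1 \<le> \<bar>f t\<bar>}" using assms by (intro closed_Collect_le continuous_intros)
  then show ?thesis by (intro lmeasurable_compact closed_Int_compact) auto
qed

lemma big_integrable: "continuous_on UNIV f \<Longrightarrow> big f integrable_on {a..b}"
  unfolding big_def integrable_on_indicator by (rule big_lmeasurable)

lemma integral_big: "continuous_on UNIV f \<Longrightarrow> integral {a..b} (big f) = measure lebesgue ({t. 1 \<le> \<bar>f t\<bar>} \<inter> {a..b})"
  unfolding big_def by (rule integral_indicator) (rule big_lmeasurable)

lemma mu_eq_integral_big:
  assumes "continuous_on UNIV f"
  shows "mu f = integral {0..2 * pi} (big f)"
  unfolding integral_big[OF assms] mu_def
proof (rule measure_negligible_symdiff[OF big_lmeasurable[OF assms]])
  let ?S = "{t. 1 \<le> \<bar>f t\<bar>} \<inter> {0..2 * pi}" and ?T = "{t \<in> {0..<2 * pi}. 1 \<le> \<bar>f t\<bar>}"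
  have "?S - ?T \<union> (?T - ?S) \<subseteq> {2 * pi}" by auto
  then show "negligible (?S - ?T \<union> (?T - ?S))" by (rule negligible_subset[rotated]) simp
qed

lemma integral_consecutive:
  fixes g :: "real \<Rightarrow> real"
  assumes "\<And>a b. g integrable_on {a..b}" "h \<ge> 0"
  shows "(\<Sum>j<J. integral {c + real j * h..c + (real j + 1) * h} g) = integral {c..c + real J * h} g"
proof (induction J)
  case (Suc J)
  have "integral {c..c + real J * h} g + integral {c + real J * h..c + (real J + 1) * h} g
      = integral {c..c + (real J + 1) * h} g"
    by (rule Henstock_Kurzweil_Integration.integral_combine) (use assms in \<open>auto simp: distrib_right\<close>)
  then show ?case using Suc by (simp add: add.commute)
qed simp

lemma integral_period:
  fixes g :: "real \<Rightarrow> real"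
  assumes int: "\<And>a b. g integrable_on {a..b}" and "T > 0" and per: "\<And>t. g (t + T) = g t"
  shows "integral {a..a + T} g = integral {0..T} g"
proof -
  have shift: "integral {x + of_int k * T..y + of_int k * T} g = integral {x..y} g" for x y and k :: int
  proof -
    have "g \<circ> ((+) (of_int k * T)) = g" using periodic_int[of g T, OF per] by (auto simp: add.commute)
    then show ?thesis using integral_shift_Icc_real[of x y g "of_int k * T"] by simp
  qed
  define k where "k = \<lfloor>a / T\<rfloor>"
  define a' where "a' = a - of_int k * T"
  have "of_int k \<le> a / T" "a / T < of_int k + 1" unfolding k_def by linarith+
  then have a': "0 \<le> a'" "a' < T" using \<open>T > 0\<close> by (auto simp: a'_def field_simps)
  have "integral {a..a + T} g = integral {a'..a' + T} g"
    using shift[of a' k "a' + T"] by (simp add: a'_def)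
  also have "\<dots> = integral {a'..T} g + integral {T..a' + T} g"
    using a' int by (intro Henstock_Kurzweil_Integration.integral_combine[symmetric]) auto
  also have "integral {T..a' + T} g = integral {0..a'} g" using shift[of 0 1 a'] by simp
  also have "integral {a'..T} g + integral {0..a'} g = integral {0..T} g"
    using a' int by (subst add.commute, intro Henstock_Kurzweil_Integration.integral_combine) auto
  finally show ?thesis .
qed

lemma integral_periods:
  fixes g :: "real \<Rightarrow> real"
  assumes int: "\<And>a b. g integrable_on {a..b}" and "T > 0" and per: "\<And>t. g (t + T) = g t"
  shows "integral {a..a + real k * T} g = real k * integral {0..T} g"
proof -
  have "integral {a + real j * T..a + (real j + 1) * T} g = integral {0..T} g" for j
    using integral_period[OF assms, of "a + real j * T"] by (simp add: distrib_right add.assoc)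
  then show ?thesis using integral_consecutive[OF int, of T a k] \<open>T > 0\<close> by simp
qed

text \<open>Period \<open>pi\<close> moves the computation to \<open>[- pi / 2, pi / 2]\<close>,
  where the cosine is nonnegative and the level set is one interval or empty.\<close>

lemma mu_cos:
  assumes "A \<ge> 0"
  shows "mu (\<lambda>t. A * cos t) = (if A \<ge> 1 then 4 * arccos (1 / A) else 0)"
proof -
  let ?f = "\<lambda>t. A * cos t"
  have cont: "continuous_on UNIV ?f" by (intro continuous_intros)
  note int = big_integrable[OF cont]
  have per: "big ?f (t + pi) = big ?f t" for t by (simp add: big_def indicator_def)
  have "mu ?f = 2 * integral {0..pi} (big ?f)"
    unfolding mu_eq_integral_big[OF cont] using integral_periods[OF int _ per, of 0 2] by simp
  also have "integral {0..pi} (big ?f) = integral {- (pi / 2)..- (pi / 2) + pi} (big ?f)"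
    by (rule integral_period[OF int _ per, symmetric]) simp
  also have "\<dots> = measure lebesgue ({t. 1 \<le> \<bar>?f t\<bar>} \<inter> {- (pi / 2)..pi / 2})"
    unfolding integral_big[OF cont] by simp
  also have "{t. 1 \<le> \<bar>?f t\<bar>} \<inter> {- (pi / 2)..pi / 2} = (if A \<ge> 1 then {- arccos (1 / A)..arccos (1 / A)} else {})"
  proof (cases "A \<ge> 1")
    case True
    then have inv: "0 \<le> 1 / A" "1 / A \<le> 1" "- 1 \<le> 1 / A" by (auto simp: field_simps)
    have le2: "arccos (1 / A) \<le> pi / 2" using inv by (intro arccos_le_pi2)
    have "1 \<le> \<bar>?f t\<bar> \<longleftrightarrow> \<bar>t\<bar> \<le> arccos (1 / A)" if t: "\<bar>t\<bar> \<le> pi / 2" for t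
    proof -
      have "cos t \<ge> 0" using t by (intro cos_ge_zero) auto
      then have "1 \<le> \<bar>?f t\<bar> \<longleftrightarrow> 1 / A \<le> cos t" using True by (simp add: abs_mult field_simps)
      also have "\<dots> \<longleftrightarrow> arccos (cos \<bar>t\<bar>) \<le> arccos (1 / A)"
        using inv by (subst arccos_le_mono) auto
      also have "arccos (cos \<bar>t\<bar>) = \<bar>t\<bar>" using t by (intro arccos_cos) auto
      finally show ?thesis .
    qed
    then show ?thesis using True le2 by (auto simp: abs_le_iff)
  next
    case False
    have "\<not> 1 \<le> \<bar>?f t\<bar>" for t
    proof -
      have "\<bar>?f t\<bar> \<le> A * 1" unfolding abs_mult using assms by (intro mult_mono) auto
      then show ?thesis using False by simp
    qed
    then show ?thesis using False by auto
  qed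
  also have "measure lebesgue (if A \<ge> 1 then {- arccos (1 / A)..arccos (1 / A)} else {})
      = (if A \<ge> 1 then 2 * arccos (1 / A) else 0)"
    using arccos_lbound[of "1 / A"] by (auto simp: field_simps)
  finally show ?thesis by simp
qed

text \<open>The substitution covers \<open>n\<close> full periods, and its factor
  \<open>1 / n\<close> cancels their number.\<close>

lemma mu_cos_multiple:
  fixes n :: nat
  assumes "n \<ge> 1" "A \<ge> 0"
  shows "mu (\<lambda>t. A * cos (real n * t - \<theta>)) = (if A \<ge> 1 then 4 * arccos (1 / A) else 0)"
proof -
  let ?f = "\<lambda>t. A * cos t" and ?g = "\<lambda>t. A * cos (real n * t - \<theta>)"
  have cf: "continuous_on UNIV ?f" and cg: "continuous_on UNIV ?g" by (intro continuous_intros)+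
  note int = big_integrable[OF cf]
  have per: "big ?f (t + 2 * pi) = big ?f t" for t by (simp add: big_def indicator_def)
  let ?I = "real n * integral {0..2 * pi} (big ?f)"
  have e: "integral {- \<theta>..- \<theta> + real n * (2 * pi)} (big ?f) = ?I"
    by (rule integral_periods[OF int _ per]) simp
  have "(big ?f has_integral ?I) (cbox (- \<theta>) (- \<theta> + real n * (2 * pi)))"
    unfolding e[symmetric] box_real by (rule integrable_integral[OF int])
  then have "((\<lambda>x. big ?f (real n *\<^sub>R x + - \<theta>)) has_integral (?I /\<^sub>R real n ^ DIM(real)))
      (cbox ((- \<theta> - - \<theta>) /\<^sub>R real n) ((- \<theta> + real n * (2 * pi) - - \<theta>) /\<^sub>R real n))"
    using assms by (subst has_integral_affinity_iff) auto
  moreover have "(\<lambda>x. big ?f (real n *\<^sub>R x + - \<theta>)) = big ?g" by (auto simp: big_def indicator_def)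
  ultimately have "(big ?g has_integral integral {0..2 * pi} (big ?f)) {0..2 * pi}"
    using assms by (simp add: field_simps)
  then have "mu ?g = mu ?f"
    unfolding mu_eq_integral_big[OF cf] mu_eq_integral_big[OF cg] by (rule integral_unique)
  then show ?thesis by (simp add: mu_cos[OF assms(2)])
qed

lemma cos_sin_combination:
  fixes p q :: real
  obtains \<theta> where "\<And>x. p * cos x + q * sin x = sqrt (p\<^sup>2 + q\<^sup>2) * cos (x - \<theta>)"
proof
  define z where "z = Complex p q"
  have "z = of_real (norm z) * cis (Arg z)" by (metis rcis_cmod_Arg rcis_def)
  from arg_cong[OF this, of Re] arg_cong[OF this, of Im]
  have pq: "p = norm z * cos (Arg z)" "q = norm z * sin (Arg z)" by (simp_all add: z_def)
  show "p * cos x + q * sin x = sqrt (p\<^sup>2 + q\<^sup>2) * cos (x - Arg z)" for x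
  proof -
    have "norm z * cos (x - Arg z) = norm z * cos (Arg z) * cos x + norm z * sin (Arg z) * sin x"
      by (simp add: cos_diff algebra_simps)
    also have "\<dots> = p * cos x + q * sin x" using pq by simp
    finally show ?thesis by (simp add: z_def complex_norm)
  qed
qed

text \<open>Average over \<open>s\<close> in one grid cell: the translated cells tile a period, so
  the mean number of nodes with \<open>\<bar>f\<bar> \<ge> 1\<close> is
  \<open>mu f / grid_step M\<close>.\<close>

lemma exists_shift_few_large_nodes:
  assumes cont: "continuous_on UNIV f" and per: "\<And>t. f (t + 2 * pi) = f t"
  shows "\<exists>s. real (card {k \<in> {- int M..int M}. \<bar>f (node M s k)\<bar> > 1}) \<le> real (2 * M + 1) * mu f / (2 * pi)"
proof (rule ccontr)
  assume neg: "\<not> ?thesis"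
  let ?X = "{- int M..int M}" and ?h = "grid_step M" and ?g = "big f"
  define y where "y = real (2 * M + 1) * mu f / (2 * pi)"
  \<comment> \<open>Counts are integers, so exceeding \<open>y\<close> means reaching
    \<open>q\<close>; this gap makes a non-strict comparison of integrals sufficient.\<close>
  define q where "q = of_int \<lfloor>y\<rfloor> + (1::real)"
  have q: "q > y" unfolding q_def by linarith
  have h: "?h > 0" "real (2 * M + 1) * ?h = 2 * pi" by (simp_all add: grid_step_def add.commute)
  have card: "q \<le> real (card {k \<in> ?X. \<bar>f (node M s k)\<bar> > 1})" for s
  proof -
    have "y < real (card {k \<in> ?X. \<bar>f (node M s k)\<bar> > 1})" using neg by (simp add: y_def not_le)
    then have "\<lfloor>y\<rfloor> < int (card {k \<in> ?X. \<bar>f (node M s k)\<bar> > 1})" by linarith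
    then show ?thesis unfolding q_def by linarith
  qed
  note int = big_integrable[OF cont]
  have gper: "?g (t + 2 * pi) = ?g t" for t by (simp add: big_def indicator_def per)
  have sh: "(\<lambda>s. ?g (node M s k)) = ?g \<circ> ((+) (of_int k * ?h))" for k
    by (auto simp: node_def add.commute)
  have ints: "(\<lambda>s. ?g (node M s k)) integrable_on {0..?h}" for k
    unfolding sh using has_integral_shift_Icc_real[of ?g "of_int k * ?h" _ 0 ?h] int
    by (meson integrable_on_def)
  have "q * ?h = integral {0..?h} (\<lambda>s. q)" using h by simp
  also have "\<dots> \<le> integral {0..?h} (\<lambda>s. \<Sum>k\<in>?X. ?g (node M s k))"
  proof (rule integral_le)
    show "(\<lambda>s. \<Sum>k\<in>?X. ?g (node M s k)) integrable_on {0..?h}" by (intro integrable_sum ints) simp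
    fix s
    have "real (card {k \<in> ?X. \<bar>f (node M s k)\<bar> > 1}) = (\<Sum>k\<in>?X. if \<bar>f (node M s k)\<bar> > 1 then 1 else 0)"
      by (simp add: sum.If_cases Int_def)
    also have "\<dots> \<le> (\<Sum>k\<in>?X. ?g (node M s k))" by (intro sum_mono) (auto simp: big_def indicator_def)
    finally show "q \<le> (\<Sum>k\<in>?X. ?g (node M s k))" using card[of s] by linarith
  qed auto
  also have "\<dots> = (\<Sum>k\<in>?X. integral {0..?h} (\<lambda>s. ?g (node M s k)))"
    by (intro Henstock_Kurzweil_Integration.integral_sum ints) simp
  also have "\<dots> = (\<Sum>k\<in>?X. integral {of_int k * ?h..(of_int k + 1) * ?h} ?g)"
    unfolding sh integral_shift_Icc_real by (simp add: distrib_right add.commute)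
  also have "\<dots> = (\<Sum>j<2*M+1. integral {- real M * ?h + real j * ?h..- real M * ?h + (real j + 1) * ?h} ?g)"
    unfolding sum_int_symmetric_interval by (intro sum.cong refl) (simp add: algebra_simps)
  also have "\<dots> = integral {- real M * ?h..- real M * ?h + real (2 * M + 1) * ?h} ?g"
    using h by (intro integral_consecutive int) auto
  also have "\<dots> = mu f"
    unfolding h(2) mu_eq_integral_big[OF cont] by (rule integral_period[OF int _ gper]) simp
  finally have "q * ?h \<le> mu f" .
  moreover have "y * ?h = mu f" by (simp add: y_def grid_step_def add.commute)
  moreover have "y * ?h < q * ?h" using q h by simp
  ultimately show False by linarith
qed

lemma mu_lead_le:
  fixes n :: nat and a b :: "nat \<Rightarrow> real"
  assumes n: "n \<ge> 1"
  shows "mu (\<lambda>t. a n * cos (real n * t) + b n * sin (real n * t)) \<le> sqrt (2 * real n) * mu (trigpoly n a b)"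
proof -
  define A where amplitude: "A = sqrt ((a n)\<^sup>2 + (b n)\<^sup>2)"
  define m where "m = mu (trigpoly n a b)"
  obtain \<theta> where "\<And>x. a n * cos x + b n * sin x = A * cos (x - \<theta>)"
    using cos_sin_combination[of "a n" "b n"] unfolding amplitude by blast
  then have top: "mu (\<lambda>t. a n * cos (real n * t) + b n * sin (real n * t)) = (if A \<ge> 1 then 4 * arccos (1 / A) else 0)"
    using mu_cos_multiple[OF n, of A \<theta>] by (simp add: amplitude)
  have m0: "m \<ge> 0" by (simp add: m_def mu_def)
  let ?c = "sqrt (2 * real n)"
  have "4 * arccos (1 / A) \<le> ?c * m" if A: "A \<ge> 1"
  proof -
    have inv: "0 \<le> 1 / A" "1 / A \<le> 1" "- 1 \<le> 1 / A" using A by (auto simp: field_simps)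
    show ?thesis
    proof (cases "?c * (m / 4) \<le> pi / 2")
      \<comment> \<open>The right-hand side then exceeds \<open>2 * pi\<close>, the most that the
        left-hand side can be.\<close>
      case False
      moreover have "?c * m = 4 * (?c * (m / 4))" by simp
      ultimately show ?thesis using arccos_le_pi2[OF inv(1,2)] by linarith
    next
      case True
      have c1: "?c > 1" using n by simp
      have m2': "m < 2 * pi"
      proof (cases "m = 0")
        case False
        then have "1 * (m / 4) < ?c * (m / 4)" using c1 m0 by (intro mult_strict_right_mono) auto
        then show ?thesis using True by linarith
      qed simp
      interpret leading_coefficient n a b m
      proof
        show "sqrt ((a n)\<^sup>2 + (b n)\<^sup>2) > 0" using A by (simp only: amplitude)
        show "\<exists>s. real (card {k \<in> {- int M..int M}. \<bar>trigpoly n a b (node M s k)\<bar> > 1}) \<le> real (2 * M + 1) * m / (2 * pi)" for M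
          unfolding m_def by (intro exists_shift_few_large_nodes trigpoly_continuous trigpoly_periodic)
      qed (use n m0 m2' in auto)
      have "cos (m / 4) > 0" using m0 m2' by (intro cos_gt_zero_pi) auto
      then have cp: "cos (m / 4) ^ (2 * n) > 0" by simp
      have "A \<le> 1 / cos (m / 4) ^ (2 * n)" using lead_le unfolding A_def amplitude .
      then have "cos (m / 4) ^ (2 * n) \<le> 1 / A" using cp A by (simp add: field_simps)
      moreover have "cos (?c * (m / 4)) \<le> cos (m / 4) ^ (2 * n)"
        using cos_mult_le_cos_power[of "2 * n" "m / 4"] n m0 True by simp
      ultimately have "arccos (1 / A) \<le> arccos (cos (?c * (m / 4)))" using inv by (intro arccos_le_arccos) auto
      also have "\<dots> = ?c * (m / 4)"
      proof (rule arccos_cos)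
        show "0 \<le> ?c * (m / 4)" using m0 by simp
        show "?c * (m / 4) \<le> pi" using True pi_gt_zero by linarith
      qed
      finally show ?thesis by simp
    qed
  qed
  then show ?thesis unfolding top m_def[symmetric] using m0 by simp
qed

section \<open>Cosine polynomials with known leading coefficient, and the extremal ones\<close>

definition cos_poly :: "nat \<Rightarrow> real \<Rightarrow> (real \<Rightarrow> real) \<Rightarrow> bool" where
  "cos_poly n l f \<longleftrightarrow> (\<exists>c. (\<forall>t. f t = (\<Sum>k\<le>n. c k * cos (real k * t))) \<and> c n = l)"

lemma cos_poly_add: "cos_poly n l f \<Longrightarrow> cos_poly n l' g \<Longrightarrow> cos_poly n (l + l') (\<lambda>t. f t + g t)"
  unfolding cos_poly_def
proof (elim exE conjE)
  fix c d assume "\<forall>t. f t = (\<Sum>k\<le>n. c k * cos (real k * t))" "c n = l"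
    "\<forall>t. g t = (\<Sum>k\<le>n. d k * cos (real k * t))" "d n = l'"
  then show "\<exists>c. (\<forall>t. f t + g t = (\<Sum>k\<le>n. c k * cos (real k * t))) \<and> c n = l + l'"
    by (intro exI[of _ "\<lambda>k. c k + d k"]) (simp add: sum.distrib distrib_right)
qed

lemma cos_poly_cmult: "cos_poly n l f \<Longrightarrow> cos_poly n (x * l) (\<lambda>t. x * f t)"
  unfolding cos_poly_def
proof (elim exE conjE)
  fix c assume "\<forall>t. f t = (\<Sum>k\<le>n. c k * cos (real k * t))" "c n = l"
  then show "\<exists>c. (\<forall>t. x * f t = (\<Sum>k\<le>n. c k * cos (real k * t))) \<and> c n = x * l"
    by (intro exI[of _ "\<lambda>k. x * c k"]) (simp add: sum_distrib_left mult.assoc)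
qed

lemma cos_poly_cos: "k \<le> n \<Longrightarrow> cos_poly n (if k = n then 1 else 0) (\<lambda>t. cos (real k * t))"
  unfolding cos_poly_def
  by (intro exI[of _ "\<lambda>j. if k = j then 1 else 0"]) (auto simp: if_distrib[of "\<lambda>x. x * _"] cong: if_cong)

lemma cos_poly_sum:
  assumes "finite K" "\<And>k. k \<in> K \<Longrightarrow> cos_poly n (l k) (f k)"
  shows "cos_poly n (\<Sum>k\<in>K. l k) (\<lambda>t. \<Sum>k\<in>K. f k t)"
  using assms
proof (induction K)
  case empty
  show ?case unfolding cos_poly_def by (intro exI[of _ "\<lambda>k. 0"]) simp
next
  case (insert k K)
  have "cos_poly n (l k + (\<Sum>k\<in>K. l k)) (\<lambda>t. f k t + (\<Sum>k\<in>K. f k t))"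
    by (rule cos_poly_add) (use insert in auto)
  then show ?case using insert(1,2) by simp
qed

lemma cos_poly_raise: "cos_poly n l f \<Longrightarrow> cos_poly (Suc n) 0 f"
  unfolding cos_poly_def
proof (elim exE conjE)
  fix c assume "\<forall>t. f t = (\<Sum>k\<le>n. c k * cos (real k * t))"
  then show "\<exists>c. (\<forall>t. f t = (\<Sum>k\<le>Suc n. c k * cos (real k * t))) \<and> c (Suc n) = 0"
    by (intro exI[of _ "\<lambda>k. if k \<le> n then c k else 0"]) simp
qed

text \<open>\<open>n = 0\<close> is excluded because there multiplication by
  \<open>2 * cos t\<close> doubles the leading coefficient.\<close>

lemma cos_poly_times_cos:
  assumes "cos_poly n l f" "n \<ge> 1"
  shows "cos_poly (Suc n) l (\<lambda>t. 2 * cos t * f t)"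
proof -
  obtain c where c: "\<And>t. f t = (\<Sum>k\<le>n. c k * cos (real k * t))" "c n = l"
    using assms by (auto simp: cos_poly_def)
  \<comment> \<open>The index \<open>k - 1\<close> reflected at 0, as
    \<open>cos (- t) = cos t\<close>.\<close>
  define j where "j k = (if k = 0 then 1 else k - 1)" for k :: nat
  have prod: "2 * cos t * cos (real k * t) = cos (real (Suc k) * t) + cos (real (j k) * t)" for k t
  proof (cases k)
    case (Suc i)
    have "real (Suc k) * t = real k * t + t" "real (j k) * t = real k * t - t"
      using Suc by (simp_all add: j_def algebra_simps)
    then show ?thesis by (simp add: cos_add cos_diff)
  qed (simp add: j_def)
  have "cos_poly (Suc n) (\<Sum>k\<le>n. c k * ((if Suc k = Suc n then 1 else 0) + (if j k = Suc n then 1 else 0)))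
      (\<lambda>t. \<Sum>k\<le>n. c k * (cos (real (Suc k) * t) + cos (real (j k) * t)))"
    using assms(2) by (intro cos_poly_sum cos_poly_cmult cos_poly_add cos_poly_cos) (auto simp: j_def)
  moreover have "(\<Sum>k\<le>n. c k * ((if Suc k = Suc n then 1 else 0) + (if j k = Suc n then 1 else 0))) = (\<Sum>k\<le>n. if k = n then c k else 0)"
    using assms(2) by (intro sum.cong refl) (auto simp: j_def)
  moreover have "(\<lambda>t. \<Sum>k\<le>n. c k * (cos (real (Suc k) * t) + cos (real (j k) * t))) = (\<lambda>t. 2 * cos t * f t)"
    unfolding c(1) sum_distrib_left prod[symmetric] by (simp only: mult_ac)
  ultimately show ?thesis using c(2) by simp
qed

text \<open>The powers of 2 in the Chebyshev recurrence and in the linearisation of powers of the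
  cosine cancel. Two consecutive degrees are carried along; the lower one may have any leading
  coefficient, since the recurrence raises it by two orders.\<close>

lemma cheb_affine_cos:
  fixes p q :: real
  shows "(\<exists>l. cos_poly n l (\<lambda>t. cheb n (p + q * cos t) 1))
    \<and> cos_poly (Suc n) (q ^ Suc n) (\<lambda>t. cheb (Suc n) (p + q * cos t) 1)"
proof (induction n)
  case 0
  have "cos_poly 0 1 (\<lambda>t. 1)" using cos_poly_cos[of 0 0] by simp
  moreover have "cos_poly 1 (p * 0 + q * 1) (\<lambda>t. p * 1 + q * cos t)"
    using cos_poly_add[OF cos_poly_cmult[OF cos_poly_cos[of 0 1]] cos_poly_cmult[OF cos_poly_cos[of 1 1]], of p q] by simp
  ultimately show ?case by auto
next
  case (Suc n)
  let ?T = "\<lambda>n t. cheb n (p + q * cos t) 1"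
  obtain l where l: "cos_poly n l (?T n)" using Suc by blast
  have T: "cos_poly (Suc n) (q ^ Suc n) (?T (Suc n))" using Suc by blast
  have "cos_poly (Suc (Suc n)) (2 * p * 0 + q * q ^ Suc n + (- 1) * 0)
      (\<lambda>t. 2 * p * ?T (Suc n) t + q * (2 * cos t * ?T (Suc n) t) + (- 1) * ?T n t)"
    by (intro cos_poly_add cos_poly_cmult cos_poly_raise[OF T] cos_poly_times_cos[OF T]
        cos_poly_raise[OF cos_poly_raise[OF l]]) simp
  moreover have "(\<lambda>t. 2 * p * ?T (Suc n) t + q * (2 * cos t * ?T (Suc n) t) + (- 1) * ?T n t) = ?T (Suc (Suc n))"
    by (simp add: algebra_simps)
  ultimately show ?case using T by auto
qed

text \<open>The witness is \<open>\<mu>\<close> times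
  \<open>T\<^sub>n (2 * (cos (t / 2) / cos x)\<^sup>2 - 1)\<close>. For \<open>t\<close> outside the
  arc of half-length \<open>2 * x\<close> around 0 the argument lies in \<open>[- 1, 1]\<close>, and
  \<open>\<mu> < 1\<close> keeps the modulus strictly below 1 there.\<close>

lemma trigpoly_small_mu:
  fixes n :: nat
  assumes n: "n \<ge> 1" and x: "0 < x" "x < pi / 4" and \<mu>: "0 < \<mu>" "\<mu> < 1"
  obtains a b :: "nat \<Rightarrow> real" where "a n = \<mu> / cos x ^ (2 * n)" "b n = 0" "mu (trigpoly n a b) \<le> 4 * x"
proof -
  define q where "q = 1 / (cos x)\<^sup>2"
  have cx: "cos x > 0" using x by (intro cos_gt_zero_pi) auto
  have q0: "q > 0" using cx by (simp add: q_def)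
  obtain i where i: "n = Suc i" using n by (cases n) auto
  obtain c where c: "\<And>t. cheb n (q - 1 + q * cos t) 1 = (\<Sum>k\<le>n. c k * cos (real k * t))" "c n = q ^ n"
    using cheb_affine_cos[of i "q - 1" q] unfolding cos_poly_def i by blast
  \<comment> \<open>\<open>trigpoly\<close> halves the constant term, hence the factor 2.\<close>
  define a where "a k = (if k = 0 then 2 * \<mu> * c 0 else \<mu> * c k)" for k
  have f: "trigpoly n a (\<lambda>_. 0) t = \<mu> * cheb n (q - 1 + q * cos t) 1" for t
  proof -
    have "(\<Sum>k\<le>n. c k * cos (real k * t)) = c 0 + (\<Sum>k=1..n. c k * cos (real k * t))"
      by (simp add: atMost_atLeast0 sum.atLeast_Suc_atMost)
    then show ?thesis unfolding c(1) trigpoly_def by (simp add: a_def distrib_left sum_distrib_left mult.assoc)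
  qed
  have large: "cos t > cos (2 * x)" if "1 \<le> \<bar>trigpoly n a (\<lambda>_. 0) t\<bar>" for t
  proof (rule ccontr)
    assume "\<not> ?thesis"
    then have "cos t \<le> 2 * (cos x)\<^sup>2 - 1" by (simp add: cos_double_cos)
    then have "q * (1 + cos t) \<le> q * (2 * (cos x)\<^sup>2)" using q0 by (intro mult_left_mono) auto
    also have "\<dots> = 2" using cx by (simp add: q_def)
    finally have y1: "q - 1 + q * cos t \<le> 1" by (simp add: algebra_simps)
    have "0 \<le> 1 + cos t" using cos_ge_minus_one[of t] by linarith
    then have "0 \<le> q * (1 + cos t)" using q0 by simp
    then have y2: "- 1 \<le> q - 1 + q * cos t" by (simp add: algebra_simps)
    have "cheb n (q - 1 + q * cos t) 1 = cos (real n * arccos (q - 1 + q * cos t))"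
      using cheb_cos[of n 1 "arccos (q - 1 + q * cos t)"] y1 y2 by simp
    then have "\<bar>trigpoly n a (\<lambda>_. 0) t\<bar> \<le> \<mu> * 1"
      unfolding f abs_mult using \<mu> by (intro mult_mono) auto
    then show False using that \<mu> by simp
  qed
  have "mu (trigpoly n a (\<lambda>_. 0)) \<le> measure lebesgue ({0..2 * x} \<union> {2 * pi - 2 * x..2 * pi})"
    unfolding mu_def
  proof (rule measure_mono_fmeasurable)
    show "{0..2 * x} \<union> {2 * pi - 2 * x..2 * pi} \<in> lmeasurable" by (intro fmeasurable.Un) auto
    show "{t \<in> {0..<2 * pi}. 1 \<le> \<bar>trigpoly n a (\<lambda>_. 0) t\<bar>} \<in> sets lebesgue"
    proof -
      have e: "{t \<in> {0..<2 * pi}. 1 \<le> \<bar>trigpoly n a (\<lambda>_. 0) t\<bar>} = {0..<2 * pi} \<inter> {t. 1 \<le> \<bar>trigpoly n a (\<lambda>_. 0) t\<bar>}" by auto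
      have "closed {t. 1 \<le> \<bar>trigpoly n a (\<lambda>_. 0) t\<bar>}" by (intro closed_Collect_le continuous_intros)
      then have "{t. 1 \<le> \<bar>trigpoly n a (\<lambda>_. 0) t\<bar>} \<in> sets lebesgue" by (intro sets_completionI_sets lborelD borel_closed)
      then show ?thesis unfolding e by (intro sets.Int) simp_all
    qed
    show "{t \<in> {0..<2 * pi}. 1 \<le> \<bar>trigpoly n a (\<lambda>_. 0) t\<bar>} \<subseteq> {0..2 * x} \<union> {2 * pi - 2 * x..2 * pi}"
    proof
      fix t assume "t \<in> {t \<in> {0..<2 * pi}. 1 \<le> \<bar>trigpoly n a (\<lambda>_. 0) t\<bar>}"
      then have t: "0 \<le> t" "t < 2 * pi" and ct: "cos (2 * x) < cos t" using large by auto
      have mono: "s \<le> 2 * x" if "s \<le> pi" "cos (2 * x) < cos s" for s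
        by (rule ccontr) (use cos_monotone_0_pi_le[of "2 * x" s] that x in auto)
      show "t \<in> {0..2 * x} \<union> {2 * pi - 2 * x..2 * pi}"
      proof (cases "t \<le> pi")
        case True
        then have "t \<le> 2 * x" using ct by (rule mono)
        then show ?thesis using t by simp
      next
        case False
        have "cos (2 * pi - t) = cos t" by (simp add: cos_diff)
        then have "2 * pi - t \<le> 2 * x" using ct False by (intro mono) auto
        then show ?thesis using t by simp
      qed
    qed
  qed
  also have "\<dots> \<le> measure lebesgue {0..2 * x} + measure lebesgue {2 * pi - 2 * x..2 * pi}"
    by (rule measure_Un_le) auto
  also have "\<dots> = 4 * x" using x by simp
  finally have "mu (trigpoly n a (\<lambda>_. 0)) \<le> 4 * x" .
  moreover have "a n = \<mu> / cos x ^ (2 * n)"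
    using n by (simp add: a_def c(2) q_def power_divide power_mult)
  ultimately show thesis using that[of a "\<lambda>_. 0"] by simp
qed

theorem theorem9:
  fixes n :: nat
  assumes "n \<ge> 1"
  shows "sqrt (2 * real n) \<in> {\<beta>::real. \<forall>a b :: nat \<Rightarrow> real.
            mu (\<lambda>t. a n * cos (real n * t) + b n * sin (real n * t)) \<le> \<beta> * mu (trigpoly n a b)}
       \<and> (\<forall>\<beta>::real. (\<forall>a b :: nat \<Rightarrow> real.
            mu (\<lambda>t. a n * cos (real n * t) + b n * sin (real n * t)) \<le> \<beta> * mu (trigpoly n a b))
            \<longrightarrow> sqrt (2 * real n) \<le> \<beta>)"
proof (intro conjI allI impI CollectI)
  show "mu (\<lambda>t. a n * cos (real n * t) + b n * sin (real n * t)) \<le> sqrt (2 * real n) * mu (trigpoly n a b)"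
    for a b :: "nat \<Rightarrow> real"
    using assms by (rule mu_lead_le)
next
  fix \<beta> :: real
  assume \<beta>: "\<forall>a b :: nat \<Rightarrow> real.
    mu (\<lambda>t. a n * cos (real n * t) + b n * sin (real n * t)) \<le> \<beta> * mu (trigpoly n a b)"
  \<comment> \<open>The reciprocal of the leading amplitude of the test polynomial with
    \<open>\<mu> = 1 - x ^ 4\<close>. The defect \<open>x ^ 4\<close> keeps \<open>\<mu>\<close>
    below 1 and leaves the expansion up to order \<open>x\<^sup>2\<close> unchanged.\<close>
  let ?h = "\<lambda>x::real. cos x ^ (2 * n) / (1 - x ^ 4)"
  have ineq: "\<beta> \<ge> 0 \<and> (\<beta> * x \<le> pi \<longrightarrow> cos (\<beta> * x) \<le> ?h x)"
    if x: "0 < x" "x < pi / 4" "x < 1" and h1: "?h x < 1" for x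
  proof -
    have "x ^ 4 < 1" using x by (simp add: power_less_one_iff)
    then have \<mu>: "0 < 1 - x ^ 4" "1 - x ^ 4 < 1" using x by auto
    obtain a b where ab: "a n = (1 - x ^ 4) / cos x ^ (2 * n)" "b n = 0" "mu (trigpoly n a b) \<le> 4 * x"
      using trigpoly_small_mu[OF assms x(1,2) \<mu>] by blast
    have cx: "cos x > 0" using x by (intro cos_gt_zero_pi) auto
    have inv: "1 / a n = ?h x" by (simp add: ab)
    have h0: "0 < ?h x" using cx \<mu> by simp
    have an: "a n > 0" using cx \<mu> by (simp add: ab)
    have "a n \<ge> 1" using h1 an unfolding inv[symmetric] by (simp add: field_simps)
    then have "mu (\<lambda>t. a n * cos (real n * t) + b n * sin (real n * t)) = 4 * arccos (?h x)"
      using mu_cos_multiple[OF assms, of "a n" 0] an by (simp add: ab(2) inv)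
    then have le: "4 * arccos (?h x) \<le> \<beta> * mu (trigpoly n a b)" using \<beta> by metis
    have "arccos (?h x) > 0" using arccos_lt_bounded[of "?h x"] h0 h1 by auto
    then have "\<beta> * mu (trigpoly n a b) > 0" using le by linarith
    then have \<beta>0: "\<beta> > 0" by (metis measure_nonneg mu_def not_le mult_nonpos_nonneg not_less)
    have "\<beta> * mu (trigpoly n a b) \<le> \<beta> * (4 * x)" using ab(3) \<beta>0 by (intro mult_left_mono) auto
    then have "arccos (?h x) \<le> \<beta> * x" using le by simp
    moreover have "0 \<le> arccos (?h x)" "cos (arccos (?h x)) = ?h x" using h0 h1 by (auto intro: arccos_lbound)
    ultimately have "cos (\<beta> * x) \<le> ?h x" if "\<beta> * x \<le> pi"
      using that cos_monotone_0_pi_le[of "arccos (?h x)" "\<beta> * x"] by simp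
    with \<beta>0 show ?thesis by simp
  qed
  \<comment> \<open>The expansion starts with \<open>1 - n * x\<^sup>2\<close>, so
    \<open>?h x < 1\<close> for small \<open>x\<close>: the amplitude exceeds 1 and the leading
    harmonic has positive measure.\<close>
  have lim: "((\<lambda>x. (?h x - 1) / x\<^sup>2) \<longlongrightarrow> - real n) (at_right 0)" by real_asymp
  have "eventually (\<lambda>x. (?h x - 1) / x\<^sup>2 < 0) (at_right 0)"
    by (rule order_tendstoD(2)[OF lim]) (use assms in simp)
  \<comment> \<open>The last bound ensures \<open>\<beta> * x \<le> pi\<close>; adding 1 covers
    \<open>\<beta> = 0\<close>.\<close>
  moreover have "eventually (\<lambda>x::real. x \<in> {0<..<min (pi / 4) (min 1 (pi / (\<bar>\<beta>\<bar> + 1)))}) (at_right 0)"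
    by (rule eventually_at_right_real) auto
  ultimately have ev: "eventually (\<lambda>x. \<beta> \<ge> 0 \<and> (?h x - cos (\<beta> * x)) / x\<^sup>2 \<ge> 0) (at_right 0)"
  proof eventually_elim
    case (elim x)
    then have x: "0 < x" "x < pi / 4" "x < 1" "x < pi / (\<bar>\<beta>\<bar> + 1)" by auto
    have "?h x - 1 < 0" using elim x by (simp add: divide_less_0_iff)
    moreover have "\<beta> * x \<le> pi"
    proof -
      have "\<beta> * x \<le> (\<bar>\<beta>\<bar> + 1) * x" using x by (intro mult_right_mono) auto
      also have "\<dots> \<le> pi" using x(4) by (simp add: pos_less_divide_eq mult.commute)
      finally show ?thesis .
    qed
    ultimately show ?case using ineq[OF x(1-3)] by simp
  qed
  have "\<beta> \<ge> 0" using eventually_happens'[OF _ ev] by auto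
  \<comment> \<open>Second-order terms: \<open>\<beta>\<^sup>2 / 2\<close> from the cosine against
    \<open>n\<close> from \<open>?h\<close>, which is the source of \<open>2 * n\<close>.\<close>
  have "((\<lambda>x. (?h x - cos (\<beta> * x)) / x\<^sup>2) \<longlongrightarrow> \<beta> * \<beta> / 2 - real n) (at_right 0)" by real_asymp
  then have "0 \<le> \<beta> * \<beta> / 2 - real n"
    by (rule tendsto_lowerbound) (use ev in \<open>auto elim: eventually_mono\<close>)
  then have "2 * real n \<le> \<beta>\<^sup>2" by (simp add: power2_eq_square)
  then have "sqrt (2 * real n) \<le> sqrt (\<beta>\<^sup>2)" by (rule real_sqrt_le_mono)
  then show "sqrt (2 * real n) \<le> \<beta>" using \<open>\<beta> \<ge> 0\<close> by simp
qed

end
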